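(* Let $\mathcal{N}:x\mapsto\rho_x$ be a classical-quantum (CQ) channel with finite input alphabet $\mathcal{X}$ and output states $\rho_x$ on a finite-dimensional Hilbert space. For any $\alpha\in[\tfrac12,1]$, any probability distribution $p$ on $\mathcal{X}$, and any rate $r\ge 0$, \[ \lim_{n\to\infty}\frac{-1}{n}\log P_e^{(n)}(\mathcal{N},r)\;\ge\;\frac{1-\alpha}{\alpha}\bigl[I_{\alpha}(\mathcal{N},p)-r\bigr]. \]
   Context: For a sequence $x^n=(x_1,\dots,x_n)\in\mathcal{X}^n$ put $\rho_{x^n}=\rho_{x_1}\otimes\cdots\otimes\rho_{x_n}$. A code for $n$ uses of the channel with $M$ messages consists of codewords $x^n_1,\dots,x^n_M\in\mathcal{X}^n$ and a POVM $\{\Lambda_1,\dots,\Lambda_M\}$ on $\mathcal{H}^{\otimes n}$ ($\Lambda_m\ge0$, $\sum_m\Lambda_m=\mathbb{1}$); its rate is $\frac{\log M}{n}$ and its (average) error probability is $P_e=1-\frac1M\sum_{m=1}^M\operatorname{tr}[\Lambda_m\rho_{x^n_m}]$. $P_e^{(n)}(\mathcal{N},r)$ denotes the infimum of $P_e$ over all codes for $n$ uses with $M=2^{nr}$ messages. The Petz Rényi divergence is $D_\alpha(\rho\|\sigma)=\frac{1}{\alpha-1}\log\operatorname{tr}[\rho^\alpha\sigma^{1-\alpha}]$ (for $\rho\ll\sigma$). For a distribution $p$ on $\mathcal{X}$, with $\rho_{XB}=\sum_x p_x|x\rangle\langle x|\otimes\rho_x$ and $\rho_X=\sum_x p_x|x\rangle\langle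 x|$, define $I_\alpha(\mathcal{N},p)=\min_{\sigma_B}D_\alpha(\rho_{XB}\|\rho_X\otimes\sigma_B)$, the minimum over quantum states $\sigma_B$; for $\alpha\in(0,1)$ this equals $\frac{\alpha}{\alpha-1}\log\operatorname{tr}\bigl[(\sum_x p_x\rho_x^\alpha)^{1/\alpha}\bigr]$, and at $\alpha=1$ it is the usual (Umegaki) mutual information. *)

theory Defs
  imports Complex_Main "Jordan_Normal_Form.Matrix" "HOL-Library.Extended_Real"
begin

definition adj :: "complex mat \<Rightarrow> complex mat" where
  "adj A = mat (dim_col A) (dim_row A) (\<lambda>(i,j). cnj (A $$ (j,i)))"

definition mtrace :: "complex mat \<Rightarrow> complex" where
  "mtrace A = (\<Sum>i<dim_row A. A $$ (i,i))"

definition hermitian :: "nat \<Rightarrow> complex mat \<Rightarrow> bool" where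
  "hermitian d A \<longleftrightarrow> A \<in> carrier_mat d d \<and> adj A = A"

definition psd :: "nat \<Rightarrow> complex mat \<Rightarrow> bool" where
  "psd d A \<longleftrightarrow> hermitian d A \<and>
     (\<forall>v\<in>carrier_vec d. 0 \<le> Re (conjugate v \<bullet> (A *\<^sub>v v)))"

definition is_state :: "nat \<Rightarrow> complex mat \<Rightarrow> bool" where
  "is_state d \<rho> \<longleftrightarrow> psd d \<rho> \<and> mtrace \<rho> = 1"

definition unitary_mat :: "nat \<Rightarrow> complex mat \<Rightarrow> bool" where
  "unitary_mat d U \<longleftrightarrow> U \<in> carrier_mat d d \<and> adj U * U = 1\<^sub>m d"

definition diag_real :: "nat \<Rightarrow> (nat \<Rightarrow> real) \<Rightarrow> complex mat" where
  "diag_real d ls = mat d d (\<lambda>(i,j). if i = j then complex_of_real (ls i) else 0)"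

definition mat_fun :: "(real \<Rightarrow> real) \<Rightarrow> complex mat \<Rightarrow> complex mat" where
  "mat_fun f A = (SOME B. \<exists>U ls. unitary_mat (dim_row A) U \<and>
      A = U * diag_real (dim_row A) ls * adj U \<and>
      B = U * diag_real (dim_row A) (f \<circ> ls) * adj U)"

(* real powers, taken on the support (0 \<mapsto> 0) *)
definition mat_powr :: "complex mat \<Rightarrow> real \<Rightarrow> complex mat" where
  "mat_powr A a = mat_fun (\<lambda>x. if x > 0 then x powr a else 0) A"

(* natural logarithm, taken on the support *)
definition mat_ln :: "complex mat \<Rightarrow> complex mat" where
  "mat_ln A = mat_fun (\<lambda>x. if x > 0 then ln x else 0) A"

definition supp_le :: "nat \<Rightarrow> complex mat \<Rightarrow> complex mat \<Rightarrow> bool" where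
  "supp_le d \<rho> \<sigma> \<longleftrightarrow> (\<forall>v\<in>carrier_vec d. \<sigma> *\<^sub>v v = 0\<^sub>v d \<longrightarrow> \<rho> *\<^sub>v v = 0\<^sub>v d)"

(* Petz Renyi divergence (log base 2); at alpha = 1 the Umegaki relative entropy *)
definition petz_D :: "real \<Rightarrow> complex mat \<Rightarrow> complex mat \<Rightarrow> real" where
  "petz_D \<alpha> \<rho> \<sigma> =
    (if \<alpha> = 1 then Re (mtrace (\<rho> * (mat_ln \<rho> - mat_ln \<sigma>))) / ln 2
     else log 2 (Re (mtrace (mat_powr \<rho> \<alpha> * mat_powr \<sigma> (1 - \<alpha>)))) / (\<alpha> - 1))"

definition kron :: "complex mat \<Rightarrow> complex mat \<Rightarrow> complex mat" where
  "kron A B = mat (dim_row A * dim_row B) (dim_col A * dim_col B)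
     (\<lambda>(i,j). A $$ (i div dim_row B, j div dim_col B) * B $$ (i mod dim_row B, j mod dim_col B))"

definition msum :: "nat \<Rightarrow> nat \<Rightarrow> ('i \<Rightarrow> complex mat) \<Rightarrow> 'i set \<Rightarrow> complex mat" where
  "msum n m f I = mat n m (\<lambda>ij. \<Sum>x\<in>I. f x $$ ij)"

definition ket_proj :: "nat \<Rightarrow> nat \<Rightarrow> complex mat" where
  "ket_proj k x = mat k k (\<lambda>(i,j). if i = x \<and> j = x then 1 else 0)"

(* input alphabet is {0..<k}; channel x \<mapsto> \<rho> x, states on C^d *)
definition rho_X :: "nat \<Rightarrow> (nat \<Rightarrow> real) \<Rightarrow> complex mat" where
  "rho_X k p = msum k k (\<lambda>x. complex_of_real (p x) \<cdot>\<^sub>m ket_proj k x) {..<k}"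

definition rho_XB :: "nat \<Rightarrow> nat \<Rightarrow> (nat \<Rightarrow> complex mat) \<Rightarrow> (nat \<Rightarrow> real) \<Rightarrow> complex mat" where
  "rho_XB k d \<rho> p = msum (k*d) (k*d)
     (\<lambda>x. complex_of_real (p x) \<cdot>\<^sub>m kron (ket_proj k x) (\<rho> x)) {..<k}"

definition I_alpha :: "nat \<Rightarrow> nat \<Rightarrow> (nat \<Rightarrow> complex mat) \<Rightarrow> real \<Rightarrow> (nat \<Rightarrow> real) \<Rightarrow> real" where
  "I_alpha k d \<rho> \<alpha> p = Inf {petz_D \<alpha> (rho_XB k d \<rho> p) (kron (rho_X k p) \<sigma>) | \<sigma>.
      is_state d \<sigma> \<and> supp_le (k*d) (rho_XB k d \<rho> p) (kron (rho_X k p) \<sigma>)}"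

fun tensor_states :: "(nat \<Rightarrow> complex mat) \<Rightarrow> nat list \<Rightarrow> complex mat" where
  "tensor_states \<rho> [] = 1\<^sub>m 1"
| "tensor_states \<rho> (x # xs) = kron (\<rho> x) (tensor_states \<rho> xs)"

definition is_code :: "nat \<Rightarrow> nat \<Rightarrow> nat \<Rightarrow> nat \<Rightarrow> (nat \<Rightarrow> nat list) \<Rightarrow> (nat \<Rightarrow> complex mat) \<Rightarrow> bool" where
  "is_code k d n M cw \<Lambda> \<longleftrightarrow>
     (\<forall>m<M. length (cw m) = n \<and> set (cw m) \<subseteq> {..<k}) \<and>
     (\<forall>m<M. psd (d^n) (\<Lambda> m)) \<and>
     msum (d^n) (d^n) \<Lambda> {..<M} = 1\<^sub>m (d^n)"

definition code_error :: "(nat \<Rightarrow> complex mat) \<Rightarrow> nat \<Rightarrow> (nat \<Rightarrow> nat list) \<Rightarrow> (nat \<Rightarrow> complex mat) \<Rightarrow> real" where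
  "code_error \<rho> M cw \<Lambda> =
     1 - (1 / real M) * (\<Sum>m<M. Re (mtrace (\<Lambda> m * tensor_states \<rho> (cw m))))"

definition Pe_opt :: "nat \<Rightarrow> nat \<Rightarrow> (nat \<Rightarrow> complex mat) \<Rightarrow> nat \<Rightarrow> real \<Rightarrow> real" where
  "Pe_opt k d \<rho> n r = (let M = nat \<lceil>2 powr (real n * r)\<rceil> in
     Inf {code_error \<rho> M cw \<Lambda> | cw \<Lambda>. is_code k d n M cw \<Lambda>})"

end

theory Submission
  imports Defs "Jordan_Normal_Form.Schur_Decomposition" "Jordan_Normal_Form.Spectral_Radius"
    "HOL-Analysis.Analysis"
begin

text \<open>
  Put \<open>s = (1 - \<alpha>) / \<alpha>\<close>, so that \<open>1 + s = 1 / \<alpha>\<close>, and for a codebook let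
  \<open>B\<^sub>m\<close> be the \<open>\<alpha>\<close>-th power of the \<open>m\<close>-th output state, \<open>A = \<Sum>\<^sub>m B\<^sub>m\<close> and \<open>S\<^sub>m = A - B\<^sub>m\<close>.
  By duality for state discrimination, the optimal total success probability is, up to an
  arbitrarily small error, the trace of some \<open>K\<close> dominating all states \<open>B\<^sub>m\<^bsup>1+s\<^esup>\<close>.
  By Loewner-Heinz, \<open>T = K\<^bsup>1/(1+s)\<^esup>\<close> dominates all \<open>B\<^sub>m\<close>, and Klein's inequality gives
  \<open>tr K \<ge> (1 + s) tr (T A\<^bsup>s\<^esup>) - s tr A\<^bsup>1+s\<^esup>\<close>. Writing powers as integrals over resolvents one finds
  \<open>tr (T A\<^bsup>s\<^esup>) \<ge> tr A\<^bsup>1+s\<^esup> - \<Sum>\<^sub>m tr (B\<^sub>m S\<^sub>m\<^bsup>s\<^esup>)\<close>, whence the total error probability is at most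
  \<open>(1 + s) \<Sum>\<^sub>m tr (B\<^sub>m S\<^sub>m\<^bsup>s\<^esup>)\<close>. For a random codebook, operator concavity of \<open>x \<mapsto> x\<^bsup>s\<^esup>\<close> replaces
  \<open>S\<^sub>m\<close> by its mean, and the resulting quantity factorises over the channel uses into Gallager's function
  \<open>tr (\<Sum>\<^sub>x p\<^sub>x \<rho>\<^sub>x\<^bsup>\<alpha>\<^esup>)\<^bsup>1/\<alpha>\<^esup>\<close>, which is evaluated by inserting the normalised
  \<open>(\<Sum>\<^sub>x p\<^sub>x \<rho>\<^sub>x\<^bsup>\<alpha>\<^esup>)\<^bsup>1/\<alpha>\<^esup>\<close> as the state \<open>\<sigma>\<close> in the Renyi information.
\<close>

hide_type (open) Finite_Cartesian_Product.vec
hide_const (open) Finite_Cartesian_Product.vec Finite_Cartesian_Product.mat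
  Finite_Cartesian_Product.row inner
unbundle no vec_syntax

section \<open>Adjoints, traces and the spectral theorem\<close>

text \<open>The assumption \<alpha> \<ge> 1/2 is the same as s \<le> 1, the range in which x^s is
  operator monotone and operator concave. The obstacle is that the outputs do not commute, so no
  pointwise maximum likelihood rule is available as a decoder. Duality removes the need to name one:
  it suffices to bound the trace of an arbitrary dominating \<open>K\<close> from below. In that
  bound the competing terms B_m and S_m must be separated inside a function of A. This is possible
  for a kernel in which A stands linearly between two resolvents, and such a kernel integrates to
  x^s for s < 1. Operator inequalities are tested by pairing with positive matrices, so
  matrix-valued integrals never occur. The Renyi information is an infimum and is needed only from
  above, so a single candidate state settles it.\<close>

lemma mult_carrier_square[simp]:
  "A \<in> carrier_mat n n \<Longrightarrow> B \<in> carrier_mat n n \<Longrightarrow> A * B \<in> carrier_mat n n"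
  by (rule mult_carrier_mat)

lemma adj_dim[simp]: "dim_row (adj A) = dim_col A" "dim_col (adj A) = dim_row A"
  by (auto simp: adj_def)

lemma adj_carrier[simp]: "A \<in> carrier_mat n m \<Longrightarrow> adj A \<in> carrier_mat m n"
  by (auto simp: adj_def)

lemma adj_index[simp]: "i < dim_col A \<Longrightarrow> j < dim_row A \<Longrightarrow> adj A $$ (i,j) = cnj (A $$ (j,i))"
  by (auto simp: adj_def)

lemma adj_adj[simp]: "adj (adj A) = A"
  by (rule eq_matI) auto

lemma adj_one[simp]: "adj (1\<^sub>m n) = 1\<^sub>m n"
  by (rule eq_matI) auto

lemma index_mult_sum:
  assumes "i < dim_row A" "j < dim_col B" "dim_col A = dim_row B"
  shows "(A * B) $$ (i,j) = (\<Sum>l<dim_row B. A $$ (i,l) * B $$ (l,j))"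
  using assms by (auto simp: scalar_prod_def lessThan_atLeast0 intro!: sum.cong)

lemma adj_mult: "dim_col A = dim_row B \<Longrightarrow> adj (A * B) = adj B * adj A"
  by (rule eq_matI) (auto simp: index_mult_sum mult.commute intro!: sum.cong simp del: index_mult_mat(1))

lemma adj_add: "A \<in> carrier_mat n m \<Longrightarrow> B \<in> carrier_mat n m \<Longrightarrow> adj (A + B) = adj A + adj B"
  by (rule eq_matI) auto

lemma adj_minus: "A \<in> carrier_mat n m \<Longrightarrow> B \<in> carrier_mat n m \<Longrightarrow> adj (A - B) = adj A - adj B"
  by (rule eq_matI) auto

lemma adj_smult: "adj (c \<cdot>\<^sub>m A) = cnj c \<cdot>\<^sub>m adj A"
  by (rule eq_matI) auto

lemma mtrace_comm:
  assumes "A \<in> carrier_mat n m" "B \<in> carrier_mat m n"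
  shows "mtrace (A * B) = mtrace (B * A)"
proof -
  have "mtrace (A * B) = (\<Sum>i<n. \<Sum>l<m. A $$ (i,l) * B $$ (l,i))"
    unfolding mtrace_def using assms by (auto simp: index_mult_sum simp del: index_mult_mat(1))
  also have "\<dots> = (\<Sum>l<m. \<Sum>i<n. B $$ (l,i) * A $$ (i,l))"
    by (subst sum.swap) (simp add: mult.commute)
  also have "\<dots> = mtrace (B * A)"
    unfolding mtrace_def using assms by (auto simp: index_mult_sum simp del: index_mult_mat(1))
  finally show ?thesis .
qed

lemma mtrace_add: "A \<in> carrier_mat n n \<Longrightarrow> B \<in> carrier_mat n n \<Longrightarrow> mtrace (A + B) = mtrace A + mtrace B"
  by (auto simp: mtrace_def sum.distrib)

lemma mtrace_minus: "A \<in> carrier_mat n n \<Longrightarrow> B \<in> carrier_mat n n \<Longrightarrow> mtrace (A - B) = mtrace A - mtrace B"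
  by (auto simp: mtrace_def sum_subtractf)

lemma mtrace_smult: "A \<in> carrier_mat n n \<Longrightarrow> mtrace (c \<cdot>\<^sub>m A) = c * mtrace A"
  by (auto simp: mtrace_def sum_distrib_left)

lemma unitary_matD:
  assumes "unitary_mat d U"
  shows "U \<in> carrier_mat d d" "adj U \<in> carrier_mat d d" "adj U * U = 1\<^sub>m d" "U * adj U = 1\<^sub>m d"
  using assms mat_mult_left_right_inverse[of "adj U" d U] by (auto simp: unitary_mat_def)

lemma diag_real_carrier[simp]: "diag_real d l \<in> carrier_mat d d"
  and diag_real_dim[simp]: "dim_row (diag_real d l) = d" "dim_col (diag_real d l) = d"
  by (auto simp: diag_real_def)

lemma adj_diag_real[simp]: "adj (diag_real d l) = diag_real d l"
  by (rule eq_matI) (auto simp: diag_real_def)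

lemma diag_real_mult: "diag_real d l * diag_real d l' = diag_real d (\<lambda>i. l i * l' i)"
  by (rule eq_matI) (auto simp: index_mult_sum diag_real_def if_distrib[of "\<lambda>x. x * _"] cong: if_cong simp del: index_mult_mat(1))

lemma unitary_mat_mult:
  assumes "unitary_mat d U" "unitary_mat d V"
  shows "unitary_mat d (U * V)"
proof -
  note U = unitary_matD[OF assms(1)] and V = unitary_matD[OF assms(2)]
  have "adj (U * V) * (U * V) = adj V * (adj U * (U * V))"
    using U(1,2) V(1,2) by (simp add: adj_mult assoc_mult_mat[of _ d d _ d _ d])
  also have "adj U * (U * V) = V"
    using U V by (simp add: assoc_mult_mat[of _ d d _ d _ d, symmetric])
  finally show ?thesis using U V by (simp add: unitary_mat_def)
qed

text \<open>Feeds the deflation step of the spectral theorem. Gram-Schmidt returns orthogonal,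
  unnormalised vectors and keeps the first one, so dividing by the norms \<open>sqrt (g i)\<close>
  merely rescales \<open>v\<close>.\<close>

lemma unitary_with_first_column:
  fixes v :: "complex vec"
  assumes v: "v \<in> carrier_vec n" and v0: "v \<noteq> 0\<^sub>v n"
  obtains W c where "unitary_mat n W" "col W 0 = c \<cdot>\<^sub>v v"
proof -
  have n: "n \<noteq> 0" using v v0 by (intro notI) auto
  interpret cof_vec_space n "TYPE(complex)" .
  define b where "b = basis_completion v"
  define ws where "ws = gram_schmidt n b"
  from basis_completion[OF v v0, folded b_def]
  have dist_b: "distinct b" and indep: "\<not> lin_dep (set b)" and b: "set b \<subseteq> carrier_vec n"
    and hdb: "hd b = v" and len_b: "length b = n" by auto
  from hdb len_b n obtain vs where bv: "b = v # vs" by (cases b) auto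
  from gram_schmidt_result[OF b dist_b indep refl, folded ws_def]
  have ws: "set ws \<subseteq> carrier_vec n" "corthogonal ws" "length ws = n"
    by (auto simp: len_b)
  from gram_schmidt_hd[OF v, of vs, folded bv] have hdws: "hd ws = v" unfolding ws_def .
  define g where "g i = (\<Sum>k<n. (cmod (ws ! i $ k))\<^sup>2)" for i
  have wsn: "ws ! i \<in> carrier_vec n" if "i < n" for i using ws that by auto
  have ip: "ws ! i \<bullet>c ws ! j = (\<Sum>k<n. ws ! i $ k * cnj (ws ! j $ k))" if "i < n" "j < n" for i j
    using wsn[OF that(1)] wsn[OF that(2)] by (auto simp: scalar_prod_def lessThan_atLeast0)
  have gi: "ws ! i \<bullet>c ws ! i = complex_of_real (g i)" if "i < n" for i
    unfolding ip[OF that that] g_def of_real_sum complex_norm_square ..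
  have gpos: "g i > 0" if "i < n" for i
  proof -
    have "ws ! i \<bullet>c ws ! i \<noteq> 0" using corthogonalD[OF ws(2), of i i] that ws by auto
    hence "g i \<noteq> 0" using gi[OF that] by auto
    moreover have "g i \<ge> 0" unfolding g_def by (simp add: sum_nonneg)
    ultimately show ?thesis by simp
  qed
  define W where "W = mat n n (\<lambda>(k,i). complex_of_real (1 / sqrt (g i)) * ws ! i $ k)"
  have W: "W \<in> carrier_mat n n" by (simp add: W_def)
  have "adj W * W = 1\<^sub>m n"
  proof (rule eq_matI)
    fix i j assume ij: "i < dim_row (1\<^sub>m n :: complex mat)" "j < dim_col (1\<^sub>m n :: complex mat)"
    hence i: "i < n" and j: "j < n" by auto
    have "(adj W * W) $$ (i,j) = (\<Sum>k<n. cnj (W $$ (k,i)) * W $$ (k,j))"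
      using i j W by (simp add: index_mult_sum del: index_mult_mat(1))
    also have "\<dots> = complex_of_real (1 / sqrt (g i) * (1 / sqrt (g j))) * (ws ! j \<bullet>c ws ! i)"
      using i j by (simp add: ip W_def sum_distrib_left sum_divide_distrib mult_ac)
    also have "\<dots> = (1\<^sub>m n :: complex mat) $$ (i,j)"
    proof (cases "i = j")
      case True
      have "complex_of_real (1 / sqrt (g i) * (1 / sqrt (g i))) * complex_of_real (g i) = 1"
        using gpos[OF i] by (simp flip: of_real_mult)
      thus ?thesis using True i gi[OF i] by simp
    next
      case False
      thus ?thesis using corthogonalD[OF ws(2), of j i] i j ws by auto
    qed
    finally show "(adj W * W) $$ (i,j) = (1\<^sub>m n :: complex mat) $$ (i,j)" .
  qed (use W in auto)
  hence uW: "unitary_mat n W" using W by (simp add: unitary_mat_def)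
  have "ws ! 0 = v" using hdws ws(3) n by (cases ws) auto
  hence "col W 0 = complex_of_real (1 / sqrt (g 0)) \<cdot>\<^sub>v v"
    using n v by (intro eq_vecI) (auto simp: W_def)
  with uW show ?thesis using that by blast
qed

text \<open>Deflation: conjugating by a unitary whose first column is an eigenvector clears the rest
  of the first column, and Hermiticity then clears the rest of the first row. The remaining block is
  Hermitian of one dimension less.\<close>

lemma spectral_theorem:
  assumes "hermitian d A"
  shows "\<exists>U l. unitary_mat d U \<and> A = U * diag_real d l * adj U"
  using assms
proof (induction d arbitrary: A)
  case 0
  hence "A = 1\<^sub>m 0 * diag_real 0 (\<lambda>_. 0) * adj (1\<^sub>m 0)"
    by (intro eq_matI) (auto simp: hermitian_def)
  moreover have "unitary_mat 0 (1\<^sub>m 0)" by (auto simp: unitary_mat_def)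
  ultimately show ?case by blast
next
  case (Suc n)
  let ?n = "Suc n"
  from Suc.prems have A: "A \<in> carrier_mat ?n ?n" and hA: "adj A = A" by (auto simp: hermitian_def)
  from spectrum_non_empty[OF A] obtain e where "eigenvalue A e" by (auto simp: spectrum_def)
  then obtain v where "eigenvector A v e" by (auto simp: eigenvalue_def)
  hence v: "v \<in> carrier_vec ?n" "v \<noteq> 0\<^sub>v ?n" and Av: "A *\<^sub>v v = e \<cdot>\<^sub>v v"
    using A by (auto simp: eigenvector_def)
  obtain W c where uW: "unitary_mat ?n W" and W0: "col W 0 = c \<cdot>\<^sub>v v"
    using unitary_with_first_column[OF v] by blast
  note W = unitary_matD[OF uW]
  define A' where "A' = adj W * A * W"
  have A': "A' \<in> carrier_mat ?n ?n" using W A by (simp add: A'_def)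
  have hA': "adj A' = A'"
    using W A hA by (simp add: A'_def adj_mult assoc_mult_mat[of _ ?n ?n _ ?n _ ?n])
  have AW0: "col (A * W) 0 = e \<cdot>\<^sub>v col W 0"
  proof -
    have "col (A * W) 0 = A *\<^sub>v col W 0" using A W by (intro eq_vecI) auto
    also have "\<dots> = e \<cdot>\<^sub>v col W 0"
      unfolding W0 using mult_mat_vec[OF A v(1), of c] Av v by (simp add: smult_smult_assoc mult.commute)
    finally show ?thesis .
  qed
  have col0: "A' $$ (i,0) = (if i = 0 then e else 0)" if i: "i < ?n" for i
  proof -
    have "A' $$ (i,0) = row (adj W) i \<bullet> col (A * W) 0"
      using A W i by (simp add: A'_def assoc_mult_mat[of _ ?n ?n _ ?n _ ?n])
    also have "\<dots> = e * (row (adj W) i \<bullet> col W 0)"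
      unfolding AW0 using A W i by simp
    also have "row (adj W) i \<bullet> col W 0 = (adj W * W) $$ (i,0)" using W(1) i by simp
    also have "adj W * W = 1\<^sub>m ?n" by (rule W(3))
    finally show ?thesis using i by simp
  qed
  have row0: "A' $$ (0,j) = (if j = 0 then cnj e else 0)" if j: "j < ?n" for j
  proof -
    have "A' $$ (0,j) = cnj (A' $$ (j,0))" using A' j by (subst hA'[symmetric]) simp
    thus ?thesis using col0[OF j] by simp
  qed
  \<comment> \<open>Column and row give \<open>e\<close> and \<open>cnj e\<close> for the same
    corner entry, so the eigenvalue is real, as \<open>diag_real\<close> requires.\<close>
  have e: "e = complex_of_real (Re e)"
    using col0[of 0] row0[of 0] by (simp add: complex_eq_iff)
  define A2 where "A2 = mat n n (\<lambda>(i,j). A' $$ (Suc i, Suc j))"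
  have hA2: "cnj (A' $$ (Suc j, Suc i)) = A' $$ (Suc i, Suc j)" if "i < n" "j < n" for i j
    using A' that by (subst (2) hA'[symmetric]) simp
  have "adj A2 = A2"
    by (rule eq_matI) (simp_all add: A2_def hA2)
  hence "hermitian n A2" by (simp add: hermitian_def) (simp add: A2_def)
  from Suc.IH[OF this] obtain U2 l2 where uU2: "unitary_mat n U2"
    and A2: "A2 = U2 * diag_real n l2 * adj U2" by blast
  note U2 = unitary_matD[OF uU2]
  define U where "U = four_block_mat (1\<^sub>m 1) (0\<^sub>m 1 n) (0\<^sub>m n 1) U2"
  have U: "U \<in> carrier_mat ?n ?n" using U2 by (auto simp: U_def)
  have adjU: "adj U = four_block_mat (1\<^sub>m 1) (0\<^sub>m 1 n) (0\<^sub>m n 1) (adj U2)"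
    using U2 by (intro eq_matI) (auto simp: U_def)
  have uU: "unitary_mat ?n U"
  proof -
    have "adj U * U = four_block_mat (1\<^sub>m 1) (0\<^sub>m 1 n) (0\<^sub>m n 1) (1\<^sub>m n)"
      unfolding adjU unfolding U_def
      using U2 by (subst mult_four_block_mat[of _ 1 1 _ n _ n _ _ 1 _ n]) auto
    also have "\<dots> = 1\<^sub>m ?n" by (intro eq_matI) auto
    finally show ?thesis using U by (simp add: unitary_mat_def)
  qed
  define l where "l i = (if i = 0 then Re e else l2 (i - 1))" for i
  have D: "diag_real ?n l = four_block_mat (e \<cdot>\<^sub>m 1\<^sub>m 1) (0\<^sub>m 1 n) (0\<^sub>m n 1) (diag_real n l2)"
    using e by (intro eq_matI) (auto simp: diag_real_def l_def)
  have "U * diag_real ?n l * adj U = four_block_mat (e \<cdot>\<^sub>m 1\<^sub>m 1) (0\<^sub>m 1 n) (0\<^sub>m n 1) A2"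
    unfolding adjU D A2 unfolding U_def using U2
    by (subst mult_four_block_mat[of _ 1 1 _ n _ n _ _ 1 _ n],
        auto)(subst mult_four_block_mat[of _ 1 1 _ n _ n _ _ 1 _ n], auto)
  also have "\<dots> = A'"
  proof (rule eq_matI)
    fix i j assume "i < dim_row A'" "j < dim_col A'"
    hence "i < ?n" "j < ?n" using A' by auto
    thus "four_block_mat (e \<cdot>\<^sub>m 1\<^sub>m 1) (0\<^sub>m 1 n) (0\<^sub>m n 1) A2 $$ (i,j) = A' $$ (i,j)"
      using e col0[of i] row0[of j] by (auto simp: A2_def)
  qed (use A' in \<open>auto simp: A2_def\<close>)
  finally have UA': "U * diag_real ?n l * adj U = A'" .
  note U = unitary_matD[OF uU]
  have "(W * U) * diag_real ?n l * adj (W * U) = W * (U * diag_real ?n l * adj U) * adj W"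
    using U W by (simp add: adj_mult assoc_mult_mat[of _ ?n ?n _ ?n _ ?n])
  also have "\<dots> = (W * adj W) * A * (W * adj W)"
    unfolding UA' A'_def using W(1,2) A by (simp add: assoc_mult_mat[of _ ?n ?n _ ?n _ ?n])
  also have "\<dots> = A" using W A by simp
  finally show ?case using unitary_mat_mult[OF uW uU] by metis
qed

section \<open>Functional calculus\<close>

text \<open>\<open>mat_fun\<close> selects some diagonalisation by \<open>SOME\<close>, so
  independence of the choice is what makes it usable. The change of basis \<open>W\<close> between
  two diagonalisations intertwines the two diagonals. Read entrywise, \<open>W\<close> vanishes
  wherever the eigenvalues differ, hence it also intertwines their images under
  \<open>f\<close>.\<close>

lemma mat_fun_eq:
  assumes uU: "unitary_mat d U" and A: "A = U * diag_real d l * adj U"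
  shows "mat_fun f A = U * diag_real d (f \<circ> l) * adj U"
proof -
  note U = unitary_matD[OF uU]
  have dA: "dim_row A = d" using U by (simp add: A)
  have "\<exists>B U l. unitary_mat d U \<and> A = U * diag_real d l * adj U \<and> B = U * diag_real d (f \<circ> l) * adj U"
    using uU A by blast
  from someI_ex[OF this] obtain V m where uV: "unitary_mat d V"
    and AV: "A = V * diag_real d m * adj V" and B: "mat_fun f A = V * diag_real d (f \<circ> m) * adj V"
    unfolding mat_fun_def dA by auto
  note V = unitary_matD[OF uV]
  note as = assoc_mult_mat[of _ d d _ d _ d]
  define W where "W = adj V * U"
  have W: "W \<in> carrier_mat d d" using U V by (simp add: W_def)
  have "W * diag_real d l = adj V * (U * diag_real d l * adj U) * U"
    using U V by (simp add: W_def as)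
  also have "\<dots> = (adj V * V) * diag_real d m * (adj V * U)"
    unfolding A[symmetric] AV using U(1,2) V(1,2) by (simp add: as)
  also have "\<dots> = diag_real d m * W" using U V by (simp add: W_def)
  finally have eq: "W * diag_real d l = diag_real d m * W" .
  have ent: "(W * diag_real d h) $$ (i,j) = W $$ (i,j) * h j"
    "(diag_real d h * W) $$ (i,j) = h i * W $$ (i,j)" if "i < d" "j < d" for i j h
    using that W by (auto simp: index_mult_sum diag_real_def if_distrib[of "\<lambda>x. _ * x"]
        if_distrib[of "\<lambda>x. x * _"] cong: if_cong simp del: index_mult_mat(1))
  have eqf: "W * diag_real d (f \<circ> l) = diag_real d (f \<circ> m) * W"
  proof (rule eq_matI)
    fix i j assume "i < dim_row (diag_real d (f \<circ> m) * W)" "j < dim_col (diag_real d (f \<circ> m) * W)"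
    hence ij: "i < d" "j < d" using W by auto
    have "W $$ (i,j) * l j = m i * W $$ (i,j)"
      using arg_cong[OF eq, of "\<lambda>X. X $$ (i,j)"] ent[OF ij, of l] ent[OF ij, of m] by simp
    hence "W $$ (i,j) = 0 \<or> l j = m i" by auto
    thus "(W * diag_real d (f \<circ> l)) $$ (i,j) = (diag_real d (f \<circ> m) * W) $$ (i,j)"
      by (auto simp: ent[OF ij])
  qed (use W in auto)
  have "U * diag_real d (f \<circ> l) * adj U = (V * adj V) * U * diag_real d (f \<circ> l) * adj U"
    using U V by simp
  also have "\<dots> = V * (W * diag_real d (f \<circ> l)) * adj U"
    using U(1,2) V(1,2) by (simp add: W_def as)
  also have "\<dots> = V * diag_real d (f \<circ> m) * (W * adj U)"
    unfolding eqf using U(1,2) V(1,2) W by (simp add: as)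
  also have "W * adj U = adj V"
    unfolding W_def using U V by (simp add: as)
  finally show ?thesis unfolding B by (rule sym)
qed

lemma hermitian_carrier[simp]: "hermitian d A \<Longrightarrow> A \<in> carrier_mat d d"
  by (simp add: hermitian_def)

lemma psdI:
  "hermitian d A \<Longrightarrow> (\<And>v. v \<in> carrier_vec d \<Longrightarrow> 0 \<le> Re (conjugate v \<bullet> (A *\<^sub>v v))) \<Longrightarrow> psd d A"
  unfolding psd_def by blast

lemma psd_quadratic_form: "psd d A \<Longrightarrow> v \<in> carrier_vec d \<Longrightarrow> 0 \<le> Re (conjugate v \<bullet> (A *\<^sub>v v))"
  unfolding psd_def by blast

lemma psd_hermitian[simp]: "psd d A \<Longrightarrow> hermitian d A"
  unfolding psd_def by blast

lemma psd_carrier[simp]: "psd d A \<Longrightarrow> A \<in> carrier_mat d d"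
  by simp

lemma psd_adj: "psd d A \<Longrightarrow> adj A = A"
  using psd_hermitian unfolding hermitian_def by blast

lemma hermitian_spectral:
  assumes "hermitian d A"
  obtains U l where "unitary_mat d U" "A = U * diag_real d l * adj U"
    "\<And>f. mat_fun f A = U * diag_real d (f \<circ> l) * adj U"
  using spectral_theorem[OF assms] mat_fun_eq by blast

lemma hermitian_conj_diag_real:
  "unitary_mat d U \<Longrightarrow> hermitian d (U * diag_real d l * adj U)"
  using unitary_matD[of d U]
  by (simp add: hermitian_def adj_mult assoc_mult_mat[of _ d d _ d _ d])

lemma mat_fun_hermitian[simp]: "hermitian d A \<Longrightarrow> hermitian d (mat_fun f A)"
  by (metis hermitian_spectral hermitian_conj_diag_real)

lemma mat_fun_carrier[simp]: "hermitian d A \<Longrightarrow> mat_fun f A \<in> carrier_mat d d"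
  by (simp add: hermitian_carrier)

lemma mat_fun_comp:
  assumes "hermitian d A" shows "mat_fun g (mat_fun f A) = mat_fun (\<lambda>x. g (f x)) A"
proof -
  obtain U l where U: "unitary_mat d U" and f: "\<And>f. mat_fun f A = U * diag_real d (f \<circ> l) * adj U"
    using hermitian_spectral[OF assms] by blast
  show ?thesis unfolding mat_fun_eq[OF U f[of f], of g] f[of "\<lambda>x. g (f x)"] by (simp add: comp_def)
qed

lemma mat_fun_mult:
  assumes "hermitian d A" shows "mat_fun f A * mat_fun g A = mat_fun (\<lambda>x. f x * g x) A"
proof -
  obtain U l where uU: "unitary_mat d U" and f: "\<And>f. mat_fun f A = U * diag_real d (f \<circ> l) * adj U"
    using hermitian_spectral[OF assms] by blast
  note U = unitary_matD[OF uU]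
  have "mat_fun f A * mat_fun g A = U * diag_real d (f \<circ> l) * (adj U * U) * diag_real d (g \<circ> l) * adj U"
    unfolding f using U(1,2) by (simp add: assoc_mult_mat[of _ d d _ d _ d])
  also have "\<dots> = U * (diag_real d (f \<circ> l) * diag_real d (g \<circ> l)) * adj U"
    using U by (simp add: assoc_mult_mat[of _ d d _ d _ d])
  finally show ?thesis unfolding f by (simp add: diag_real_mult comp_def)
qed

lemma mat_fun_id: assumes "hermitian d A" shows "mat_fun (\<lambda>x. x) A = A"
proof -
  obtain U l where "A = U * diag_real d l * adj U" "\<And>f. mat_fun f A = U * diag_real d (f \<circ> l) * adj U"
    using hermitian_spectral[OF assms] by blast
  thus ?thesis by (simp add: comp_def)
qed

lemma mat_fun_one: assumes "hermitian d A" shows "mat_fun (\<lambda>x. 1) A = 1\<^sub>m d"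
proof -
  obtain U l where uU: "unitary_mat d U" and f: "\<And>f. mat_fun f A = U * diag_real d (f \<circ> l) * adj U"
    using hermitian_spectral[OF assms] by blast
  have "diag_real d (\<lambda>_. 1) = 1\<^sub>m d" by (rule eq_matI) (auto simp: diag_real_def)
  thus ?thesis using unitary_matD[OF uU] by (simp add: f comp_def)
qed

lemma mat_fun_add:
  assumes "hermitian d A" shows "mat_fun (\<lambda>x. f x + g x) A = mat_fun f A + mat_fun g A"
proof -
  obtain U l where uU: "unitary_mat d U" and f: "\<And>f. mat_fun f A = U * diag_real d (f \<circ> l) * adj U"
    using hermitian_spectral[OF assms] by blast
  note U = unitary_matD[OF uU]
  have D: "diag_real d ((\<lambda>x. f x + g x) \<circ> l) = diag_real d (f \<circ> l) + diag_real d (g \<circ> l)"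
    by (rule eq_matI) (auto simp: diag_real_def)
  show ?thesis unfolding f D using U(1,2)
    by (simp add: add_mult_distrib_mat[of _ d d _ _ d] mult_add_distrib_mat[of _ d d _ d])
qed

lemma mat_fun_cmult:
  assumes "hermitian d A" shows "mat_fun (\<lambda>x. c * f x) A = complex_of_real c \<cdot>\<^sub>m mat_fun f A"
proof -
  obtain U l where uU: "unitary_mat d U" and f: "\<And>f. mat_fun f A = U * diag_real d (f \<circ> l) * adj U"
    using hermitian_spectral[OF assms] by blast
  note U = unitary_matD[OF uU]
  have D: "diag_real d ((\<lambda>x. c * f x) \<circ> l) = complex_of_real c \<cdot>\<^sub>m diag_real d (f \<circ> l)"
    by (rule eq_matI) (auto simp: diag_real_def)
  show ?thesis unfolding f D using U(1,2)
    by (simp add: mult_smult_assoc_mat[of _ d d _ d] mult_smult_distrib[of _ d d _ d])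
qed

section \<open>Positive semidefinite matrices and the trace pairing\<close>

lemma quadratic_form_eq:
  assumes "v \<in> carrier_vec d" "A \<in> carrier_mat d d"
  shows "conjugate v \<bullet> (A *\<^sub>v v) = (\<Sum>i<d. \<Sum>j<d. cnj (v $ i) * A $$ (i,j) * v $ j)"
  using assms by (auto simp: scalar_prod_def lessThan_atLeast0 sum_distrib_left mult.assoc intro!: sum.cong)

lemma quadratic_form_gram:
  assumes X: "X \<in> carrier_mat d m" and v: "v \<in> carrier_vec d"
  shows "conjugate v \<bullet> ((X * adj X) *\<^sub>v v)
    = complex_of_real (\<Sum>k<m. (cmod (\<Sum>i<d. cnj (v $ i) * X $$ (i,k)))\<^sup>2)"
proof -
  have C: "X * adj X \<in> carrier_mat d d" using X by auto
  have "conjugate v \<bullet> ((X * adj X) *\<^sub>v v)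
      = (\<Sum>i<d. \<Sum>j<d. \<Sum>k<m. cnj (v $ i) * (X $$ (i,k) * cnj (X $$ (j,k))) * v $ j)"
    unfolding quadratic_form_eq[OF v C] using X
    by (auto simp: index_mult_sum sum_distrib_left sum_distrib_right intro!: sum.cong simp del: index_mult_mat(1))
  also have "\<dots> = (\<Sum>k<m. \<Sum>i<d. \<Sum>j<d. cnj (v $ i) * (X $$ (i,k) * cnj (X $$ (j,k))) * v $ j)"
    by (rule sym, subst sum.swap, rule sum.cong[OF refl], rule sum.swap)
  also have "\<dots> = (\<Sum>k<m. (\<Sum>i<d. cnj (v $ i) * X $$ (i,k)) * cnj (\<Sum>i<d. cnj (v $ i) * X $$ (i,k)))"
    by (simp only: cnj_sum sum_product) (intro sum.cong refl, simp add: mult_ac)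
  also have "\<dots> = complex_of_real (\<Sum>k<m. (cmod (\<Sum>i<d. cnj (v $ i) * X $$ (i,k)))\<^sup>2)"
    unfolding of_real_sum complex_norm_square ..
  finally show ?thesis .
qed

lemma psd_gram:
  assumes X: "X \<in> carrier_mat d m" shows "psd d (X * adj X)"
proof (rule psdI)
  show "hermitian d (X * adj X)" using X by (auto simp: hermitian_def adj_mult)
qed (simp add: quadratic_form_gram[OF X] sum_nonneg)

text \<open>A diagonal entry of X* A X is the quadratic form of \<open>A\<close> at a column of
  \<open>X\<close>. With \<open>X\<close> unitary this makes eigenvalues nonnegative; with
  \<open>X\<close> a factor of a second positive matrix it makes the trace of the product
  nonnegative.\<close>

lemma psd_conj_diag_nonneg:
  assumes "psd d A" "X \<in> carrier_mat d m" "k < m"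
  shows "0 \<le> Re ((adj X * A * X) $$ (k,k))"
proof -
  have v: "col X k \<in> carrier_vec d" using assms by auto
  have A: "A \<in> carrier_mat d d" using assms by simp
  have "(adj X * A * X) $$ (k,k) = (\<Sum>j<d. \<Sum>i<d. cnj (X $$ (i,k)) * A $$ (i,j) * X $$ (j,k))"
    using carrier_matD[OF A] carrier_matD[OF assms(2)] assms(3)
    by (auto simp: index_mult_sum sum_distrib_right simp del: index_mult_mat(1))
  also have "\<dots> = conjugate (col X k) \<bullet> (A *\<^sub>v col X k)"
    unfolding quadratic_form_eq[OF v A] using assms by (subst sum.swap) simp
  finally show ?thesis using psd_quadratic_form[OF assms(1) v] by simp
qed

lemma psd_spectral:
  assumes "psd d A"
  obtains U l where "unitary_mat d U" "A = U * diag_real d l * adj U"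
    "\<And>f. mat_fun f A = U * diag_real d (f \<circ> l) * adj U" "\<And>i. 0 \<le> l i"
proof -
  obtain U l where uU: "unitary_mat d U" and A: "A = U * diag_real d l * adj U"
    using spectral_theorem[OF psd_hermitian[OF assms]] by blast
  note U = unitary_matD[OF uU]
  have "adj U * A * U = (adj U * U) * diag_real d l * (adj U * U)"
    unfolding A using U(1,2) by (simp add: assoc_mult_mat[of _ d d _ d _ d])
  also have "\<dots> = diag_real d l" using U by simp
  finally have pos: "0 \<le> l i" if "i < d" for i
    using psd_conj_diag_nonneg[OF assms U(1) that] that by (simp add: diag_real_def)
  \<comment> \<open>Values of \<open>l\<close> beyond \<open>d\<close> are arbitrary. Setting them
    to zero gives nonnegativity at every index, so later uses carry no side condition
    \<open>i < d\<close>.\<close>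
  define l' where "l' i = (if i < d then l i else 0)" for i
  have "diag_real d l = diag_real d l'" by (rule eq_matI) (auto simp: diag_real_def l'_def)
  with A have "A = U * diag_real d l' * adj U" by simp
  moreover have "0 \<le> l' i" for i using pos by (simp add: l'_def)
  ultimately show ?thesis using that[OF uU] mat_fun_eq[OF uU] by blast
qed

lemma psd_conj_diag_real:
  assumes uU: "unitary_mat d U" and l: "\<And>i. i < d \<Longrightarrow> 0 \<le> l i"
  shows "psd d (U * diag_real d l * adj U)"
proof -
  note U = unitary_matD[OF uU]
  let ?s = "diag_real d (\<lambda>i. sqrt (l i))"
  have "?s * ?s = diag_real d l" unfolding diag_real_mult
    by (rule eq_matI) (use l in \<open>auto simp: diag_real_def simp flip: of_real_mult\<close>)
  hence "U * diag_real d l * adj U = (U * ?s) * adj (U * ?s)"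
    using U(1,2) by (simp add: adj_mult assoc_mult_mat[of _ d d _ d _ d]) (simp add: assoc_mult_mat[of _ d d _ d _ d, symmetric])
  thus ?thesis using psd_gram[of "U * ?s" d d] U by simp
qed

lemma mat_fun_psd:
  assumes "psd d A" "\<And>x. 0 \<le> x \<Longrightarrow> 0 \<le> f x" shows "psd d (mat_fun f A)"
proof -
  obtain U l where "unitary_mat d U" "\<And>f. mat_fun f A = U * diag_real d (f \<circ> l) * adj U" "\<And>i. 0 \<le> l i"
    using psd_spectral[OF assms(1)] by blast
  thus ?thesis using assms(2) by (simp add: psd_conj_diag_real)
qed

lemma mat_fun_cong:
  assumes "psd d A" "\<And>x. 0 \<le> x \<Longrightarrow> f x = g x" shows "mat_fun f A = mat_fun g A"
proof -
  obtain U l where "unitary_mat d U" "\<And>f. mat_fun f A = U * diag_real d (f \<circ> l) * adj U" "\<And>i. 0 \<le> l i"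
    using psd_spectral[OF assms(1)] by blast
  moreover from this(3) have "f \<circ> l = g \<circ> l" using assms(2) by auto
  ultimately show ?thesis by simp
qed

lemma psd_factor:
  assumes "psd d A" obtains X where "X \<in> carrier_mat d d" "A = X * adj X"
proof -
  let ?X = "mat_fun sqrt A"
  have "?X * ?X = mat_fun (\<lambda>x. x) A"
    unfolding mat_fun_mult[OF psd_hermitian[OF assms]] by (rule mat_fun_cong[OF assms]) simp
  moreover have "adj ?X = ?X" by (rule psd_adj[OF mat_fun_psd[OF assms]]) simp
  ultimately show ?thesis using that[of ?X] assms by (simp add: mat_fun_id[of d])
qed

lemma psd_conj:
  assumes "psd d A" "Y \<in> carrier_mat n d" shows "psd n (Y * A * adj Y)"
proof -
  obtain X where X: "X \<in> carrier_mat d d" "A = X * adj X" using psd_factor[OF assms(1)] .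
  have "Y * A * adj Y = (Y * X) * adj (Y * X)"
    using X assms by (simp add: adj_mult assoc_mult_mat[of _ n d _ d _ n] assoc_mult_mat[of _ n d _ d _ d]
      assoc_mult_mat[of _ d d _ d _ n] mult_carrier_mat[of _ d d _ n])
  thus ?thesis using psd_gram[of "Y * X" n d] X assms(2) by (simp add: mult_carrier_mat[of _ n d])
qed

text \<open>On Hermitian arguments this is the Hilbert-Schmidt inner product. The functionals
  \<open>rtr P\<close> with \<open>P\<close> positive encode the operator order by real
  numbers.\<close>

definition rtr :: "complex mat \<Rightarrow> complex mat \<Rightarrow> real" where
  "rtr A B = Re (mtrace (A * B))"

lemma rtr_comm: "A \<in> carrier_mat n m \<Longrightarrow> B \<in> carrier_mat m n \<Longrightarrow> rtr A B = rtr B A"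
  by (simp add: rtr_def mtrace_comm)

lemma rtr_psd_nonneg:
  assumes "psd d A" "psd d B" shows "0 \<le> rtr A B"
proof -
  obtain X where X: "X \<in> carrier_mat d d" "A = X * adj X" using psd_factor[OF assms(1)] .
  have "rtr A B = Re (mtrace (X * (adj X * B)))"
    unfolding rtr_def X(2) using X assms by (simp add: assoc_mult_mat[of _ d d _ d _ d])
  also have "\<dots> = Re (mtrace (adj X * B * X))" using X assms by (simp add: mtrace_comm[of X d d])
  also have "\<dots> = (\<Sum>i<d. Re ((adj X * B * X) $$ (i,i)))"
    using X by (simp add: mtrace_def)
  also have "\<dots> \<ge> 0" using psd_conj_diag_nonneg[OF assms(2) X(1)] by (intro sum_nonneg) auto
  finally show ?thesis .
qed

lemma rtr_add_right: "P \<in> carrier_mat d d \<Longrightarrow> A \<in> carrier_mat d d \<Longrightarrow> B \<in> carrier_mat d d \<Longrightarrow>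
    rtr P (A + B) = rtr P A + rtr P B"
  by (simp add: rtr_def mult_add_distrib_mat[of _ d d _ d] mtrace_add[of _ d])

lemma rtr_minus_right: "P \<in> carrier_mat d d \<Longrightarrow> A \<in> carrier_mat d d \<Longrightarrow> B \<in> carrier_mat d d \<Longrightarrow>
    rtr P (A - B) = rtr P A - rtr P B"
  by (simp add: rtr_def mult_minus_distrib_mat[of _ d d _ d] mtrace_minus[of _ d])

lemma rtr_smult_right: "P \<in> carrier_mat d d \<Longrightarrow> A \<in> carrier_mat d d \<Longrightarrow>
    rtr P (complex_of_real c \<cdot>\<^sub>m A) = c * rtr P A"
  by (simp add: rtr_def mult_smult_distrib[of _ d d _ d] mtrace_smult[of _ d])

lemma msum_carrier[simp]: "msum n m f I \<in> carrier_mat n m"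
  by (simp add: msum_def)

lemma msum_dim[simp]: "dim_row (msum n m f I) = n" "dim_col (msum n m f I) = m"
  by (simp_all add: msum_def)

lemma rtr_eq: "A \<in> carrier_mat d d \<Longrightarrow> B \<in> carrier_mat d d \<Longrightarrow>
    rtr A B = Re (\<Sum>i<d. \<Sum>j<d. A $$ (i,j) * B $$ (j,i))"
  by (simp add: rtr_def mtrace_def index_mult_sum del: index_mult_mat(1))

lemma rtr_msum_right:
  assumes "P \<in> carrier_mat d d" "\<And>i. i \<in> I \<Longrightarrow> f i \<in> carrier_mat d d"
  shows "rtr P (msum d d f I) = (\<Sum>i\<in>I. rtr P (f i))"
proof -
  have "(\<Sum>x\<in>I. rtr P (f x)) = (\<Sum>x\<in>I. Re (\<Sum>i<d. \<Sum>j<d. P $$ (i,j) * f x $$ (j,i)))"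
    using assms by (simp add: rtr_eq[of _ d])
  also have "\<dots> = Re (\<Sum>i<d. \<Sum>j<d. \<Sum>x\<in>I. P $$ (i,j) * f x $$ (j,i))"
    by (simp only: Re_sum) (subst sum.swap[of _ _ I], rule sum.cong[OF refl], rule sum.swap)
  also have "\<dots> = rtr P (msum d d f I)"
    using assms by (simp add: rtr_eq[of _ d] msum_def sum_distrib_left)
  finally show ?thesis ..
qed

text \<open>The witness is the rank-one matrix v v*; it turns a quadratic form into a trace pairing,
  which is linear in \<open>A\<close>.\<close>

lemma quadratic_form_rtr:
  assumes v: "v \<in> carrier_vec d"
  obtains P where "psd d P"
    "\<And>A. A \<in> carrier_mat d d \<Longrightarrow> Re (conjugate v \<bullet> (A *\<^sub>v v)) = rtr P A"
proof -
  define X where "X = mat d 1 (\<lambda>(i,j). v $ i)"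
  have X: "X \<in> carrier_mat d 1" by (simp add: X_def)
  have XX: "X * adj X = mat d d (\<lambda>(i,j). v $ i * cnj (v $ j))"
    by (rule eq_matI) (auto simp: X_def index_mult_sum simp del: index_mult_mat(1))
  have "Re (conjugate v \<bullet> (A *\<^sub>v v)) = rtr (X * adj X) A" if A: "A \<in> carrier_mat d d" for A
  proof -
    have "conjugate v \<bullet> (A *\<^sub>v v) = (\<Sum>i<d. \<Sum>j<d. v $ i * cnj (v $ j) * A $$ (j,i))"
      unfolding quadratic_form_eq[OF v A] by (subst sum.swap) (simp add: mult_ac)
    thus ?thesis unfolding XX using A by (simp add: rtr_eq[of _ d])
  qed
  with psd_gram[OF X] show ?thesis using that by blast
qed

text \<open>Self-duality of the positive cone: the rank-one test matrices among the \<open>P\<close>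
  already recover every quadratic form. \<open>rtr_psd_nonneg\<close> is the converse
  direction.\<close>

lemma psdI_rtr:
  assumes A: "hermitian d A" and pos: "\<And>P. psd d P \<Longrightarrow> 0 \<le> rtr P A"
  shows "psd d A"
proof (rule psdI[OF A])
  fix v :: "complex vec" assume "v \<in> carrier_vec d"
  from quadratic_form_rtr[OF this] obtain P where "psd d P" "Re (conjugate v \<bullet> (A *\<^sub>v v)) = rtr P A"
    using A by (metis hermitian_carrier)
  thus "0 \<le> Re (conjugate v \<bullet> (A *\<^sub>v v))" using pos by simp
qed

text \<open>With A = X X* the quadratic form is the squared norm of X* v, so if it vanishes then X*
  v is already zero.\<close>

lemma psd_mult_vec_eq_0:
  assumes A: "psd d A" and v: "v \<in> carrier_vec d" and z: "Re (conjugate v \<bullet> (A *\<^sub>v v)) = 0"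
  shows "A *\<^sub>v v = 0\<^sub>v d"
proof -
  obtain X where X: "X \<in> carrier_mat d d" "A = X * adj X" using psd_factor[OF A] .
  have "(\<Sum>k<d. (cmod (\<Sum>i<d. cnj (v $ i) * X $$ (i,k)))\<^sup>2) = 0"
    using z unfolding X(2) quadratic_form_gram[OF X(1) v] by simp
  hence k: "(\<Sum>i<d. cnj (v $ i) * X $$ (i,k)) = 0" if "k < d" for k
    using that by (simp add: sum_nonneg_eq_0_iff)
  have "adj X *\<^sub>v v = 0\<^sub>v d"
  proof (rule eq_vecI)
    fix i assume "i < dim_vec (0\<^sub>v d :: complex vec)"
    hence i: "i < d" by simp
    have "(adj X *\<^sub>v v) $ i = cnj (\<Sum>j<d. cnj (v $ j) * X $$ (j,i))"
      using X(1) v i by (auto simp: scalar_prod_def lessThan_atLeast0 mult.commute intro!: sum.cong)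
    thus "(adj X *\<^sub>v v) $ i = 0\<^sub>v d $ i" using k[OF i] i by simp
  qed (use X in auto)
  thus ?thesis unfolding X(2) using assoc_mult_mat_vec[of X d d "adj X" d v] X(1) v by auto
qed

text \<open>The weights are the diagonal of \<open>P\<close> in an eigenbasis of \<open>A\<close>
  and do not depend on \<open>f\<close>. Integral formulas that hold at each eigenvalue therefore
  carry over to the trace as finite linear combinations.\<close>

lemma rtr_mat_fun:
  assumes A: "psd d A" and P: "P \<in> carrier_mat d d"
  obtains w l where "\<And>f. rtr P (mat_fun f A) = (\<Sum>i<d. w i * f (l i))"
    "\<And>i. 0 \<le> l i" "psd d P \<Longrightarrow> (\<And>i. i < d \<Longrightarrow> 0 \<le> w i)"
proof -
  obtain U l where uU: "unitary_mat d U" and f: "\<And>f. mat_fun f A = U * diag_real d (f \<circ> l) * adj U"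
    and l: "\<And>i. 0 \<le> l i"
    using psd_spectral[OF A] by blast
  note U = unitary_matD[OF uU]
  define w where "w i = Re ((adj U * P * U) $$ (i,i))" for i
  have "rtr P (mat_fun f A) = (\<Sum>i<d. w i * f (l i))" for f
  proof -
    have "rtr P (mat_fun f A) = Re (mtrace ((P * U * diag_real d (f \<circ> l)) * adj U))"
      unfolding rtr_def f using U(1,2) P by (simp add: assoc_mult_mat[of _ d d _ d _ d])
    also have "\<dots> = Re (mtrace (adj U * (P * U * diag_real d (f \<circ> l))))"
      using U(1,2) P by (subst mtrace_comm[of _ d d]) auto
    also have "\<dots> = rtr (adj U * P * U) (diag_real d (f \<circ> l))"
      unfolding rtr_def using U(1,2) P by (simp add: assoc_mult_mat[of _ d d _ d _ d])
    also have "\<dots> = (\<Sum>i<d. w i * f (l i))"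
      using U(1,2) P by (simp add: rtr_eq[of _ d] diag_real_def w_def if_distrib[of "\<lambda>x. _ * x"] cong: if_cong)
    finally show ?thesis .
  qed
  with l show ?thesis using that[of w l] psd_conj_diag_nonneg[OF _ U(1)] by (auto simp: w_def)
qed

text \<open>The weight \<open>w i j\<close> is the squared overlap of the i-th eigenvector of
  \<open>A\<close> with the j-th eigenvector of \<open>B\<close>. Trace inequalities for two
  non-commuting matrices thereby reduce to inequalities between two numbers.\<close>

lemma rtr_mat_fun_mat_fun:
  assumes A: "psd d A" and B: "psd d B"
  obtains w a b where "\<And>f g. rtr (mat_fun f A) (mat_fun g B) = (\<Sum>i<d. \<Sum>j<d. w i j * (f (a i) * g (b j)))"
    "\<And>i. 0 \<le> a i" "\<And>j. 0 \<le> b j" "\<And>i j. 0 \<le> w i j"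
proof -
  obtain U a where uU: "unitary_mat d U" and f: "\<And>f. mat_fun f A = U * diag_real d (f \<circ> a) * adj U"
    and a: "\<And>i. 0 \<le> a i"
    using psd_spectral[OF A] by blast
  obtain V b where uV: "unitary_mat d V" and g: "\<And>f. mat_fun f B = V * diag_real d (f \<circ> b) * adj V"
    and b: "\<And>i. 0 \<le> b i"
    using psd_spectral[OF B] by blast
  note U = unitary_matD[OF uU] and V = unitary_matD[OF uV]
  define W where "W = adj U * V"
  have W: "W \<in> carrier_mat d d" using U V by (simp add: W_def)
  have adjW: "adj W = adj V * U" using U V by (simp add: W_def adj_mult)
  define w where "w i j = (cmod (W $$ (i,j)))\<^sup>2" for i j
  have "rtr (mat_fun f A) (mat_fun g B) = (\<Sum>i<d. \<Sum>j<d. w i j * (f (a i) * g (b j)))" for f g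
  proof -
    let ?F = "diag_real d (f \<circ> a)" and ?G = "diag_real d (g \<circ> b)"
    have "rtr (mat_fun f A) (mat_fun g B) = Re (mtrace (U * (?F * W * ?G * adj V)))"
      unfolding rtr_def f g W_def using U(1,2) V(1,2) by (simp add: assoc_mult_mat[of _ d d _ d _ d])
    also have "\<dots> = Re (mtrace (?F * W * ?G * adj V * U))"
      using U(1,2) V(1,2) W by (subst mtrace_comm[of _ d d]) auto
    also have "\<dots> = rtr (?F * W) (?G * adj W)"
      unfolding rtr_def adjW using U(1,2) V(1,2) W by (simp add: assoc_mult_mat[of _ d d _ d _ d])
    also have "\<dots> = Re (\<Sum>i<d. \<Sum>j<d. (f (a i) * W $$ (i,j)) * (g (b j) * cnj (W $$ (i,j))))"
      using W by (simp add: rtr_eq[of _ d] index_mult_sum diag_real_def if_distrib[of "\<lambda>x. x * _"]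
        cong: if_cong del: index_mult_mat(1))
    also have "\<dots> = Re (\<Sum>i<d. \<Sum>j<d. complex_of_real (f (a i) * g (b j)) * complex_of_real (w i j))"
      unfolding w_def complex_norm_square by (simp add: mult_ac)
    finally show ?thesis by (simp add: mult_ac)
  qed
  with a b show ?thesis using that[of w a b] by (auto simp: w_def)
qed

declare minus_carrier_mat[simp]

section \<open>Resolvents\<close>

definition resolvent :: "real \<Rightarrow> complex mat \<Rightarrow> complex mat" where
  "resolvent c A = mat_fun (\<lambda>x. 1 / (x + c)) A"

lemma resolvent_psd: "psd d A \<Longrightarrow> 0 < c \<Longrightarrow> psd d (resolvent c A)"
  unfolding resolvent_def by (rule mat_fun_psd) auto

lemma mat_fun_shift:
  "psd d A \<Longrightarrow> mat_fun (\<lambda>x. x + c) A = A + complex_of_real c \<cdot>\<^sub>m 1\<^sub>m d"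
  using mat_fun_add[of d A "\<lambda>x. x" "\<lambda>_. c * 1"] mat_fun_cmult[of d A c "\<lambda>_. 1"]
  by (simp add: mat_fun_id[of d] mat_fun_one[of d])

lemma resolvent_mult:
  assumes A: "psd d A" and c: "0 < c"
  shows "resolvent c A * (A + complex_of_real c \<cdot>\<^sub>m 1\<^sub>m d) = 1\<^sub>m d"
    and "(A + complex_of_real c \<cdot>\<^sub>m 1\<^sub>m d) * resolvent c A = 1\<^sub>m d"
proof -
  have 1: "mat_fun (\<lambda>x. 1 / (x + c) * (x + c)) A = mat_fun (\<lambda>_. 1) A"
    "mat_fun (\<lambda>x. (x + c) * (1 / (x + c))) A = mat_fun (\<lambda>_. 1) A"
    using c by (intro mat_fun_cong[OF A]; simp)+
  show "resolvent c A * (A + complex_of_real c \<cdot>\<^sub>m 1\<^sub>m d) = 1\<^sub>m d"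
    and "(A + complex_of_real c \<cdot>\<^sub>m 1\<^sub>m d) * resolvent c A = 1\<^sub>m d"
    unfolding resolvent_def mat_fun_shift[OF A, symmetric] mat_fun_mult[OF psd_hermitian[OF A]] 1
    using A by (simp_all add: mat_fun_one[of d])
qed

lemma rtr_sandwich:
  assumes "S \<in> carrier_mat d d" "R \<in> carrier_mat d d" "B \<in> carrier_mat d d"
  shows "rtr S (R * B * R) = rtr B (R * S * R)"
proof -
  have "rtr S (R * B * R) = rtr (S * R) (B * R)"
    using assms by (simp add: rtr_def assoc_mult_mat[of _ d d _ d _ d])
  also have "\<dots> = rtr (B * R) (S * R)" using assms by (simp add: rtr_comm[of _ d d])
  also have "\<dots> = rtr B (R * S * R)"
    using assms by (simp add: rtr_def assoc_mult_mat[of _ d d _ d _ d])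
  finally show ?thesis .
qed

text \<open>With \<open>R = (X + c)\<^sup>-\<^sup>1\<close> and \<open>Q = (Y + c)\<^sup>-\<^sup>1\<close>, this is positivity of
  \<open>(R - Q) (X + c) (R - Q) = R - Q - Q (Y - X) Q\<close>.\<close>

lemma resolvent_tangent:
  assumes X: "psd d X" and Y: "psd d Y" and P: "psd d P" and c: "0 < c"
  shows "rtr P (resolvent c Y) + rtr P (resolvent c Y * (Y - X) * resolvent c Y) \<le> rtr P (resolvent c X)"
proof -
  define R where "R = resolvent c X"
  define Q where "Q = resolvent c Y"
  define Z where "Z = X + complex_of_real c \<cdot>\<^sub>m 1\<^sub>m d"
  define Z' where "Z' = Y + complex_of_real c \<cdot>\<^sub>m 1\<^sub>m d"
  have pR: "psd d R" and pQ: "psd d Q" unfolding R_def Q_def by (intro resolvent_psd X Y c)+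
  have Zf: "Z = mat_fun (\<lambda>x. x + c) X" unfolding Z_def mat_fun_shift[OF X] ..
  have pZ: "psd d Z" unfolding Zf by (rule mat_fun_psd[OF X]) (use c in simp)
  have C: "R \<in> carrier_mat d d" "Q \<in> carrier_mat d d" "Z \<in> carrier_mat d d" "P \<in> carrier_mat d d"
    "X \<in> carrier_mat d d" "Y \<in> carrier_mat d d" "Z' \<in> carrier_mat d d" "Y - X \<in> carrier_mat d d"
    using pR pQ pZ P X Y psd_carrier[OF X] psd_carrier[OF Y] by (auto simp: Z'_def)
  note as = assoc_mult_mat[of _ d d _ d _ d]
  have RZ: "R * Z = 1\<^sub>m d" "Z * R = 1\<^sub>m d" unfolding R_def Z_def by (rule resolvent_mult[OF X c])+
  have QZ: "Q * Z' = 1\<^sub>m d" unfolding Q_def Z'_def by (rule resolvent_mult[OF Y c])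
  have a: "adj (R - Q) = R - Q" using C pR pQ by (simp add: adj_minus[of _ d d] psd_adj)
  have "psd d ((R - Q) * Z * adj (R - Q))" using C by (intro psd_conj[OF pZ]) auto
  hence "0 \<le> rtr P ((R - Q) * Z * (R - Q))" using rtr_psd_nonneg[OF P] a by simp
  also have "(R - Q) * Z * (R - Q) = (R - Q) - (Q - Q * Z * Q)"
  proof -
    have "(R - Q) * Z = 1\<^sub>m d - Q * Z" using C RZ by (simp add: minus_mult_distrib_mat[of _ d d _ _ d])
    hence "(R - Q) * Z * (R - Q) = (1\<^sub>m d - Q * Z) * (R - Q)" by simp
    also have "\<dots> = 1\<^sub>m d * (R - Q) - Q * Z * (R - Q)"
      using C by (intro minus_mult_distrib_mat[of _ d d _ _ d]) auto
    also have "Q * Z * (R - Q) = Q * Z * R - Q * Z * Q"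
      using C by (intro mult_minus_distrib_mat[of _ d d _ d]) auto
    also have "Q * Z * R = Q" using C RZ by (simp add: as)
    finally show ?thesis using C by simp
  qed
  also have "rtr P \<dots> = rtr P R - 2 * rtr P Q + rtr P (Q * Z * Q)"
    using C by (simp add: rtr_minus_right[of _ d])
  also have "Q * Z * Q = Q - Q * (Y - X) * Q"
  proof -
    have "Z = Z' - (Y - X)" using C by (intro eq_matI) (auto simp: Z_def Z'_def)
    hence "Q * Z = 1\<^sub>m d - Q * (Y - X)" using C QZ by (simp add: mult_minus_distrib_mat[of _ d d _ d])
    thus ?thesis using C by (simp add: minus_mult_distrib_mat[of _ d d _ _ d])
  qed
  also have "rtr P \<dots> = rtr P Q - rtr P (Q * (Y - X) * Q)"
    using C by (simp add: rtr_minus_right[of _ d])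
  finally show ?thesis unfolding R_def Q_def by simp
qed

lemma mat_fun_frac:
  assumes A: "psd d A" and c: "0 < c" and P: "P \<in> carrier_mat d d"
  shows "rtr P (mat_fun (\<lambda>x. x / (x + c)) A) = rtr P (1\<^sub>m d) - c * rtr P (resolvent c A)"
proof -
  have "mat_fun (\<lambda>x. x / (x + c)) A = mat_fun (\<lambda>x. 1 + (- c) * (1 / (x + c))) A"
    using c by (intro mat_fun_cong[OF A]) (simp add: field_simps)
  also have "\<dots> = 1\<^sub>m d + complex_of_real (- c) \<cdot>\<^sub>m resolvent c A"
    using A unfolding resolvent_def by (simp only: mat_fun_add[of d A] mat_fun_cmult[of d A] mat_fun_one[of d A] psd_hermitian)
  finally show ?thesis using P psd_carrier[OF resolvent_psd[OF A c]]
    by (simp only: rtr_add_right[of _ d] rtr_smult_right[of _ d] one_carrier_mat smult_carrier_mat)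
qed

lemma mat_fun_frac_square:
  assumes A: "psd d A" and c: "0 < c"
  shows "mat_fun (\<lambda>x. x / (x + c)\<^sup>2) A = resolvent c A * A * resolvent c A"
proof -
  have "resolvent c A * A * resolvent c A = mat_fun (\<lambda>x. 1 / (x + c)) A * mat_fun (\<lambda>x. x) A * mat_fun (\<lambda>x. 1 / (x + c)) A"
    using A by (simp add: resolvent_def mat_fun_id[of d A])
  also have "\<dots> = mat_fun (\<lambda>x. 1 / (x + c) * x * (1 / (x + c))) A"
    using A by (simp only: mat_fun_mult[of d A] psd_hermitian)
  finally show ?thesis by (simp add: power2_eq_square)
qed

text \<open>The tangent inequality at \<open>Y\<close> has a nonnegative first-order term when X
  \<le> Y, so the resolvent is antitone. Since x / (x + c) = 1 - c / (x + c), the order is reversed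
  once more.\<close>

lemma frac_mono:
  assumes X: "psd d X" and Y: "psd d Y" and XY: "psd d (Y - X)" and P: "psd d P" and c: "0 < c"
  shows "rtr P (mat_fun (\<lambda>x. x / (x + c)) X) \<le> rtr P (mat_fun (\<lambda>x. x / (x + c)) Y)"
proof -
  let ?Q = "resolvent c Y"
  have Q: "psd d ?Q" by (rule resolvent_psd[OF Y c])
  have "psd d (?Q * (Y - X) * ?Q)" using psd_conj[OF XY psd_carrier[OF Q]] by (simp add: psd_adj[OF Q])
  hence "0 \<le> rtr P (?Q * (Y - X) * ?Q)" by (rule rtr_psd_nonneg[OF P])
  hence "rtr P (resolvent c Y) \<le> rtr P (resolvent c X)"
    using resolvent_tangent[OF X Y P c] by simp
  thus ?thesis using c P by (simp add: mat_fun_frac[OF X c] mat_fun_frac[OF Y c])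
qed

text \<open>Jensen's inequality from the supporting tangent of the convex resolvent at the mean. The
  mean is specified by its pairings, the form in which averages over codebooks are
  available.\<close>

lemma frac_concave:
  assumes S: "\<And>i. i \<in> I \<Longrightarrow> psd d (S i)" and w: "\<And>i. i \<in> I \<Longrightarrow> 0 \<le> w i"
    and w1: "sum w I = 1" and Sb: "psd d Sb"
    and Sb_eq: "\<And>P. P \<in> carrier_mat d d \<Longrightarrow> rtr P Sb = (\<Sum>i\<in>I. w i * rtr P (S i))"
    and P: "psd d P" and c: "0 < c"
  shows "(\<Sum>i\<in>I. w i * rtr P (mat_fun (\<lambda>x. x / (x + c)) (S i))) \<le> rtr P (mat_fun (\<lambda>x. x / (x + c)) Sb)"
proof -
  define Q where "Q = resolvent c Sb"
  have pQ: "psd d Q" unfolding Q_def by (rule resolvent_psd[OF Sb c])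
  define K where "K = Q * P * Q"
  have C: "Q \<in> carrier_mat d d" "P \<in> carrier_mat d d" "Sb \<in> carrier_mat d d" "K \<in> carrier_mat d d"
    using pQ P Sb by (simp_all add: K_def)
  have t: "rtr P Q + (rtr K Sb - rtr K (S i)) \<le> rtr P (resolvent c (S i))" if "i \<in> I" for i
  proof -
    have Si: "S i \<in> carrier_mat d d" using S[OF that] by simp
    hence "rtr P (Q * (Sb - S i) * Q) = rtr K (Sb - S i)"
      unfolding K_def using C by (subst rtr_sandwich[of _ d]) (auto simp: rtr_comm[of _ d d])
    also have "\<dots> = rtr K Sb - rtr K (S i)" using C Si by (simp add: rtr_minus_right[of _ d])
    finally show ?thesis using resolvent_tangent[OF S[OF that] Sb P c] by (simp add: Q_def)
  qed
  \<comment> \<open>The first-order terms average to zero, because \<open>Sb\<close> is the mean of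
    the \<open>S i\<close>, here tested against \<open>K\<close>.\<close>
  have "rtr P Q = (\<Sum>i\<in>I. w i * (rtr P Q + (rtr K Sb - rtr K (S i))))"
    using w1 Sb_eq[OF C(4)] by (simp add: algebra_simps sum.distrib sum_subtractf flip: sum_distrib_left sum_distrib_right)
  also have "\<dots> \<le> (\<Sum>i\<in>I. w i * rtr P (resolvent c (S i)))"
    using t w by (intro sum_mono mult_left_mono) auto
  finally have "c * rtr P Q \<le> (\<Sum>i\<in>I. w i * (c * rtr P (resolvent c (S i))))"
    using c by (simp add: sum_distrib_left mult.left_commute flip: sum_distrib_left)
  moreover have "(\<Sum>i\<in>I. w i * rtr P (mat_fun (\<lambda>x. x / (x + c)) (S i)))
      = (\<Sum>i\<in>I. w i * (rtr P (1\<^sub>m d) - c * rtr P (resolvent c (S i))))"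
    using S c C by (intro sum.cong refl) (simp add: mat_fun_frac[of d])
  moreover have "\<dots> = rtr P (1\<^sub>m d) - (\<Sum>i\<in>I. w i * (c * rtr P (resolvent c (S i))))"
    using w1 by (simp add: right_diff_distrib sum_subtractf flip: sum_distrib_right)
  ultimately show ?thesis using Sb c C by (simp add: mat_fun_frac[of d] Q_def)
qed

text \<open>Write Q = (A + c)^-1, S = A - B_m and R = (S + c)^-1. The kernel satisfies h(A) = Q A Q,
  which is linear in the middle factor and splits as Q B_m Q + Q S Q. Paired with B_m, the first
  part is at most tr(B_m Q T Q) because B_m \<le> T, and the second is at most tr(B_m R S R) =
  tr(B_m h(S)). Summing over m turns the terms tr(B_m Q T Q) into tr(A Q T Q) = tr(T h(A)).\<close>

lemma frac_square_packing:
  assumes B: "\<And>m. m \<in> I \<Longrightarrow> psd d (B m)" and A: "psd d A"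
    and A_eq: "\<And>P. P \<in> carrier_mat d d \<Longrightarrow> rtr P A = (\<Sum>m\<in>I. rtr P (B m))"
    and S: "\<And>m. m \<in> I \<Longrightarrow> psd d (A - B m)"
    and T: "psd d T" and TB: "\<And>m. m \<in> I \<Longrightarrow> psd d (T - B m)" and c: "0 < c"
  defines "h \<equiv> mat_fun (\<lambda>x. x / (x + c)\<^sup>2)"
  shows "rtr A (h A) - (\<Sum>m\<in>I. rtr (B m) (h (A - B m))) \<le> rtr T (h A)"
proof -
  define Q where "Q = resolvent c A"
  have pQ: "psd d Q" unfolding Q_def by (rule resolvent_psd[OF A c])
  have hA: "h A = Q * A * Q" unfolding h_def Q_def by (rule mat_fun_frac_square[OF A c])
  have C: "Q \<in> carrier_mat d d" "A \<in> carrier_mat d d" "T \<in> carrier_mat d d" using pQ A T by auto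
  have "rtr (B m) (Q * A * Q) - rtr (B m) (h (A - B m)) \<le> rtr (B m) (Q * T * Q)" if m: "m \<in> I" for m
  proof -
    define S' where "S' = A - B m"
    have pS: "psd d S'" and pB: "psd d (B m)" using S[OF m] B[OF m] by (auto simp: S'_def)
    have Bc: "B m \<in> carrier_mat d d" and Sc: "S' \<in> carrier_mat d d" using pB pS by auto
    define R where "R = resolvent c S'"
    have R: "R \<in> carrier_mat d d" using resolvent_psd[OF pS c] by (simp add: R_def)
    have AS: "A - S' = B m" using C Bc by (intro eq_matI) (auto simp: S'_def)
    have SA: "S' - A = complex_of_real (- 1) \<cdot>\<^sub>m B m" using C Bc by (intro eq_matI) (auto simp: S'_def)
    \<comment> \<open>This and the next inequality are the tangent inequalities between
      \<open>S'\<close> and \<open>A\<close>, with base point \<open>A\<close> and then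
      \<open>S'\<close>, both tested against \<open>S'\<close> itself. Adding them cancels the
      resolvents and compares the two first-order terms; cyclicity then exchanges \<open>B m\<close>
      and \<open>S'\<close>.\<close>
    have "rtr S' Q + rtr S' (Q * B m * Q) \<le> rtr S' R"
      using resolvent_tangent[OF pS A pS c] by (simp add: AS Q_def R_def)
    moreover have "rtr S' R + rtr S' (R * (S' - A) * R) \<le> rtr S' Q"
      using resolvent_tangent[OF A pS pS c] by (simp add: Q_def R_def)
    moreover have "R * (S' - A) * R = complex_of_real (- 1) \<cdot>\<^sub>m (R * B m * R)"
      unfolding SA using R Bc
      by (simp only: mult_smult_distrib[of _ d d _ d] mult_smult_assoc_mat[of _ d d _ d] mult_carrier_square)
    moreover have "rtr S' (complex_of_real (- 1) \<cdot>\<^sub>m (R * B m * R)) = - rtr S' (R * B m * R)"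
      using R Bc Sc by (subst rtr_smult_right[of _ d]) auto
    ultimately have "rtr S' (Q * B m * Q) \<le> rtr S' (R * B m * R)" by simp
    hence key: "rtr (B m) (Q * S' * Q) \<le> rtr (B m) (R * S' * R)"
      by (simp only: rtr_sandwich[OF Sc C(1) Bc] rtr_sandwich[OF Sc R Bc])
    have "h (A - B m) = R * S' * R"
      unfolding h_def S'_def[symmetric] R_def by (rule mat_fun_frac_square[OF pS c])
    moreover have "rtr (B m) (Q * A * Q) = rtr (B m) (Q * B m * Q) + rtr (B m) (Q * S' * Q)"
    proof -
      have "A = B m + S'" using C Bc by (intro eq_matI) (auto simp: S'_def)
      hence "Q * A * Q = Q * B m * Q + Q * S' * Q" using C Bc Sc
        by (simp add: mult_add_distrib_mat[of _ d d _ d] add_mult_distrib_mat[of _ d d _ _ d])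
      thus ?thesis using C Bc Sc by (simp add: rtr_add_right[of _ d])
    qed
    moreover have "rtr (B m) (Q * B m * Q) \<le> rtr (B m) (Q * T * Q)"
    proof -
      have "psd d (Q * (T - B m) * Q)" using psd_conj[OF TB[OF m] C(1)] by (simp add: psd_adj[OF pQ])
      hence "0 \<le> rtr (B m) (Q * (T - B m) * Q)" by (rule rtr_psd_nonneg[OF pB])
      moreover have "Q * (T - B m) * Q = Q * T * Q - Q * B m * Q" using C Bc
        by (simp add: mult_minus_distrib_mat[of _ d d _ d] minus_mult_distrib_mat[of _ d d _ _ d])
      ultimately show ?thesis using C Bc by (simp add: rtr_minus_right[of _ d])
    qed
    ultimately show ?thesis using key by simp
  qed
  hence "(\<Sum>m\<in>I. rtr (B m) (Q * A * Q)) - (\<Sum>m\<in>I. rtr (B m) (h (A - B m))) \<le> (\<Sum>m\<in>I. rtr (B m) (Q * T * Q))"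
    unfolding sum_subtractf[symmetric] by (intro sum_mono) auto
  moreover have "(\<Sum>m\<in>I. rtr (B m) Y) = rtr A Y" if Y: "Y \<in> carrier_mat d d" for Y
    using A_eq[OF Y] B C Y by (simp add: rtr_comm[of _ d d])
  moreover have "rtr A (Q * T * Q) = rtr T (h A)" unfolding hA by (rule rtr_sandwich[OF C(2,1,3)])
  ultimately show ?thesis unfolding hA using C by simp
qed

section \<open>Powers as integrals over resolvents\<close>

text \<open>The dominating function for the kernels in the logarithmic variable u; it is bounded by
  the sum of a one-sided exponential and its reflection.\<close>

lemma integrable_exp_neg_abs:
  fixes c :: real assumes c: "0 < c"
  shows "integrable lborel (\<lambda>u. exp (- (c * \<bar>u\<bar>)))"
proof -
  let ?f = "\<lambda>u::real. if u \<in> {0..} then exp (- c * u) else 0"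
  have "(?f has_integral (exp (- c * 0) / c)) UNIV"
    unfolding has_integral_restrict_UNIV by (rule has_integral_exp_minus_to_infinity[OF c])
  hence "(\<integral>\<^sup>+u. ennreal (?f u) \<partial>lborel) = ennreal (exp (- c * 0) / c)"
    by (intro nn_integral_has_integral_lborel) auto
  hence i: "integrable lborel ?f" by (intro integrableI_nonneg) auto
  have "integrable lborel (\<lambda>u. ?f (0 + (-1) * u))"
    by (rule lborel_integrable_real_affine[OF i]) simp
  with i have "integrable lborel (\<lambda>u. ?f u + ?f (0 + (-1) * u))" by (rule Bochner_Integration.integrable_add)
  thus ?thesis by (rule Bochner_Integration.integrable_bound) (auto simp: indicator_def)
qed

text \<open>In the variable c = exp u this is the Mellin integral of c^(q-1) F(t/c). The logarithmic
  variable makes scaling by t a translation by \<open>ln t\<close>, under which Lebesgue measure is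
  invariant, and the weight contributes the factor t^q. The value of \<open>C\<close> never matters,
  only that it is positive and independent of t.\<close>

lemma powr_integral:
  fixes F :: "real \<Rightarrow> real" and q :: real
  assumes q: "0 < q" "q < 1" and [measurable]: "F \<in> borel_measurable borel" and F0: "F 0 = 0"
    and F: "\<And>y. 0 < y \<Longrightarrow> 0 < F y" "\<And>y. 0 < y \<Longrightarrow> F y \<le> y" "\<And>y. 0 < y \<Longrightarrow> F y \<le> 1"
  shows "\<exists>C>0. \<forall>t\<ge>0. has_bochner_integral lborel (\<lambda>u. exp (q * u) * F (t * exp (- u))) (C * t powr q)"
proof -
  define g where "g u = exp (q * u) * F (exp (- u))" for u
  have [measurable]: "g \<in> borel_measurable borel" unfolding g_def by measurable
  have gpos: "0 < g u" for u using F(1)[of "exp (-u)"] by (simp add: g_def)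
  \<comment> \<open>Decay rate at both ends: F y \<le> y gives exp (-(1 - q) u) for u \<ge> 0, and F
    y \<le> 1 gives exp (q u) for u < 0.\<close>
  define c where "c = min q (1 - q)"
  have c: "0 < c" using q by (simp add: c_def)
  have "g u \<le> exp (- (c * \<bar>u\<bar>))" for u
  proof (cases "0 \<le> u")
    case True
    have "g u \<le> exp (q * u) * exp (- u)" unfolding g_def using F(2)[of "exp (-u)"] by simp
    also have "\<dots> = exp (- ((1 - q) * u))" by (simp add: algebra_simps flip: exp_add)
    also have "\<dots> \<le> exp (- (c * \<bar>u\<bar>))" using True by (auto simp: c_def intro: mult_right_mono)
    finally show ?thesis .
  next
    case False
    have "g u \<le> exp (q * u) * 1" unfolding g_def using F(3)[of "exp (-u)"] by simp
    also have "\<dots> \<le> exp (- (c * \<bar>u\<bar>))" using False by (auto simp: c_def intro: mult_right_mono_neg)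
    finally show ?thesis .
  qed
  hence ig: "integrable lborel g"
    using gpos by (intro Bochner_Integration.integrable_bound[OF integrable_exp_neg_abs[OF c]])
      (auto simp: less_imp_le)
  define C where "C = integral\<^sup>L lborel g"
  \<comment> \<open>A strictly positive integrand with zero integral would make the whole line a
    null set.\<close>
  have "C \<noteq> 0"
  proof
    assume "C = 0"
    hence "AE u in lborel. g u = 0"
      using integral_nonneg_eq_0_iff_AE[OF ig] gpos by (simp add: C_def less_imp_le)
    hence "AE u::real in lborel. False" using gpos by (auto elim!: eventually_mono simp: less_le)
    hence "emeasure lborel (UNIV :: real set) = 0" by (simp add: AE_iff_measurable[OF _ refl])
    thus False by simp
  qed
  moreover have "0 \<le> C" unfolding C_def using gpos by (intro integral_nonneg_AE) (simp add: less_imp_le)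
  ultimately have C: "0 < C" by simp
  have hb: "has_bochner_integral lborel g C" unfolding C_def using ig by (rule has_bochner_integral_integrable)
  have "has_bochner_integral lborel (\<lambda>u. exp (q * u) * F (t * exp (- u))) (C * t powr q)" if t: "0 \<le> t" for t
  proof (cases "t = 0")
    case True
    thus ?thesis using F0 by (simp add: has_bochner_integral_zero)
  next
    case False
    with t have t: "0 < t" by simp
    have e: "exp (q * (ln t + 1 * u)) * F (t * exp (- (ln t + 1 * u))) = t powr q * g u" for u
    proof -
      have "exp (- (ln t + u)) = exp (- ln t) * exp (- u)" by (simp flip: exp_add)
      hence "t * exp (- (ln t + u)) = exp (- u)" using t by (simp add: exp_minus[of "ln t"])
      moreover have "exp (q * (ln t + u)) = t powr q * exp (q * u)"
        using t by (simp add: powr_def distrib_left exp_add)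
      ultimately show ?thesis by (simp add: g_def)
    qed
    have "has_bochner_integral lborel (\<lambda>u. t powr q * g u) (t powr q * C)"
      using hb by (intro has_bochner_integral_mult_right) auto
    thus ?thesis
      by (subst lborel_has_bochner_integral_real_affine_iff[where c = 1 and t = "ln t"])
        (simp_all only: e, simp_all add: mult.commute)
  qed
  with C show ?thesis by blast
qed

text \<open>On a nonnegative spectrum the case split in \<open>mat_powr\<close> is absorbed by the
  convention \<open>0 powr q = 0\<close>.\<close>

lemma mat_powr_eq: "psd d A \<Longrightarrow> mat_powr A q = mat_fun (\<lambda>x. x powr q) A"
  unfolding mat_powr_def by (rule mat_fun_cong) auto

lemma mat_powr_psd[simp]: "psd d A \<Longrightarrow> psd d (mat_powr A q)"
  by (simp add: mat_powr_eq mat_fun_psd)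

lemma mat_powr_one: "psd d A \<Longrightarrow> mat_powr A 1 = A"
  using mat_fun_cong[of d A "\<lambda>x. x powr 1" "\<lambda>x. x"] by (simp add: mat_powr_eq mat_fun_id[of d])

lemma mat_powr_powr: "psd d A \<Longrightarrow> mat_powr (mat_powr A a) b = mat_powr A (a * b)"
  by (simp add: mat_powr_eq[of d] mat_fun_psd mat_fun_comp[of d] powr_powr)

text \<open>The order of the quantifiers is the point: one constant serves all dimensions and
  matrices, so an inequality between integrands for different matrices yields one between traces of
  powers after cancelling \<open>C\<close>.\<close>

lemma rtr_powr_integral:
  fixes F :: "real \<Rightarrow> real" and q :: real
  assumes "0 < q" "q < 1" "F \<in> borel_measurable borel" "F 0 = 0"
    "\<And>y. 0 < y \<Longrightarrow> 0 < F y" "\<And>y. 0 < y \<Longrightarrow> F y \<le> y" "\<And>y. 0 < y \<Longrightarrow> F y \<le> 1"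
  shows "\<exists>C>0. \<forall>d A P. psd d A \<longrightarrow> P \<in> carrier_mat d d \<longrightarrow>
    has_bochner_integral lborel (\<lambda>u. exp (q * u) * rtr P (mat_fun (\<lambda>x. F (x * exp (- u))) A))
      (C * rtr P (mat_powr A q))"
proof -
  obtain C where C: "0 < C" and
    int: "\<And>t. 0 \<le> t \<Longrightarrow> has_bochner_integral lborel (\<lambda>u. exp (q * u) * F (t * exp (- u))) (C * t powr q)"
    using powr_integral[OF assms] by blast
  have "has_bochner_integral lborel (\<lambda>u. exp (q * u) * rtr P (mat_fun (\<lambda>x. F (x * exp (- u))) A))
      (C * rtr P (mat_powr A q))" if A: "psd d A" and P: "P \<in> carrier_mat d d" for d A P
  proof -
    obtain w l where w: "\<And>f. rtr P (mat_fun f A) = (\<Sum>i<d. w i * f (l i))" and l: "\<And>i. 0 \<le> l i"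
      using rtr_mat_fun[OF A P] by metis
    have "has_bochner_integral lborel (\<lambda>u. \<Sum>i<d. w i * (exp (q * u) * F (l i * exp (- u))))
        (\<Sum>i<d. w i * (C * l i powr q))"
      by (intro has_bochner_integral_sum has_bochner_integral_mult_right int l)
    thus ?thesis unfolding mat_powr_eq[OF A] w by (simp add: sum_distrib_left mult_ac)
  qed
  with C show ?thesis by blast
qed

lemma rtr_powr_integral_frac:
  fixes q :: real
  assumes q: "0 < q" "q < 1"
  obtains C where "C > 0" "\<And>d A P. psd d A \<Longrightarrow> P \<in> carrier_mat d d \<Longrightarrow>
    has_bochner_integral lborel (\<lambda>u. exp (q * u) * rtr P (mat_fun (\<lambda>x. x / (x + exp u)) A))
      (C * rtr P (mat_powr A q))"
proof -
  have e: "x * exp (- u) / (1 + x * exp (- u)) = x / (x + exp u)" for x u :: real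
  proof -
    have "x * exp (- u) / (1 + x * exp (- u)) = (x * exp (- u) * exp u) / ((1 + x * exp (- u)) * exp u)"
      by (simp del: mult_cancel_right)
    also have "x * exp (- u) * exp u = x" by (simp add: exp_minus)
    also have "(1 + x * exp (- u)) * exp u = x + exp u" by (simp add: exp_minus algebra_simps)
    finally show ?thesis .
  qed
  have "\<exists>C>0. \<forall>d A P. psd d A \<longrightarrow> P \<in> carrier_mat d d \<longrightarrow>
    has_bochner_integral lborel (\<lambda>u. exp (q * u) * rtr P (mat_fun (\<lambda>x. x * exp (- u) / (1 + x * exp (- u))) A))
      (C * rtr P (mat_powr A q))"
    by (rule rtr_powr_integral[OF q, of "\<lambda>y. y / (1 + y)"]) (auto simp: field_simps)
  thus ?thesis unfolding e using that by blast
qed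

text \<open>Here F y = y / (1 + y)^2, which at y = x exp(-u) equals exp u times x / (x + exp u)^2.
  The factor exp u moves into the weight, whence the exponent q + 1.\<close>

lemma rtr_powr_integral_frac_square:
  fixes q :: real
  assumes q: "0 < q" "q < 1"
  obtains C where "C > 0" "\<And>d A P. psd d A \<Longrightarrow> P \<in> carrier_mat d d \<Longrightarrow>
    has_bochner_integral lborel (\<lambda>u. exp ((q + 1) * u) * rtr P (mat_fun (\<lambda>x. x / (x + exp u)\<^sup>2) A))
      (C * rtr P (mat_powr A q))"
proof -
  have e: "x * exp (- u) / (1 + x * exp (- u))\<^sup>2 = exp u * (x / (x + exp u)\<^sup>2)" for x u :: real
  proof -
    have "x * exp (- u) / (1 + x * exp (- u))\<^sup>2 = (x * exp (- u) * (exp u)\<^sup>2) / ((1 + x * exp (- u))\<^sup>2 * (exp u)\<^sup>2)"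
      by (simp del: mult_cancel_right)
    also have "x * exp (- u) * (exp u)\<^sup>2 = exp u * x" by (simp add: exp_minus power2_eq_square)
    also have "(1 + x * exp (- u))\<^sup>2 * (exp u)\<^sup>2 = (x + exp u)\<^sup>2"
      unfolding power_mult_distrib[symmetric] by (simp add: exp_minus algebra_simps)
    finally show ?thesis by simp
  qed
  have "\<exists>C>0. \<forall>d A P. psd d A \<longrightarrow> P \<in> carrier_mat d d \<longrightarrow>
    has_bochner_integral lborel (\<lambda>u. exp (q * u) * rtr P (mat_fun (\<lambda>x. x * exp (- u) / (1 + x * exp (- u))\<^sup>2) A))
      (C * rtr P (mat_powr A q))"
  proof (rule rtr_powr_integral[OF q, of "\<lambda>y. y / (1 + y)\<^sup>2"])
    fix y :: real assume y: "0 < y"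
    have 1: "1 \<le> (1 + y)\<^sup>2" and 2: "y \<le> (1 + y)\<^sup>2" using y by (auto simp: power2_eq_square algebra_simps)
    show "y / (1 + y)\<^sup>2 \<le> y" "y / (1 + y)\<^sup>2 \<le> 1" "0 < y / (1 + y)\<^sup>2"
      using y 1 2 by (auto simp: divide_le_eq)
  qed auto
  then obtain C where C: "C > 0" and I: "\<And>d A P. psd d A \<Longrightarrow> P \<in> carrier_mat d d \<Longrightarrow>
    has_bochner_integral lborel (\<lambda>u. exp (q * u) * rtr P (mat_fun (\<lambda>x. exp u * (x / (x + exp u)\<^sup>2)) A))
      (C * rtr P (mat_powr A q))"
    unfolding e by blast
  have "has_bochner_integral lborel (\<lambda>u. exp ((q + 1) * u) * rtr P (mat_fun (\<lambda>x. x / (x + exp u)\<^sup>2) A))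
      (C * rtr P (mat_powr A q))" if A: "psd d A" and P: "P \<in> carrier_mat d d" for d A P
  proof -
    have "exp (q * u) * rtr P (mat_fun (\<lambda>x. exp u * (x / (x + exp u)\<^sup>2)) A)
      = exp ((q + 1) * u) * rtr P (mat_fun (\<lambda>x. x / (x + exp u)\<^sup>2) A)" for u
      unfolding mat_fun_cmult[OF psd_hermitian[OF A]] rtr_smult_right[OF P mat_fun_carrier[OF psd_hermitian[OF A]]]
      by (simp add: distrib_right exp_add)
    thus ?thesis using I[OF A P] by simp
  qed
  with C show ?thesis using that by blast
qed

section \<open>Operator monotonicity, operator concavity and packing for fractional powers\<close>

lemma has_bochner_integral_mono:
  fixes f g :: "'a \<Rightarrow> real"
  assumes "has_bochner_integral M f x" "has_bochner_integral M g y" "\<And>u. f u \<le> g u"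
  shows "x \<le> y"
  using assms integral_mono[of M f g] by (auto simp: has_bochner_integral_iff)

text \<open>The inequality holds for the kernel at every u and is integrated. The exponent 1 is
  treated separately, since the integral representation is available only for q < 1.\<close>

lemma mat_powr_mono_rtr:
  assumes X: "psd d X" and Y: "psd d Y" and XY: "psd d (Y - X)" and P: "psd d P" and q: "0 < q" "q \<le> 1"
  shows "rtr P (mat_powr X q) \<le> rtr P (mat_powr Y q)"
proof (cases "q = 1")
  case True
  have "0 \<le> rtr P (Y - X)" by (rule rtr_psd_nonneg[OF P XY])
  thus ?thesis using True X Y P by (simp add: mat_powr_one[of d] rtr_minus_right[of _ d])
next
  case False
  with q have "q < 1" by simp
  from rtr_powr_integral_frac[OF q(1) this] obtain C where C: "C > 0"
    and int: "\<And>d A P. psd d A \<Longrightarrow> P \<in> carrier_mat d d \<Longrightarrow>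
    has_bochner_integral lborel (\<lambda>u. exp (q * u) * rtr P (mat_fun (\<lambda>x. x / (x + exp u)) A))
      (C * rtr P (mat_powr A q))" by blast
  have "C * rtr P (mat_powr X q) \<le> C * rtr P (mat_powr Y q)"
    by (rule has_bochner_integral_mono[OF int[OF X psd_carrier[OF P]] int[OF Y psd_carrier[OF P]]])
      (intro mult_left_mono frac_mono[OF X Y XY P], auto)
  thus ?thesis using C by simp
qed

lemma hermitian_minus: "hermitian d A \<Longrightarrow> hermitian d B \<Longrightarrow> hermitian d (A - B)"
  by (auto simp: hermitian_def adj_minus[of _ d d])

theorem loewner_heinz:
  assumes X: "psd d X" and Y: "psd d Y" and XY: "psd d (Y - X)" and q: "0 < q" "q \<le> 1"
  shows "psd d (mat_powr Y q - mat_powr X q)"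
proof (rule psdI_rtr)
  show "hermitian d (mat_powr Y q - mat_powr X q)" using X Y by (intro hermitian_minus) auto
  fix P assume P: "psd d P"
  show "0 \<le> rtr P (mat_powr Y q - mat_powr X q)"
    using mat_powr_mono_rtr[OF X Y XY P q] P mat_powr_psd[OF X, of q, THEN psd_carrier]
      mat_powr_psd[OF Y, of q, THEN psd_carrier] by (simp add: rtr_minus_right[of _ d])
qed

lemma mat_powr_concave:
  assumes S: "\<And>i. i \<in> I \<Longrightarrow> psd d (S i)" and w: "\<And>i. i \<in> I \<Longrightarrow> 0 \<le> w i"
    and w1: "sum w I = 1" and Sb: "psd d Sb"
    and Sb_eq: "\<And>P. P \<in> carrier_mat d d \<Longrightarrow> rtr P Sb = (\<Sum>i\<in>I. w i * rtr P (S i))"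
    and P: "psd d P" and q: "0 < q" "q \<le> 1"
  shows "(\<Sum>i\<in>I. w i * rtr P (mat_powr (S i) q)) \<le> rtr P (mat_powr Sb q)"
proof (cases "q = 1")
  case True
  thus ?thesis using S Sb Sb_eq[of P] P by (simp add: mat_powr_one[of d])
next
  case False
  with q have "q < 1" by simp
  from rtr_powr_integral_frac[OF q(1) this] obtain C where C: "C > 0"
    and int: "\<And>d A P. psd d A \<Longrightarrow> P \<in> carrier_mat d d \<Longrightarrow>
    has_bochner_integral lborel (\<lambda>u. exp (q * u) * rtr P (mat_fun (\<lambda>x. x / (x + exp u)) A))
      (C * rtr P (mat_powr A q))" by blast
  have "(\<Sum>i\<in>I. w i * (C * rtr P (mat_powr (S i) q))) \<le> C * rtr P (mat_powr Sb q)"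
  proof (rule has_bochner_integral_mono)
    show "has_bochner_integral lborel
        (\<lambda>u. \<Sum>i\<in>I. w i * (exp (q * u) * rtr P (mat_fun (\<lambda>x. x / (x + exp u)) (S i))))
        (\<Sum>i\<in>I. w i * (C * rtr P (mat_powr (S i) q)))"
      by (intro has_bochner_integral_sum has_bochner_integral_mult_right int[of d] S psd_carrier[OF P])
    show "has_bochner_integral lborel (\<lambda>u. exp (q * u) * rtr P (mat_fun (\<lambda>x. x / (x + exp u)) Sb))
      (C * rtr P (mat_powr Sb q))" by (rule int[OF Sb psd_carrier[OF P]])
    fix u :: real
    show "(\<Sum>i\<in>I. w i * (exp (q * u) * rtr P (mat_fun (\<lambda>x. x / (x + exp u)) (S i))))
      \<le> exp (q * u) * rtr P (mat_fun (\<lambda>x. x / (x + exp u)) Sb)"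
      using mult_left_mono[OF frac_concave[OF S w w1 Sb Sb_eq P, of "exp u"], of "exp (q * u)"]
      by (simp add: sum_distrib_left mult.left_commute)
  qed
  also have "(\<Sum>i\<in>I. w i * (C * rtr P (mat_powr (S i) q))) = C * (\<Sum>i\<in>I. w i * rtr P (mat_powr (S i) q))"
    by (simp add: sum_distrib_left mult.left_commute)
  finally show ?thesis using C by simp
qed

text \<open>For positive numbers, (1 - x)^s \<ge> 1 - x on [0,1] gives a^s - (a - b)^s \<le> b
  a^(s-1); multiplying by b_m and summing gives at most t a^s whenever t bounds every b_m. Without
  commutativity, the estimate is made under the integral. For s = 1 it is just tr(B_m B_m) \<le>
  tr(B_m T).\<close>

lemma mat_powr_packing:
  assumes B: "\<And>m. m \<in> I \<Longrightarrow> psd d (B m)" and A: "psd d A"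
    and A_eq: "\<And>P. P \<in> carrier_mat d d \<Longrightarrow> rtr P A = (\<Sum>m\<in>I. rtr P (B m))"
    and S: "\<And>m. m \<in> I \<Longrightarrow> psd d (A - B m)"
    and T: "psd d T" and TB: "\<And>m. m \<in> I \<Longrightarrow> psd d (T - B m)" and s: "0 < s" "s \<le> 1"
  shows "rtr A (mat_powr A s) - (\<Sum>m\<in>I. rtr (B m) (mat_powr (A - B m) s)) \<le> rtr T (mat_powr A s)"
proof (cases "s = 1")
  case True
  have C: "A \<in> carrier_mat d d" "T \<in> carrier_mat d d" using A T by auto
  have "rtr (B m) A - rtr (B m) (A - B m) \<le> rtr (B m) T" if m: "m \<in> I" for m
    using rtr_psd_nonneg[OF B[OF m] TB[OF m]] B[OF m] C by (simp add: rtr_minus_right[of _ d])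
  hence "(\<Sum>m\<in>I. rtr (B m) A) - (\<Sum>m\<in>I. rtr (B m) (A - B m)) \<le> (\<Sum>m\<in>I. rtr (B m) T)"
    unfolding sum_subtractf[symmetric] by (intro sum_mono) auto
  moreover have "(\<Sum>m\<in>I. rtr (B m) Y) = rtr A Y" if Y: "Y \<in> carrier_mat d d" for Y
    using A_eq[OF Y] B C Y by (simp add: rtr_comm[of _ d d])
  ultimately have "rtr A A - (\<Sum>m\<in>I. rtr (B m) (A - B m)) \<le> rtr A T" using C by simp
  thus ?thesis using True A S C by (simp add: mat_powr_one[of d] rtr_comm[of A d d T])
next
  case False
  with s have "s < 1" by simp
  from rtr_powr_integral_frac_square[OF s(1) this] obtain C where C: "C > 0"
    and int: "\<And>d A P. psd d A \<Longrightarrow> P \<in> carrier_mat d d \<Longrightarrow>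
    has_bochner_integral lborel (\<lambda>u. exp ((s + 1) * u) * rtr P (mat_fun (\<lambda>x. x / (x + exp u)\<^sup>2) A))
      (C * rtr P (mat_powr A s))" by blast
  have "C * rtr A (mat_powr A s) - (\<Sum>m\<in>I. C * rtr (B m) (mat_powr (A - B m) s)) \<le> C * rtr T (mat_powr A s)"
  proof (rule has_bochner_integral_mono)
    show "has_bochner_integral lborel
        (\<lambda>u. exp ((s + 1) * u) * rtr A (mat_fun (\<lambda>x. x / (x + exp u)\<^sup>2) A)
          - (\<Sum>m\<in>I. exp ((s + 1) * u) * rtr (B m) (mat_fun (\<lambda>x. x / (x + exp u)\<^sup>2) (A - B m))))
        (C * rtr A (mat_powr A s) - (\<Sum>m\<in>I. C * rtr (B m) (mat_powr (A - B m) s)))"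
      by (intro has_bochner_integral_diff has_bochner_integral_sum int[of d] S A psd_carrier[OF A] psd_carrier[OF B])
    show "has_bochner_integral lborel (\<lambda>u. exp ((s + 1) * u) * rtr T (mat_fun (\<lambda>x. x / (x + exp u)\<^sup>2) A))
      (C * rtr T (mat_powr A s))" by (rule int[OF A psd_carrier[OF T]])
    fix u :: real
    show "exp ((s + 1) * u) * rtr A (mat_fun (\<lambda>x. x / (x + exp u)\<^sup>2) A)
          - (\<Sum>m\<in>I. exp ((s + 1) * u) * rtr (B m) (mat_fun (\<lambda>x. x / (x + exp u)\<^sup>2) (A - B m)))
      \<le> exp ((s + 1) * u) * rtr T (mat_fun (\<lambda>x. x / (x + exp u)\<^sup>2) A)"
      using mult_left_mono[OF frac_square_packing[OF B A A_eq S T TB, of "exp u"], of "exp ((s + 1) * u)"]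
      by (simp add: sum_distrib_left right_diff_distrib)
  qed
  also have "C * rtr A (mat_powr A s) - (\<Sum>m\<in>I. C * rtr (B m) (mat_powr (A - B m) s))
    = C * (rtr A (mat_powr A s) - (\<Sum>m\<in>I. rtr (B m) (mat_powr (A - B m) s)))"
    by (simp add: sum_distrib_left right_diff_distrib)
  finally show ?thesis using C by simp
qed

section \<open>Klein's inequality and the lower bound for dual feasible matrices\<close>

lemma young_powr:
  fixes t a s :: real
  assumes "0 \<le> t" "0 \<le> a" "0 < s"
  shows "(1 + s) * (t * a powr s) \<le> t powr (1 + s) + s * a powr (1 + s)"
proof (cases "t = 0 \<or> a = 0")
  case True
  thus ?thesis using assms by auto
next
  case False
  hence "0 < t" "0 < a" using assms by auto
  have "(t powr (1 + s)) powr (1 / (1 + s)) * (a powr (1 + s)) powr (s / (1 + s))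
    \<le> 1 / (1 + s) * t powr (1 + s) + s / (1 + s) * a powr (1 + s)"
    using assms \<open>0 < t\<close> \<open>0 < a\<close> by (intro Youngs_inequality_0) (auto simp: field_simps)
  also have "(t powr (1 + s)) powr (1 / (1 + s)) = t" using assms \<open>0 < t\<close> by (simp add: powr_powr)
  also have "(a powr (1 + s)) powr (s / (1 + s)) = a powr s" using assms by (simp add: powr_powr)
  finally have "(1 + s) * (t * a powr s) \<le> (1 + s) * (1 / (1 + s) * t powr (1 + s) + s / (1 + s) * a powr (1 + s))"
    using assms by (intro mult_left_mono) auto
  also have "\<dots> = t powr (1 + s) + s * a powr (1 + s)" using assms by (simp add: distrib_left)
  finally show ?thesis .
qed

lemma rtr_mat_powr_one:
  assumes "psd d A" shows "rtr A (mat_powr A s) = rtr (mat_powr A (1 + s)) (1\<^sub>m d)"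
proof -
  have "A * mat_powr A s = mat_fun (\<lambda>x. x) A * mat_fun (\<lambda>x. x powr s) A"
    using assms by (simp add: mat_powr_eq[of d] mat_fun_id[of d])
  also have "\<dots> = mat_fun (\<lambda>x. x powr (1 + s)) A"
    unfolding mat_fun_mult[OF psd_hermitian[OF assms]]
    by (rule mat_fun_cong[OF assms]) (auto simp: powr_add)
  finally show ?thesis using assms by (simp add: rtr_def mat_powr_eq[of d] right_mult_one_mat[of _ d d])
qed

text \<open>On pairs of eigenvalues this is the supporting line of x^(1+s) at a, as in
  \<open>young_powr\<close>. Taking one of the two functions constantly 1 expresses both traces with
  the same weights, so the scalar inequality can be summed.\<close>

lemma klein_powr:
  assumes T: "psd d T" and A: "psd d A" and s: "0 < s"
  shows "(1 + s) * rtr T (mat_powr A s) \<le> rtr (mat_powr T (1 + s)) (1\<^sub>m d) + s * rtr (mat_powr A (1 + s)) (1\<^sub>m d)"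
proof -
  obtain w t a where w: "\<And>f g. rtr (mat_fun f T) (mat_fun g A) = (\<Sum>i<d. \<Sum>j<d. w i j * (f (t i) * g (a j)))"
    and pos: "\<And>i. 0 \<le> t i" "\<And>j. 0 \<le> a j" "\<And>i j. 0 \<le> w i j"
    using rtr_mat_fun_mat_fun[OF T A] by blast
  have 1: "rtr T (mat_powr A s) = (\<Sum>i<d. \<Sum>j<d. w i j * (t i * a j powr s))"
    using w[of "\<lambda>x. x" "\<lambda>x. x powr s"] T A by (simp add: mat_fun_id[of d] mat_powr_eq[of d])
  have 2: "rtr (mat_powr T (1 + s)) (1\<^sub>m d) = (\<Sum>i<d. \<Sum>j<d. w i j * (t i powr (1 + s)))"
    using w[of "\<lambda>x. x powr (1 + s)" "\<lambda>_. 1"] T A by (simp add: mat_fun_one[of d] mat_powr_eq[of d])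
  have "rtr (mat_powr A (1 + s)) (1\<^sub>m d) = rtr (1\<^sub>m d) (mat_powr A (1 + s))"
    using mat_powr_psd[OF A] by (intro rtr_comm[of _ d d]) auto
  also have "\<dots> = (\<Sum>i<d. \<Sum>j<d. w i j * (a j powr (1 + s)))"
    using w[of "\<lambda>_. 1" "\<lambda>x. x powr (1 + s)"] T A by (simp add: mat_fun_one[of d] mat_powr_eq[of d])
  finally have 3: "rtr (mat_powr A (1 + s)) (1\<^sub>m d) = (\<Sum>i<d. \<Sum>j<d. w i j * (a j powr (1 + s)))" .
  have "(1 + s) * rtr T (mat_powr A s) = (\<Sum>i<d. \<Sum>j<d. w i j * ((1 + s) * (t i * a j powr s)))"
    unfolding 1 sum_distrib_left by (intro sum.cong refl) (simp only: mult.left_commute)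
  also have "\<dots> \<le> (\<Sum>i<d. \<Sum>j<d. w i j * (t i powr (1 + s) + s * a j powr (1 + s)))"
    using s pos by (intro sum_mono mult_left_mono young_powr)
  also have "\<dots> = rtr (mat_powr T (1 + s)) (1\<^sub>m d) + s * rtr (mat_powr A (1 + s)) (1\<^sub>m d)"
    unfolding 2 3 by (simp add: sum_distrib_left distrib_left sum.distrib mult.left_commute)
  finally show ?thesis .
qed

text \<open>\<open>K\<close> is any feasible point of the dual discrimination problem for the
  matrices B_m^(1+s). Taking the root 1 / (1 + s), whose exponent is at most 1, preserves
  domination, so T = K^(1/(1+s)) can enter the packing inequality while tr T^(1+s) is still tr
  K.\<close>

lemma packing_dual_bound:
  assumes B: "\<And>m. m \<in> I \<Longrightarrow> psd d (B m)" and A: "psd d A"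
    and A_eq: "\<And>P. P \<in> carrier_mat d d \<Longrightarrow> rtr P A = (\<Sum>m\<in>I. rtr P (B m))"
    and S: "\<And>m. m \<in> I \<Longrightarrow> psd d (A - B m)"
    and K: "psd d K" and KB: "\<And>m. m \<in> I \<Longrightarrow> psd d (K - mat_powr (B m) (1 + s))"
    and s: "0 < s" "s \<le> 1"
  shows "(\<Sum>m\<in>I. rtr (mat_powr (B m) (1 + s)) (1\<^sub>m d))
    - (1 + s) * (\<Sum>m\<in>I. rtr (B m) (mat_powr (A - B m) s)) \<le> rtr K (1\<^sub>m d)"
proof -
  define T where "T = mat_powr K (1 / (1 + s))"
  have T: "psd d T" unfolding T_def using K by simp
  have TK: "mat_powr T (1 + s) = K" unfolding T_def using K s by (simp add: mat_powr_powr[of d] mat_powr_one[of d])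
  have TB: "psd d (T - B m)" if m: "m \<in> I" for m
  proof -
    have "mat_powr (mat_powr (B m) (1 + s)) (1 / (1 + s)) = B m"
      using B[OF m] s by (simp add: mat_powr_powr[of d] mat_powr_one[of d])
    thus ?thesis unfolding T_def
      using loewner_heinz[OF mat_powr_psd[OF B[OF m]] K KB[OF m], of "1 / (1 + s)"] s by simp
  qed
  \<comment> \<open>Superadditivity of tr x^(1+s) for this family: A \<ge> B_m gives A^s \<ge>
    B_m^s, and pairing with B_m and summing gives tr A^(1+s) on the right.\<close>
  have "(\<Sum>m\<in>I. rtr (mat_powr (B m) (1 + s)) (1\<^sub>m d)) = (\<Sum>m\<in>I. rtr (B m) (mat_powr (B m) s))"
    using B by (simp add: rtr_mat_powr_one[of d])
  also have "\<dots> \<le> (\<Sum>m\<in>I. rtr (B m) (mat_powr A s))"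
    using B A S s by (intro sum_mono mat_powr_mono_rtr[of d]) auto
  also have "\<dots> = (\<Sum>m\<in>I. rtr (mat_powr A s) (B m))"
    using B mat_powr_psd[OF A, of s] by (intro sum.cong refl rtr_comm[of _ d d]) auto
  also have "\<dots> = rtr A (mat_powr A s)"
    using A_eq[of "mat_powr A s"] mat_powr_psd[OF A, of s] A by (simp add: rtr_comm[of A d d])
  finally have 1: "(\<Sum>m\<in>I. rtr (mat_powr (B m) (1 + s)) (1\<^sub>m d)) \<le> rtr A (mat_powr A s)" .
  have 2: "(1 + s) * rtr T (mat_powr A s) \<le> rtr K (1\<^sub>m d) + s * rtr A (mat_powr A s)"
    using klein_powr[OF T A s(1)] A by (simp add: TK rtr_mat_powr_one[of d A])
  have "(1 + s) * (rtr A (mat_powr A s) - (\<Sum>m\<in>I. rtr (B m) (mat_powr (A - B m) s))) \<le> (1 + s) * rtr T (mat_powr A s)"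
    using s by (intro mult_left_mono mat_powr_packing[OF B A A_eq S T TB]) auto
  \<comment> \<open>Packing supplies 1 + s copies of tr A^(1+s) and Klein costs s of them; the one
    left over dominates the sum of the tr B_m^(1+s).\<close>
  with 1 2 show ?thesis by (simp add: algebra_simps)
qed

section \<open>Sums of matrices\<close>

lemma msum_add:
  assumes "\<And>i. i \<in> I \<Longrightarrow> f i \<in> carrier_mat n m" "\<And>i. i \<in> I \<Longrightarrow> g i \<in> carrier_mat n m"
  shows "msum n m (\<lambda>i. f i + g i) I = msum n m f I + msum n m g I"
proof (rule eq_matI)
  fix a b assume "a < dim_row (msum n m f I + msum n m g I)" "b < dim_col (msum n m f I + msum n m g I)"
  hence ab: "a < n" "b < m" by auto
  have "(f i + g i) $$ (a,b) = f i $$ (a,b) + g i $$ (a,b)" if "i \<in> I" for i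
    using assms(1)[OF that] assms(2)[OF that] ab by auto
  thus "msum n m (\<lambda>i. f i + g i) I $$ (a,b) = (msum n m f I + msum n m g I) $$ (a,b)"
    using ab by (simp add: msum_def sum.distrib)
qed auto

lemma mult_msum:
  assumes X: "X \<in> carrier_mat n m" and f: "\<And>i. i \<in> I \<Longrightarrow> f i \<in> carrier_mat m k"
  shows "X * msum m k f I = msum n k (\<lambda>i. X * f i) I"
proof (rule eq_matI)
  fix a b assume "a < dim_row (msum n k (\<lambda>i. X * f i) I)" "b < dim_col (msum n k (\<lambda>i. X * f i) I)"
  hence ab: "a < n" "b < k" by auto
  have "(X * f i) $$ (a,b) = (\<Sum>l<m. X $$ (a,l) * f i $$ (l,b))" if "i \<in> I" for i
    using f[OF that] X ab by (simp add: index_mult_sum del: index_mult_mat(1))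
  hence "msum n k (\<lambda>i. X * f i) I $$ (a,b) = (\<Sum>i\<in>I. \<Sum>l<m. X $$ (a,l) * f i $$ (l,b))"
    using ab by (simp add: msum_def)
  also have "\<dots> = (\<Sum>l<m. X $$ (a,l) * (\<Sum>i\<in>I. f i $$ (l,b)))"
    by (subst sum.swap) (simp add: sum_distrib_left)
  also have "\<dots> = (X * msum m k f I) $$ (a,b)"
    using X ab by (simp add: index_mult_sum msum_def del: index_mult_mat(1))
  finally show "(X * msum m k f I) $$ (a,b) = msum n k (\<lambda>i. X * f i) I $$ (a,b)" ..
qed (use X in auto)

lemma msum_mult:
  assumes X: "X \<in> carrier_mat m k" and f: "\<And>i. i \<in> I \<Longrightarrow> f i \<in> carrier_mat n m"
  shows "msum n m f I * X = msum n k (\<lambda>i. f i * X) I"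
proof (rule eq_matI)
  fix a b assume "a < dim_row (msum n k (\<lambda>i. f i * X) I)" "b < dim_col (msum n k (\<lambda>i. f i * X) I)"
  hence ab: "a < n" "b < k" by auto
  have "(f i * X) $$ (a,b) = (\<Sum>l<m. f i $$ (a,l) * X $$ (l,b))" if "i \<in> I" for i
    using f[OF that] X ab by (simp add: index_mult_sum del: index_mult_mat(1))
  hence "msum n k (\<lambda>i. f i * X) I $$ (a,b) = (\<Sum>i\<in>I. \<Sum>l<m. f i $$ (a,l) * X $$ (l,b))"
    using ab by (simp add: msum_def)
  also have "\<dots> = (\<Sum>l<m. (\<Sum>i\<in>I. f i $$ (a,l)) * X $$ (l,b))"
    by (subst sum.swap) (simp add: sum_distrib_right)
  also have "\<dots> = (msum n m f I * X) $$ (a,b)"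
    using X ab by (simp add: index_mult_sum msum_def del: index_mult_mat(1))
  finally show "(msum n m f I * X) $$ (a,b) = msum n k (\<lambda>i. f i * X) I $$ (a,b)" ..
qed (use X in auto)

lemma msum_cong: "(\<And>i. i \<in> I \<Longrightarrow> f i = g i) \<Longrightarrow> msum n m f I = msum n m g I"
  unfolding msum_def by (intro eq_matI) auto

lemma msum_single:
  assumes "finite I" "j \<in> I" "X \<in> carrier_mat n m"
  shows "msum n m (\<lambda>i. if i = j then X else 0\<^sub>m n m) I = X"
proof (rule eq_matI)
  fix a b assume "a < dim_row X" "b < dim_col X"
  hence ab: "a < n" "b < m" using assms by auto
  have "(\<Sum>i\<in>I. (if i = j then X else 0\<^sub>m n m) $$ (a,b)) = (\<Sum>i\<in>I. if i = j then X $$ (a,b) else 0)"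
    using ab by (intro sum.cong) auto
  thus "msum n m (\<lambda>i. if i = j then X else 0\<^sub>m n m) I $$ (a,b) = X $$ (a,b)"
    using assms ab by (simp add: msum_def)
qed (use assms in auto)

lemma hermitian_msum:
  assumes "\<And>i. i \<in> I \<Longrightarrow> hermitian d (f i)" shows "hermitian d (msum d d f I)"
proof -
  have e: "cnj (f i $$ (b,a)) = f i $$ (a,b)" if "i \<in> I" "a < d" "b < d" for i a b
  proof -
    have "f i \<in> carrier_mat d d" "adj (f i) = f i" using assms[OF that(1)] by (auto simp: hermitian_def)
    thus ?thesis using that(2,3) adj_index[of a "f i" b] by simp
  qed
  have "adj (msum d d f I) = msum d d f I"
    by (rule eq_matI) (auto simp: msum_def e intro!: sum.cong)
  thus ?thesis by (simp add: hermitian_def)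
qed

lemma psd_msum:
  assumes "\<And>i. i \<in> I \<Longrightarrow> psd d (f i)" shows "psd d (msum d d f I)"
proof (rule psdI_rtr)
  show "hermitian d (msum d d f I)" using assms by (intro hermitian_msum) auto
  fix P assume P: "psd d P"
  show "0 \<le> rtr P (msum d d f I)" using P assms
    by (subst rtr_msum_right) (auto intro!: sum_nonneg rtr_psd_nonneg[of d])
qed

lemma hermitian_add: "hermitian d A \<Longrightarrow> hermitian d B \<Longrightarrow> hermitian d (A + B)"
  by (auto simp: hermitian_def adj_add[of _ d d])

lemma hermitian_smult: "hermitian d A \<Longrightarrow> hermitian d (complex_of_real c \<cdot>\<^sub>m A)"
  by (auto simp: hermitian_def adj_smult)

lemma hermitian_one[simp]: "hermitian d (1\<^sub>m d)"
  by (simp add: hermitian_def)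

lemma psd_one[simp]: "psd d (1\<^sub>m d)"
  using psd_gram[of "1\<^sub>m d" d d] by simp

lemma psd_zero[simp]: "psd d (0\<^sub>m d d)"
proof -
  have "adj (0\<^sub>m d d) = 0\<^sub>m d d" by (rule eq_matI) auto
  thus ?thesis using psd_gram[of "0\<^sub>m d d" d d] by simp
qed

lemma psd_add: assumes "psd d A" "psd d B" shows "psd d (A + B)"
proof (rule psdI_rtr)
  show "hermitian d (A + B)" using assms by (intro hermitian_add) auto
  fix P assume P: "psd d P"
  show "0 \<le> rtr P (A + B)" using P assms
    by (simp add: rtr_add_right[of _ d] rtr_psd_nonneg[of d])
qed

lemma psd_smult: assumes "psd d A" "0 \<le> c" shows "psd d (complex_of_real c \<cdot>\<^sub>m A)"
proof (rule psdI_rtr)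
  show "hermitian d (complex_of_real c \<cdot>\<^sub>m A)" using assms by (intro hermitian_smult) auto
  fix P assume P: "psd d P"
  show "0 \<le> rtr P (complex_of_real c \<cdot>\<^sub>m A)" using P assms
    by (simp add: rtr_smult_right[of _ d] rtr_psd_nonneg[of d])
qed

lemma rtr_one_right: "A \<in> carrier_mat d d \<Longrightarrow> rtr A (1\<^sub>m d) = Re (mtrace A)"
  by (simp add: rtr_def)

section \<open>Duality for state discrimination\<close>

lemma mtrace_conj_diag_real:
  assumes "unitary_mat d U" shows "mtrace (U * diag_real d l * adj U) = complex_of_real (\<Sum>i<d. l i)"
proof -
  note U = unitary_matD[OF assms]
  have "mtrace (U * diag_real d l * adj U) = mtrace (adj U * (U * diag_real d l))"
    using U(1,2) by (intro mtrace_comm[of _ d d]) auto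
  also have "adj U * (U * diag_real d l) = diag_real d l"
    using U by (simp flip: assoc_mult_mat[of _ d d _ d _ d])
  finally show ?thesis by (simp add: mtrace_def diag_real_def)
qed

text \<open>The eigenprojections of \<open>A\<close> itself suffice as tests. Restricting to
  projections of trace one makes the perturbed measurement below computable and fixes the size of
  the error term.\<close>

lemma psdI_projection:
  assumes A: "hermitian d A"
    and pos: "\<And>P. psd d P \<Longrightarrow> P * P = P \<Longrightarrow> rtr P (1\<^sub>m d) = 1 \<Longrightarrow> 0 \<le> rtr P A"
  shows "psd d A"
proof -
  obtain U l where uU: "unitary_mat d U" and A': "A = U * diag_real d l * adj U"
    using hermitian_spectral[OF A] by blast
  note U = unitary_matD[OF uU]
  have mul: "(U * diag_real d f * adj U) * (U * diag_real d g * adj U) = U * diag_real d (\<lambda>i. f i * g i) * adj U" for f g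
  proof -
    have "(U * diag_real d f * adj U) * (U * diag_real d g * adj U) = U * diag_real d f * (adj U * U) * diag_real d g * adj U"
      using U(1,2) by (simp add: assoc_mult_mat[of _ d d _ d _ d])
    also have "\<dots> = U * (diag_real d f * diag_real d g) * adj U"
      using U by (simp add: assoc_mult_mat[of _ d d _ d _ d])
    finally show ?thesis by (simp add: diag_real_mult)
  qed
  have "0 \<le> l i" if i: "i < d" for i
  proof -
    let ?e = "\<lambda>j. if j = i then 1 else 0 :: real"
    let ?P = "U * diag_real d ?e * adj U"
    have e: "(\<lambda>j. ?e j * ?e j) = ?e" by auto
    have "0 \<le> rtr ?P A"
    proof (rule pos)
      show "psd d ?P" by (rule psd_conj_diag_real[OF uU]) auto
      show "?P * ?P = ?P" unfolding mul e ..
      show "rtr ?P (1\<^sub>m d) = 1" using U(1,2) i by (subst rtr_one_right) (auto simp: mtrace_conj_diag_real[OF uU])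
    qed
    also have "rtr ?P A = (\<Sum>j<d. ?e j * l j)"
      unfolding rtr_def A' mul by (simp add: mtrace_conj_diag_real[OF uU])
    also have "\<dots> = l i" using i by (simp add: if_distrib[of "\<lambda>x. x * _"] cong: if_cong)
    finally show ?thesis .
  qed
  thus ?thesis unfolding A' by (rule psd_conj_diag_real[OF uU])
qed

definition is_povm :: "nat \<Rightarrow> nat \<Rightarrow> (nat \<Rightarrow> complex mat) \<Rightarrow> bool" where
  "is_povm d M \<Lambda> \<longleftrightarrow> (\<forall>m<M. psd d (\<Lambda> m)) \<and> msum d d \<Lambda> {..<M} = 1\<^sub>m d"

lemma is_povm_rtr:
  assumes "is_povm d M \<Lambda>" "W \<in> carrier_mat d d"
  shows "(\<Sum>m<M. rtr W (\<Lambda> m)) = rtr W (1\<^sub>m d)"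
  using rtr_msum_right[of W d "{..<M}" \<Lambda>] assms by (auto simp: is_povm_def)

lemma is_povm_rtr_le:
  assumes "is_povm d M \<Lambda>" "psd d W" "m < M"
  shows "rtr W (\<Lambda> m) \<le> rtr W (1\<^sub>m d)"
proof -
  have "rtr W (\<Lambda> m) \<le> (\<Sum>m<M. rtr W (\<Lambda> m))"
    using assms by (intro member_le_sum) (auto simp: is_povm_def intro: rtr_psd_nonneg)
  thus ?thesis using is_povm_rtr[OF assms(1)] assms(2) by simp
qed

text \<open>Near-optimality against this perturbation yields approximate optimality conditions of
  Holevo, Yuen, Kennedy and Lax, which avoids a compactness argument.\<close>

lemma is_povm_perturb:
  assumes L: "is_povm d M \<Lambda>" and P: "psd d P" "P * P = P" and m0: "m0 < M" and e: "0 \<le> e" "e \<le> 1"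
  defines "E \<equiv> 1\<^sub>m d - complex_of_real e \<cdot>\<^sub>m P"
  defines "\<Lambda>' \<equiv> \<lambda>m. E * \<Lambda> m * E + (if m = m0 then complex_of_real (2 * e - e\<^sup>2) \<cdot>\<^sub>m P else 0\<^sub>m d d)"
  shows "is_povm d M \<Lambda>'"
proof -
  have Pc: "P \<in> carrier_mat d d" using P by simp
  have E: "E \<in> carrier_mat d d" using Pc by (simp add: E_def)
  have Lc: "\<Lambda> m \<in> carrier_mat d d" if "m < M" for m using L that by (auto simp: is_povm_def)
  have adjE: "adj E = E" using Pc psd_adj[OF P(1)] by (simp add: E_def adj_minus[of _ d d] adj_smult)
  have e2: "0 \<le> 2 * e - e\<^sup>2" using e mult_left_mono[of e 1 e] by (simp add: power2_eq_square)
  have "psd d (\<Lambda>' m)" if "m < M" for m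
  proof -
    have "psd d (\<Lambda> m)" using L that by (simp add: is_povm_def)
    from psd_conj[OF this E] have "psd d (E * \<Lambda> m * E)" by (simp add: adjE)
    moreover have "psd d (if m = m0 then complex_of_real (2 * e - e\<^sup>2) \<cdot>\<^sub>m P else 0\<^sub>m d d)"
      using psd_smult[OF P(1) e2] by simp
    ultimately show ?thesis unfolding \<Lambda>'_def by (rule psd_add)
  qed
  moreover have "msum d d \<Lambda>' {..<M} = 1\<^sub>m d"
  proof -
    have "msum d d \<Lambda>' {..<M} = msum d d (\<lambda>m. E * \<Lambda> m * E) {..<M} + complex_of_real (2 * e - e\<^sup>2) \<cdot>\<^sub>m P"
      unfolding \<Lambda>'_def using Lc E Pc m0 by (subst msum_add) (auto simp: msum_single)
    also have "msum d d (\<lambda>m. E * \<Lambda> m * E) {..<M} = E * msum d d \<Lambda> {..<M} * E"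
      using Lc E by (subst mult_msum[of E d d], simp, simp, subst msum_mult[of E d d], simp_all)
    also have "\<dots> = E * E" using L E by (simp add: is_povm_def)
    \<comment> \<open>Origin of the constant: (1 - e P)^2 = 1 - (2 e - e^2) P for a projection, and
      the missing weight is given to the outcome \<open>m0\<close>.\<close>
    also have "E * E = E - complex_of_real e \<cdot>\<^sub>m (P * E)"
      using Pc E by (subst (1) E_def) (simp add: minus_mult_distrib_mat[of _ d d _ _ d] mult_smult_assoc_mat[of _ d d _ d])
    also have "P * E = P - complex_of_real e \<cdot>\<^sub>m P"
      using Pc P(2) unfolding E_def by (simp add: mult_minus_distrib_mat[of _ d d _ d] mult_smult_distrib[of _ d d _ d])
    also have "E - complex_of_real e \<cdot>\<^sub>m (P - complex_of_real e \<cdot>\<^sub>m P) + complex_of_real (2 * e - e\<^sup>2) \<cdot>\<^sub>m P = 1\<^sub>m d"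
      unfolding E_def using Pc by (intro eq_matI) (auto simp: algebra_simps power2_eq_square)
    finally show ?thesis .
  qed
  ultimately show ?thesis by (simp add: is_povm_def)
qed

text \<open>In the expansion of (1 - e P) L (1 - e P), the linear terms move onto \<open>P\<close>
  by cyclicity of the trace. The quadratic term e^2 tr(W P L P) is nonnegative and is
  dropped.\<close>

lemma rtr_perturb:
  fixes e :: real
  assumes W: "psd d W" and L: "psd d L" and P: "psd d P"
  defines "E \<equiv> 1\<^sub>m d - complex_of_real e \<cdot>\<^sub>m P"
  shows "rtr W L - e * rtr P (W * L + L * W) \<le> rtr W (E * L * E)"
proof -
  have C: "W \<in> carrier_mat d d" "L \<in> carrier_mat d d" "P \<in> carrier_mat d d" using W L P by auto
  have "psd d (P * L * P)" using psd_conj[OF L C(3)] by (simp add: psd_adj[OF P])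
  hence nn: "0 \<le> e\<^sup>2 * rtr W (P * L * P)" using rtr_psd_nonneg[OF W] by simp
  have "E * L = L - complex_of_real e \<cdot>\<^sub>m (P * L)"
    unfolding E_def using C by (simp add: minus_mult_distrib_mat[of _ d d _ _ d] mult_smult_assoc_mat[of _ d d _ d])
  moreover have "X * E = X - complex_of_real e \<cdot>\<^sub>m (X * P)" if "X \<in> carrier_mat d d" for X
    unfolding E_def using C that by (simp add: mult_minus_distrib_mat[of _ d d _ d] mult_smult_distrib[of _ d d _ d])
  ultimately have "E * L * E = (L - complex_of_real e \<cdot>\<^sub>m (P * L)) - complex_of_real e \<cdot>\<^sub>m ((L - complex_of_real e \<cdot>\<^sub>m (P * L)) * P)"
    using C by simp
  also have "(L - complex_of_real e \<cdot>\<^sub>m (P * L)) * P = L * P - complex_of_real e \<cdot>\<^sub>m (P * L * P)"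
    using C by (simp add: minus_mult_distrib_mat[of _ d d _ _ d] mult_smult_assoc_mat[of _ d d _ d])
  finally have "rtr W (E * L * E) = rtr W L - e * rtr W (P * L) - e * (rtr W (L * P) - e * rtr W (P * L * P))"
    using C by (simp add: rtr_minus_right[of _ d] rtr_smult_right[of _ d])
  moreover have "rtr W (P * L) = rtr P (L * W)"
  proof -
    have "rtr W (P * L) = rtr (P * L) W" using C by (simp add: rtr_comm[of W d d])
    thus ?thesis using C by (simp add: rtr_def assoc_mult_mat[of _ d d _ d _ d])
  qed
  moreover have "rtr W (L * P) = rtr P (W * L)"
  proof -
    have "rtr W (L * P) = rtr (W * L) P" using C by (simp add: rtr_def assoc_mult_mat[of _ d d _ d _ d])
    thus ?thesis using C by (simp add: rtr_comm[of "W * L" d d])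
  qed
  moreover have "rtr P (W * L + L * W) = rtr P (W * L) + rtr P (L * W)" using C by (simp add: rtr_add_right[of _ d])
  ultimately show ?thesis using nn by (simp add: algebra_simps power2_eq_square)
qed

text \<open>The dual point is the Lagrange operator of a nearly optimal measurement, symmetrised and
  lifted by a small multiple of the identity. The lift pays for the measurement being only nearly
  optimal, and its trace is what \<open>\<eta>\<close> accounts for.\<close>

theorem povm_duality:
  assumes W: "\<And>m. m < M \<Longrightarrow> psd d (W m)" and M: "0 < M" and eta: "0 < \<eta>"
  obtains \<Lambda> K where "is_povm d M \<Lambda>" "hermitian d K" "\<And>m. m < M \<Longrightarrow> psd d (K - W m)"
    "rtr K (1\<^sub>m d) \<le> (\<Sum>m<M. rtr (W m) (\<Lambda> m)) + \<eta>"
proof -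
  define val where "val \<Lambda> = (\<Sum>m<M. rtr (W m) (\<Lambda> m))" for \<Lambda>
  define c where "c = (\<Sum>m<M. rtr (W m) (1\<^sub>m d))"
  have Wc: "W m \<in> carrier_mat d d" if "m < M" for m using W[OF that] by simp
  have Wt: "0 \<le> rtr (W m) (1\<^sub>m d)" if "m < M" for m using rtr_psd_nonneg[OF W[OF that] psd_one] .
  have c: "0 \<le> c" unfolding c_def using Wt by (intro sum_nonneg) auto
  have Wle: "rtr (W m) (1\<^sub>m d) \<le> c" if "m < M" for m
    unfolding c_def using Wt that by (intro member_le_sum) auto
  have val_le: "val \<Lambda> \<le> c" if "is_povm d M \<Lambda>" for \<Lambda>
    unfolding val_def c_def using is_povm_rtr_le[OF that] W by (intro sum_mono) auto
  have "is_povm d M (\<lambda>m. if m = 0 then 1\<^sub>m d else 0\<^sub>m d d)"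
    using M by (auto simp: is_povm_def msum_single)
  hence ne: "val ` {\<Lambda>. is_povm d M \<Lambda>} \<noteq> {}" by blast
  have bdd: "bdd_above (val ` {\<Lambda>. is_povm d M \<Lambda>})" using val_le by (intro bdd_aboveI2[where M = c]) auto
  \<comment> \<open>One parameter is both perturbation size and slack. It is at most 1 so that the
    perturbation is a measurement, and small enough that the lift x (1 + c) / 2 has trace at most
    \<open>\<eta>\<close>; \<open>real d + 1\<close> keeps the denominator positive when d =
    0.\<close>
  define x where "x = min 1 (2 * \<eta> / ((1 + c) * (real d + 1)))"
  have x: "0 < x" "x \<le> 1" using eta c by (auto simp: x_def)
  have xd: "x * (1 + c) / 2 * real d \<le> \<eta>"
  proof -
    have "x * ((1 + c) * (real d + 1)) \<le> 2 * \<eta>"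
      using c by (simp add: x_def pos_le_divide_eq[symmetric] add_pos_nonneg)
    moreover have "x * (1 + c) * real d \<le> x * ((1 + c) * (real d + 1))"
      using x c by (simp add: algebra_simps)
    ultimately show ?thesis by simp
  qed
  \<comment> \<open>The tolerance x^2 matches the second-order terms of a perturbation of size x, so
    that after division by x only an error of order x remains.\<close>
  have "Sup (val ` {\<Lambda>. is_povm d M \<Lambda>}) - x\<^sup>2 < Sup (val ` {\<Lambda>. is_povm d M \<Lambda>})" using x by simp
  then obtain \<Lambda> where L: "is_povm d M \<Lambda>" and "Sup (val ` {\<Lambda>. is_povm d M \<Lambda>}) - x\<^sup>2 < val \<Lambda>"
    unfolding less_cSup_iff[OF ne bdd] by blast
  hence opt: "val \<Lambda>' \<le> val \<Lambda> + x\<^sup>2" if "is_povm d M \<Lambda>'" for \<Lambda>'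
    using cSup_upper[OF _ bdd, of "val \<Lambda>'"] that by force
  have Lp: "psd d (\<Lambda> m)" if "m < M" for m using L that by (simp add: is_povm_def)
  have Lc: "\<Lambda> m \<in> carrier_mat d d" if "m < M" for m using Lp[OF that] by simp
  define G where "G m = W m * \<Lambda> m + \<Lambda> m * W m" for m
  have Gc: "G m \<in> carrier_mat d d" if "m < M" for m using Wc[OF that] Lc[OF that] by (simp add: G_def)
  \<comment> \<open>Symmetrisation of the sum of W_m \<Lambda>_m, which need not be Hermitian for a
    measurement that is not exactly optimal. Its trace is still the success value.\<close>
  define H where "H = complex_of_real (1/2) \<cdot>\<^sub>m msum d d G {..<M}"
  have Hc: "H \<in> carrier_mat d d" by (simp add: H_def)
  have Hr: "rtr P H = (\<Sum>m<M. rtr P (G m)) / 2" if "P \<in> carrier_mat d d" for P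
    unfolding H_def using that Gc rtr_msum_right[OF that, of "{..<M}" G] by (subst rtr_smult_right[of _ d]) auto
  have "hermitian d (G m)" if m: "m < M" for m
  proof -
    have "adj (W m * \<Lambda> m) = \<Lambda> m * W m" "adj (\<Lambda> m * W m) = W m * \<Lambda> m"
      using carrier_matD[OF Wc[OF m]] carrier_matD[OF Lc[OF m]] by (simp_all add: adj_mult psd_adj[OF W[OF m]] psd_adj[OF Lp[OF m]])
    hence "adj (G m) = G m" unfolding G_def using Wc[OF m] Lc[OF m]
      by (subst adj_add[of _ d d]) (auto simp: comm_add_mat[of _ d d])
    thus ?thesis using Gc[OF m] by (simp add: hermitian_def)
  qed
  hence Hh: "hermitian d H" unfolding H_def by (intro hermitian_smult hermitian_msum) auto
  define K where "K = H + complex_of_real (x * (1 + c) / 2) \<cdot>\<^sub>m 1\<^sub>m d"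
  have Kh: "hermitian d K" unfolding K_def by (intro hermitian_add Hh hermitian_smult) simp
  have Kr: "rtr P K = rtr P H + x * (1 + c) / 2 * rtr P (1\<^sub>m d)" if "P \<in> carrier_mat d d" for P
    unfolding K_def using that Hc by (subst rtr_add_right[of _ d]) (auto simp: rtr_smult_right[of _ d] simp del: of_real_mult of_real_divide)
  have KW: "psd d (K - W m0)" if m0: "m0 < M" for m0
  proof (rule psdI_projection)
    show "hermitian d (K - W m0)" using Kh W[OF m0] by (intro hermitian_minus) auto
    fix P assume P: "psd d P" "P * P = P" "rtr P (1\<^sub>m d) = 1"
    have Pc: "P \<in> carrier_mat d d" using P by simp
    define E where "E = 1\<^sub>m d - complex_of_real x \<cdot>\<^sub>m P"
    have Ec: "E \<in> carrier_mat d d" using Pc by (simp add: E_def)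
    define \<Lambda>' where "\<Lambda>' m = E * \<Lambda> m * E + (if m = m0 then complex_of_real (2 * x - x\<^sup>2) \<cdot>\<^sub>m P else 0\<^sub>m d d)" for m
    have "is_povm d M \<Lambda>'"
      unfolding \<Lambda>'_def E_def using is_povm_perturb[OF L P(1,2) m0, of x] x by simp
    hence "val \<Lambda>' \<le> val \<Lambda> + x\<^sup>2" by (rule opt)
    moreover have "val \<Lambda> - x * (2 * rtr P H) + (2 * x - x\<^sup>2) * rtr P (W m0) \<le> val \<Lambda>'"
    proof -
      have z: "rtr (W m) (0\<^sub>m d d) = 0" if "m < M" for m
        using Wc[OF that] by (simp add: rtr_def mtrace_def)
      have "val \<Lambda>' = (\<Sum>m<M. rtr (W m) (E * \<Lambda> m * E) + (if m = m0 then (2 * x - x\<^sup>2) * rtr (W m0) P else 0))"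
        unfolding val_def \<Lambda>'_def using Wc Lc Ec Pc z
        by (intro sum.cong refl) (auto simp: rtr_add_right[of _ d] rtr_smult_right[of _ d] simp del: of_real_diff of_real_mult)
      also have "\<dots> = (\<Sum>m<M. rtr (W m) (E * \<Lambda> m * E)) + (2 * x - x\<^sup>2) * rtr P (W m0)"
        using m0 Wc[OF m0] Pc by (simp add: sum.distrib rtr_comm[of P d d])
      finally have v: "val \<Lambda>' = (\<Sum>m<M. rtr (W m) (E * \<Lambda> m * E)) + (2 * x - x\<^sup>2) * rtr P (W m0)" .
      have HG: "2 * rtr P H = (\<Sum>m<M. rtr P (G m))" using Hr[OF Pc] by simp
      have "(\<Sum>m<M. rtr (W m) (\<Lambda> m) - x * rtr P (G m)) \<le> (\<Sum>m<M. rtr (W m) (E * \<Lambda> m * E))"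
        unfolding E_def G_def using W Lp P(1) by (intro sum_mono rtr_perturb) auto
      hence "val \<Lambda> - x * (2 * rtr P H) \<le> (\<Sum>m<M. rtr (W m) (E * \<Lambda> m * E))"
        unfolding HG by (simp add: val_def sum_subtractf sum_distrib_left)
      thus ?thesis unfolding v by simp
    qed
    \<comment> \<open>The value gained at \<open>m0\<close> is at most the tolerance x^2; the loss
      is linear in x up to a term of favourable sign. Collecting the terms with x^2 gives the factor
      1 + tr(P W_m0), next bounded by 1 + c.\<close>
    ultimately have 1: "x * (2 * (rtr P (W m0) - rtr P H)) \<le> x * (x * (1 + rtr P (W m0)))"
      by (simp add: algebra_simps power2_eq_square)
    have "rtr P (W m0) \<le> c"
    proof -
      have "psd d ((1\<^sub>m d - P) * 1\<^sub>m d * adj (1\<^sub>m d - P))" using Pc by (intro psd_conj) auto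
      also have "(1\<^sub>m d - P) * 1\<^sub>m d * adj (1\<^sub>m d - P) = 1\<^sub>m d - P"
        using Pc P(2) psd_adj[OF P(1)]
        by (simp add: adj_minus[of _ d d] minus_mult_distrib_mat[of _ d d _ _ d] mult_minus_distrib_mat[of _ d d _ d])
          (intro eq_matI, auto)
      finally have "0 \<le> rtr (W m0) (1\<^sub>m d - P)" by (rule rtr_psd_nonneg[OF W[OF m0]])
      thus ?thesis using Wle[OF m0] Wc[OF m0] Pc by (simp add: rtr_minus_right[of _ d] rtr_comm[of P d d])
    qed
    hence "x * (x * (1 + rtr P (W m0))) \<le> x * (x * (1 + c))" using x by simp
    with 1 have "x * (2 * (rtr P (W m0) - rtr P H)) \<le> x * (x * (1 + c))" by linarith
    hence "2 * (rtr P (W m0) - rtr P H) \<le> x * (1 + c)" using x by simp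
    thus "0 \<le> rtr P (K - W m0)"
      using Kr[OF Pc] P(3) Pc Kh Wc[OF m0] by (simp add: rtr_minus_right[of _ d])
  qed
  have "rtr K (1\<^sub>m d) = rtr (1\<^sub>m d) K" using Kh by (intro rtr_comm[of _ d d]) auto
  also have "\<dots> = rtr (1\<^sub>m d) H + x * (1 + c) / 2 * real d"
    using Kr[of "1\<^sub>m d"] by (simp add: rtr_one_right mtrace_def)
  also have "rtr (1\<^sub>m d) H = val \<Lambda>"
  proof -
    have "rtr (1\<^sub>m d) (G m) = 2 * rtr (W m) (\<Lambda> m)" if m: "m < M" for m
      using Wc[OF m] Lc[OF m] unfolding G_def
      by (simp add: rtr_def mtrace_add[of _ d] mtrace_comm[of "\<Lambda> m" d d])
    thus ?thesis by (simp add: Hr val_def sum_distrib_left[symmetric])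
  qed
  finally have "rtr K (1\<^sub>m d) \<le> val \<Lambda> + \<eta>" using xd by simp
  thus ?thesis using that[OF L Kh KW] by (simp add: val_def)
qed

text \<open>The matrices to be discriminated are the B_m^(1+s), while the bound involves the B_m.
  Discarding the matrix with index \<open>m\<close> from the sum \<open>A\<close> leaves the
  interference A - B_m.\<close>

theorem packing_povm:
  assumes B: "\<And>m. m < M \<Longrightarrow> psd d (B m)" and M: "0 < M" and s: "0 < s" "s \<le> 1" and eta: "0 < \<eta>"
  obtains \<Lambda> where "is_povm d M \<Lambda>"
    "(\<Sum>m<M. rtr (mat_powr (B m) (1 + s)) (1\<^sub>m d) - rtr (mat_powr (B m) (1 + s)) (\<Lambda> m))
      \<le> (1 + s) * (\<Sum>m<M. rtr (B m) (mat_powr (msum d d B ({..<M} - {m})) s)) + \<eta>"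
proof -
  define A where "A = msum d d B {..<M}"
  have A: "psd d A" unfolding A_def using B by (intro psd_msum) auto
  have AB: "A - B m = msum d d B ({..<M} - {m})" if "m < M" for m
  proof (rule eq_matI)
    fix i j assume "i < dim_row (msum d d B ({..<M} - {m}))" "j < dim_col (msum d d B ({..<M} - {m}))"
    thus "(A - B m) $$ (i,j) = msum d d B ({..<M} - {m}) $$ (i,j)"
      using psd_carrier[OF B[OF that]] that by (simp add: A_def msum_def sum_diff1)
  qed (use psd_carrier[OF B[OF that]] in auto)
  have S: "psd d (A - B m)" if "m < M" for m unfolding AB[OF that] using B by (intro psd_msum) auto
  have A_eq: "rtr P A = (\<Sum>m<M. rtr P (B m))" if "P \<in> carrier_mat d d" for P
    unfolding A_def using that B by (intro rtr_msum_right) auto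
  obtain \<Lambda> K where L: "is_povm d M \<Lambda>" and K: "hermitian d K"
    and KB: "\<And>m. m < M \<Longrightarrow> psd d (K - mat_powr (B m) (1 + s))"
    and tr: "rtr K (1\<^sub>m d) \<le> (\<Sum>m<M. rtr (mat_powr (B m) (1 + s)) (\<Lambda> m)) + \<eta>"
    using povm_duality[of M d "\<lambda>m. mat_powr (B m) (1 + s)", OF mat_powr_psd[OF B] M eta] by blast
  \<comment> \<open>Duality yields \<open>K\<close> only as Hermitian; it is positive because it
    dominates a positive matrix, which exists since M > 0.\<close>
  have "psd d ((K - mat_powr (B 0) (1 + s)) + mat_powr (B 0) (1 + s))"
    using KB[OF M] B[OF M] by (intro psd_add) auto
  also have "(K - mat_powr (B 0) (1 + s)) + mat_powr (B 0) (1 + s) = K"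
    using hermitian_carrier[OF K] psd_carrier[OF mat_powr_psd[OF B[OF M]], of "1 + s"] by (intro eq_matI) auto
  finally have Kp: "psd d K" .
  have "(\<Sum>m<M. rtr (mat_powr (B m) (1 + s)) (1\<^sub>m d))
    - (1 + s) * (\<Sum>m<M. rtr (B m) (mat_powr (A - B m) s)) \<le> rtr K (1\<^sub>m d)"
    by (rule packing_dual_bound[of "{..<M}" d B A K s]) (use B A A_eq S Kp KB s in auto)
  also have "(\<Sum>m<M. rtr (B m) (mat_powr (A - B m) s)) = (\<Sum>m<M. rtr (B m) (mat_powr (msum d d B ({..<M} - {m})) s))"
    using AB by simp
  finally show ?thesis using tr by (intro that[OF L]) (simp add: sum_subtractf)
qed

section \<open>Kronecker products\<close>

lemma sum_div_mod:
  fixes f :: "nat \<Rightarrow> nat \<Rightarrow> 'a :: comm_monoid_add"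
  shows "(\<Sum>i<n*m. f (i div m) (i mod m)) = (\<Sum>a<n. \<Sum>b<m. f a b)"
proof -
  have "(\<Sum>i<n*m. f (i div m) (i mod m)) = (\<Sum>(a,b)\<in>{..<n}\<times>{..<m}. f a b)"
  proof (rule sum.reindex_bij_witness[where i = "\<lambda>(a,b). a * m + b" and j = "\<lambda>i. (i div m, i mod m)"])
    fix x assume "x \<in> {..<n} \<times> {..<m}"
    then obtain a b where x: "x = (a,b)" "a < n" "b < m" by auto
    have "a * m + b < (a + 1) * m" using x by simp
    also have "\<dots> \<le> n * m" using x by (intro mult_right_mono) auto
    finally show "(case x of (a,b) \<Rightarrow> a * m + b) \<in> {..<n*m}" using x by simp
  next
    fix i assume "i \<in> {..<n*m}"
    hence i: "i < n * m" by simp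
    hence "0 < m" by (cases m) auto
    thus "(i div m, i mod m) \<in> {..<n} \<times> {..<m}" using i by (simp add: less_mult_imp_div_less)
  qed auto
  thus ?thesis by (simp add: sum.cartesian_product)
qed

lemma div_mod_less:
  assumes "i < n * (m::nat)" shows "i div m < n" "i mod m < m"
  using assms by (simp add: less_mult_imp_div_less, cases m) auto

lemma div_mod_eq_iff: "i div m = j div m \<and> i mod m = j mod m \<longleftrightarrow> i = (j::nat)"
  by (metis div_mult_mod_eq)

lemma kron_carrier[simp]:
  "A \<in> carrier_mat n n' \<Longrightarrow> B \<in> carrier_mat m m' \<Longrightarrow> kron A B \<in> carrier_mat (n * m) (n' * m')"
  by (simp add: kron_def)

lemma kron_dim[simp]: "dim_row (kron A B) = dim_row A * dim_row B" "dim_col (kron A B) = dim_col A * dim_col B"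
  by (simp_all add: kron_def)

lemma kron_index:
  assumes "A \<in> carrier_mat n n'" "B \<in> carrier_mat m m'" "i < n * m" "j < n' * m'"
  shows "kron A B $$ (i,j) = A $$ (i div m, j div m') * B $$ (i mod m, j mod m')"
  using assms by (simp add: kron_def)

lemma kron_mult:
  assumes A: "A \<in> carrier_mat n n" "C \<in> carrier_mat n n" and B: "B \<in> carrier_mat m m" "D \<in> carrier_mat m m"
  shows "kron A B * kron C D = kron (A * C) (B * D)"
proof (rule eq_matI)
  fix i j assume "i < dim_row (kron (A * C) (B * D))" "j < dim_col (kron (A * C) (B * D))"
  hence ij: "i < n * m" "j < n * m" using A B by auto
  note im = div_mod_less[OF ij(1)] and jm = div_mod_less[OF ij(2)]
  have "(kron A B * kron C D) $$ (i,j)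
      = (\<Sum>l<n*m. A $$ (i div m, l div m) * B $$ (i mod m, l mod m) * (C $$ (l div m, j div m) * D $$ (l mod m, j mod m)))"
    using A B ij by (simp add: index_mult_sum kron_index[of _ n n _ m m] del: index_mult_mat(1))
  also have "\<dots> = (\<Sum>a<n. \<Sum>b<m. A $$ (i div m, a) * B $$ (i mod m, b) * (C $$ (a, j div m) * D $$ (b, j mod m)))"
    by (rule sum_div_mod)
  also have "\<dots> = (\<Sum>a<n. A $$ (i div m, a) * C $$ (a, j div m)) * (\<Sum>b<m. B $$ (i mod m, b) * D $$ (b, j mod m))"
    unfolding sum_product by (intro sum.cong refl) (simp add: mult_ac)
  also have "\<dots> = kron (A * C) (B * D) $$ (i,j)"
    using A B ij im jm by (simp add: index_mult_sum kron_index[of _ n n _ m m] del: index_mult_mat(1))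
  finally show "(kron A B * kron C D) $$ (i,j) = kron (A * C) (B * D) $$ (i,j)" .
qed (use A B in auto)

lemma adj_kron:
  assumes "A \<in> carrier_mat n n" "B \<in> carrier_mat m m" shows "adj (kron A B) = kron (adj A) (adj B)"
proof (rule eq_matI)
  fix i j assume "i < dim_row (kron (adj A) (adj B))" "j < dim_col (kron (adj A) (adj B))"
  hence ij: "i < n * m" "j < n * m" using assms by auto
  thus "adj (kron A B) $$ (i,j) = kron (adj A) (adj B) $$ (i,j)"
    using assms div_mod_less[OF ij(1)] div_mod_less[OF ij(2)] by (simp add: kron_index[of _ n n _ m m])
qed (use assms in auto)

lemma kron_diag_real:
  "kron (diag_real n l) (diag_real m k) = diag_real (n * m) (\<lambda>i. l (i div m) * k (i mod m))"
proof (rule eq_matI)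
  fix i j assume "i < dim_row (diag_real (n * m) (\<lambda>i. l (i div m) * k (i mod m)))"
    "j < dim_col (diag_real (n * m) (\<lambda>i. l (i div m) * k (i mod m)))"
  hence ij: "i < n * m" "j < n * m" by auto
  thus "kron (diag_real n l) (diag_real m k) $$ (i,j) = diag_real (n * m) (\<lambda>i. l (i div m) * k (i mod m)) $$ (i,j)"
    using div_mod_less[OF ij(1)] div_mod_less[OF ij(2)] div_mod_eq_iff[of i m j]
    by (auto simp: kron_index[of _ n n _ m m] diag_real_def)
qed auto

lemma one_eq_diag_real: "1\<^sub>m d = diag_real d (\<lambda>_. 1)"
  by (rule eq_matI) (auto simp: diag_real_def)

lemma kron_one: "kron (1\<^sub>m n) (1\<^sub>m m) = 1\<^sub>m (n * m)"
  unfolding one_eq_diag_real kron_diag_real by simp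

lemma mtrace_kron:
  assumes "A \<in> carrier_mat n n" "B \<in> carrier_mat m m" shows "mtrace (kron A B) = mtrace A * mtrace B"
proof -
  have "mtrace (kron A B) = (\<Sum>i<n*m. A $$ (i div m, i div m) * B $$ (i mod m, i mod m))"
    using assms by (simp add: mtrace_def kron_index[of _ n n _ m m])
  also have "\<dots> = (\<Sum>a<n. \<Sum>b<m. A $$ (a,a) * B $$ (b,b))" by (rule sum_div_mod)
  finally show ?thesis using assms by (simp add: mtrace_def sum_product)
qed

lemma unitary_kron:
  assumes "unitary_mat n U" "unitary_mat m V" shows "unitary_mat (n * m) (kron U V)"
  using unitary_matD[OF assms(1)] unitary_matD[OF assms(2)]
  by (simp add: unitary_mat_def adj_kron[of _ n _ m] kron_mult[of _ n _ _ m] kron_one)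

lemma kron_spectral:
  assumes "unitary_mat n U" "unitary_mat m V"
  shows "kron (U * diag_real n l * adj U) (V * diag_real m k * adj V)
    = kron U V * diag_real (n * m) (\<lambda>i. l (i div m) * k (i mod m)) * adj (kron U V)"
  using unitary_matD(1,2)[OF assms(1)] unitary_matD(1,2)[OF assms(2)]
  by (simp add: adj_kron[of _ n _ m] kron_mult[of _ n _ _ m] flip: kron_diag_real)

text \<open>A Kronecker product of eigenbases diagonalises the product, with products of
  eigenvalues. By \<open>mat_fun_eq\<close> the power may be computed in that basis, and
  \<open>powr\<close> is multiplicative on nonnegative numbers.\<close>

lemma kron_psd_powr:
  assumes A: "psd n A" and B: "psd m B"
  shows kron_psd: "psd (n * m) (kron A B)"
    and mat_powr_kron: "mat_powr (kron A B) q = kron (mat_powr A q) (mat_powr B q)"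
proof -
  obtain U l where U: "unitary_mat n U" and A': "A = U * diag_real n l * adj U"
    and fA: "\<And>f. mat_fun f A = U * diag_real n (f \<circ> l) * adj U" and l: "\<And>i. 0 \<le> l i"
    using psd_spectral[OF A] by blast
  obtain V k where V: "unitary_mat m V" and B': "B = V * diag_real m k * adj V"
    and fB: "\<And>f. mat_fun f B = V * diag_real m (f \<circ> k) * adj V" and k: "\<And>i. 0 \<le> k i"
    using psd_spectral[OF B] by blast
  note UV = unitary_kron[OF U V]
  have AB: "kron A B = kron U V * diag_real (n * m) (\<lambda>i. l (i div m) * k (i mod m)) * adj (kron U V)"
    unfolding A' B' by (rule kron_spectral[OF U V])
  show P: "psd (n * m) (kron A B)" unfolding AB using l k by (intro psd_conj_diag_real[OF UV]) simp
  have "mat_powr (kron A B) q = kron U V * diag_real (n * m) ((\<lambda>x. x powr q) \<circ> (\<lambda>i. l (i div m) * k (i mod m))) * adj (kron U V)"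
    unfolding mat_powr_eq[OF P] by (rule mat_fun_eq[OF UV AB])
  also have "(\<lambda>x. x powr q) \<circ> (\<lambda>i. l (i div m) * k (i mod m))
    = (\<lambda>i. ((\<lambda>x. x powr q) \<circ> l) (i div m) * ((\<lambda>x. x powr q) \<circ> k) (i mod m))"
    using l k by (auto simp: powr_mult)
  finally show "mat_powr (kron A B) q = kron (mat_powr A q) (mat_powr B q)"
    unfolding mat_powr_eq[OF A] mat_powr_eq[OF B] fA fB by (simp only: kron_spectral[OF U V])
qed

lemma mat_powr_one_mat: "mat_powr (1\<^sub>m d) q = 1\<^sub>m d"
proof -
  have u: "unitary_mat d (1\<^sub>m d)" by (simp add: unitary_mat_def)
  have 1: "1\<^sub>m d = 1\<^sub>m d * diag_real d (\<lambda>_. 1) * adj (1\<^sub>m d)" by (simp flip: one_eq_diag_real)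
  show ?thesis unfolding mat_powr_def using mat_fun_eq[OF u 1, of "\<lambda>x. if 0 < x then x powr q else 0"]
    by (simp add: comp_def flip: one_eq_diag_real)
qed

lemma tensor_states_psd:
  assumes "\<And>x. x \<in> set xs \<Longrightarrow> psd d (F x)"
  shows "psd (d ^ length xs) (tensor_states F xs)"
    and "mat_powr (tensor_states F xs) q = tensor_states (\<lambda>x. mat_powr (F x) q) xs"
    and "mtrace (tensor_states F xs) = prod_list (map (\<lambda>x. mtrace (F x)) xs)"
  using assms
proof (induction xs)
  case Nil
  {
    case 1 show ?case by simp
  next
    case 2 show ?case by (simp add: mat_powr_one_mat)
  next
    case 3 show ?case by (simp add: mtrace_def)
  }
next
  case (Cons x xs)
  {
    case 1
    thus ?case using kron_psd[OF 1(1)[of x] Cons.IH(1)] by simp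
  next
    case 2
    thus ?case using mat_powr_kron[OF 2(1)[of x] Cons.IH(1)] Cons.IH(2) by simp
  next
    case 3
    thus ?case using mtrace_kron[OF psd_carrier[OF 3(1)[of x]] psd_carrier[OF Cons.IH(1)]] Cons.IH(3) by simp
  }
qed

section \<open>Words, product distributions and averages of product matrices\<close>

definition words :: "nat \<Rightarrow> nat \<Rightarrow> nat list set" where
  "words k n = {xs. set xs \<subseteq> {..<k} \<and> length xs = n}"

definition word_prob :: "(nat \<Rightarrow> real) \<Rightarrow> nat list \<Rightarrow> real" where
  "word_prob p xs = prod_list (map p xs)"

lemma finite_words[simp]: "finite (words k n)"
  unfolding words_def by (rule finite_lists_length_eq) simp

lemma sum_words_Suc:
  fixes f :: "nat list \<Rightarrow> 'a :: comm_monoid_add"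
  shows "(\<Sum>xs\<in>words k (Suc n). f xs) = (\<Sum>x<k. \<Sum>xs\<in>words k n. f (x # xs))"
proof -
  have eq: "words k (Suc n) = (\<lambda>(x,xs). x # xs) ` ({..<k} \<times> words k n)"
    by (auto simp: words_def image_iff length_Suc_conv)
  have "(\<Sum>xs\<in>words k (Suc n). f xs) = (\<Sum>(x,xs)\<in>{..<k} \<times> words k n. f (x # xs))"
    unfolding eq by (subst sum.reindex) (auto simp: inj_on_def intro!: sum.cong)
  thus ?thesis by (simp add: sum.cartesian_product)
qed

lemma words_0: "words k 0 = {[]}"
  by (auto simp: words_def)

lemma word_prob_nonneg: "\<forall>x<k. 0 \<le> p x \<Longrightarrow> xs \<in> words k n \<Longrightarrow> 0 \<le> word_prob p xs"
proof -
  assume p: "\<forall>x<k. 0 \<le> p x"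
  have "set xs \<subseteq> {..<k} \<Longrightarrow> 0 \<le> word_prob p xs"
    by (induction xs) (use p in \<open>auto simp: word_prob_def\<close>)
  thus "xs \<in> words k n \<Longrightarrow> 0 \<le> word_prob p xs" by (simp add: words_def)
qed

lemma sum_word_prob: "(\<Sum>x<k. p x) = 1 \<Longrightarrow> (\<Sum>xs\<in>words k n. word_prob p xs) = 1"
proof (induction n)
  case 0 thus ?case by (simp add: words_0 word_prob_def)
next
  case (Suc n)
  have "(\<Sum>xs\<in>words k (Suc n). word_prob p xs) = (\<Sum>x<k. \<Sum>xs\<in>words k n. p x * word_prob p xs)"
    unfolding sum_words_Suc by (simp add: word_prob_def)
  also have "\<dots> = (\<Sum>x<k. p x) * (\<Sum>xs\<in>words k n. word_prob p xs)" by (simp add: sum_product)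
  finally show ?case using Suc by simp
qed

definition mean_tensor :: "nat \<Rightarrow> nat \<Rightarrow> (nat \<Rightarrow> real) \<Rightarrow> (nat \<Rightarrow> complex mat) \<Rightarrow> nat \<Rightarrow> complex mat" where
  "mean_tensor k d p F n =
    msum (d ^ n) (d ^ n) (\<lambda>xs. complex_of_real (word_prob p xs) \<cdot>\<^sub>m tensor_states F xs) (words k n)"

definition mean_mat :: "nat \<Rightarrow> nat \<Rightarrow> (nat \<Rightarrow> real) \<Rightarrow> (nat \<Rightarrow> complex mat) \<Rightarrow> complex mat" where
  "mean_mat k d p F = msum d d (\<lambda>x. complex_of_real (p x) \<cdot>\<^sub>m F x) {..<k}"

text \<open>Both the law of a word and the tensor product factor over letters, so each entry of the
  mean is a product of a sum over the first letter and a sum over the remaining word.\<close>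

lemma mean_tensor_Suc:
  assumes F: "\<And>x. x < k \<Longrightarrow> psd d (F x)"
  shows "mean_tensor k d p F (Suc n) = kron (mean_mat k d p F) (mean_tensor k d p F n)"
proof (rule eq_matI)
  let ?D = "d ^ n"
  fix i j assume "i < dim_row (kron (mean_mat k d p F) (mean_tensor k d p F n))"
    "j < dim_col (kron (mean_mat k d p F) (mean_tensor k d p F n))"
  hence ij: "i < d * ?D" "j < d * ?D" by (auto simp: mean_mat_def mean_tensor_def)
  note im = div_mod_less[OF ij(1)] and jm = div_mod_less[OF ij(2)]
  have T: "tensor_states F xs \<in> carrier_mat ?D ?D" if "xs \<in> words k n" for xs
    using tensor_states_psd(1)[of xs d F] F that by (auto simp: words_def dest!: psd_carrier)
  have e: "(complex_of_real (word_prob p (x # xs)) \<cdot>\<^sub>m tensor_states F (x # xs)) $$ (i,j)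
      = complex_of_real (p x) * F x $$ (i div ?D, j div ?D) * (complex_of_real (word_prob p xs) * tensor_states F xs $$ (i mod ?D, j mod ?D))"
    if "x < k" "xs \<in> words k n" for x xs
    using ij T[OF that(2)] psd_carrier[OF F[OF that(1)]]
    by (simp add: word_prob_def kron_index[of _ d d _ ?D ?D])
  have "mean_tensor k d p F (Suc n) $$ (i,j)
    = (\<Sum>x<k. \<Sum>xs\<in>words k n. (complex_of_real (word_prob p (x # xs)) \<cdot>\<^sub>m tensor_states F (x # xs)) $$ (i,j))"
    using ij by (simp add: mean_tensor_def msum_def sum_words_Suc del: tensor_states.simps)
  also have "\<dots> = (\<Sum>x<k. complex_of_real (p x) * F x $$ (i div ?D, j div ?D))
     * (\<Sum>xs\<in>words k n. complex_of_real (word_prob p xs) * tensor_states F xs $$ (i mod ?D, j mod ?D))"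
    unfolding sum_product by (intro sum.cong refl e) auto
  also have "(\<Sum>x<k. complex_of_real (p x) * F x $$ (i div ?D, j div ?D)) = mean_mat k d p F $$ (i div ?D, j div ?D)"
    using im jm carrier_matD[OF psd_carrier[OF F]] by (auto simp: mean_mat_def msum_def intro!: sum.cong)
  also have "(\<Sum>xs\<in>words k n. complex_of_real (word_prob p xs) * tensor_states F xs $$ (i mod ?D, j mod ?D))
     = mean_tensor k d p F n $$ (i mod ?D, j mod ?D)"
    using im jm carrier_matD[OF T] by (auto simp: mean_tensor_def msum_def intro!: sum.cong)
  also have "mean_mat k d p F $$ (i div ?D, j div ?D) * \<dots> = kron (mean_mat k d p F) (mean_tensor k d p F n) $$ (i,j)"
    using ij by (simp add: kron_index[of _ d d _ ?D ?D] mean_mat_def mean_tensor_def)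
  finally show "mean_tensor k d p F (Suc n) $$ (i,j) = kron (mean_mat k d p F) (mean_tensor k d p F n) $$ (i,j)" .
qed (auto simp: mean_tensor_def mean_mat_def)

lemma mean_mat_psd:
  "(\<And>x. x < k \<Longrightarrow> psd d (F x)) \<Longrightarrow> \<forall>x<k. 0 \<le> p x \<Longrightarrow> psd d (mean_mat k d p F)"
  unfolding mean_mat_def by (intro psd_msum psd_smult) auto

lemma tensor_states_words_psd:
  "(\<And>x. x < k \<Longrightarrow> psd d (F x)) \<Longrightarrow> xs \<in> words k n \<Longrightarrow> psd (d ^ n) (tensor_states F xs)"
  using tensor_states_psd(1)[of xs d F] by (auto simp: words_def subset_eq)

lemma mean_tensor_psd:
  "(\<And>x. x < k \<Longrightarrow> psd d (F x)) \<Longrightarrow> \<forall>x<k. 0 \<le> p x \<Longrightarrow> psd (d ^ n) (mean_tensor k d p F n)"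
  unfolding mean_tensor_def
  by (intro psd_msum psd_smult tensor_states_words_psd word_prob_nonneg) auto

text \<open>This is where n channel uses reduce to one: the mean is a Kronecker power, and both
  powers and traces respect Kronecker products.\<close>

lemma mtrace_mat_powr_mean_tensor:
  assumes F: "\<And>x. x < k \<Longrightarrow> psd d (F x)" and p: "\<forall>x<k. 0 \<le> p x"
  shows "mtrace (mat_powr (mean_tensor k d p F n) q) = mtrace (mat_powr (mean_mat k d p F) q) ^ n"
proof (induction n)
  case 0
  have "mean_tensor k d p F 0 = 1\<^sub>m 1"
    by (rule eq_matI) (auto simp: mean_tensor_def msum_def words_0 word_prob_def)
  thus ?case by (simp add: mat_powr_one_mat) (simp add: mtrace_def)
next
  case (Suc n)
  note P = mean_mat_psd[OF F p] mean_tensor_psd[OF F p, where n = n]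
  have "mtrace (mat_powr (mean_tensor k d p F (Suc n)) q)
      = mtrace (kron (mat_powr (mean_mat k d p F) q) (mat_powr (mean_tensor k d p F n) q))"
    by (simp add: mean_tensor_Suc[OF F] mat_powr_kron[OF P])
  also have "\<dots> = mtrace (mat_powr (mean_mat k d p F) q) * mtrace (mat_powr (mean_tensor k d p F n) q)"
    by (rule mtrace_kron[OF psd_carrier[OF mat_powr_psd[OF P(1)]] psd_carrier[OF mat_powr_psd[OF P(2)]]])
  finally show ?case using Suc by simp
qed

section \<open>Random coding\<close>

lemma mat_powr_smult:
  assumes A: "psd d A" and c: "0 \<le> c"
  shows "mat_powr (complex_of_real c \<cdot>\<^sub>m A) q = complex_of_real (c powr q) \<cdot>\<^sub>m mat_powr A q"
proof -
  have h: "hermitian d A" using A by simp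
  have e: "complex_of_real c \<cdot>\<^sub>m A = mat_fun (\<lambda>x. c * x) A"
    using mat_fun_cmult[OF h, of c "\<lambda>x. x"] by (simp add: mat_fun_id[OF h])
  have "mat_powr (complex_of_real c \<cdot>\<^sub>m A) q = mat_fun (\<lambda>x. (c * x) powr q) A"
    unfolding mat_powr_eq[OF psd_smult[OF A c]] unfolding e mat_fun_comp[OF h] ..
  also have "\<dots> = mat_fun (\<lambda>x. c powr q * x powr q) A"
    by (rule mat_fun_cong[OF A]) (use c in \<open>simp add: powr_mult\<close>)
  finally show ?thesis by (simp add: mat_fun_cmult[OF h] mat_powr_eq[OF A])
qed

text \<open>Marginals of a product distribution: with the factor 1 attached to every other
  coordinate, the sum over functions factorises and those coordinates sum to one.\<close>

lemma sum_PiE_marginal: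
  fixes w :: "'a \<Rightarrow> real" and h :: "'a \<Rightarrow> real"
  assumes "finite J" "finite L" "sum w L = 1" "j0 \<in> J"
  shows "(\<Sum>c\<in>PiE J (\<lambda>_. L). (\<Prod>j\<in>J. w (c j)) * h (c j0)) = (\<Sum>x\<in>L. w x * h x)"
proof -
  have "(\<Prod>j\<in>J. w (c j) * (if j = j0 then h (c j) else 1)) = (\<Prod>j\<in>J. w (c j)) * h (c j0)" for c
    using assms by (simp add: prod.distrib)
  hence "(\<Sum>c\<in>PiE J (\<lambda>_. L). (\<Prod>j\<in>J. w (c j)) * h (c j0))
      = (\<Sum>c\<in>PiE J (\<lambda>_. L). \<Prod>j\<in>J. w (c j) * (if j = j0 then h (c j) else 1))" by (simp only:)
  also have "\<dots> = (\<Prod>j\<in>J. \<Sum>x\<in>L. w x * (if j = j0 then h x else 1))"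
    using assms by (subst prod_sum_PiE) auto
  also have "\<dots> = (\<Prod>j\<in>J. if j = j0 then \<Sum>x\<in>L. w x * h x else 1)"
    using assms(3) by (intro prod.cong) auto
  finally show ?thesis using assms by simp
qed

lemma sum_PiE_prob:
  fixes w :: "'a \<Rightarrow> real"
  assumes "finite J" "finite L" "sum w L = 1"
  shows "(\<Sum>c\<in>PiE J (\<lambda>_. L). (\<Prod>j\<in>J. w (c j))) = 1"
  using assms by (subst prod_sum_PiE[symmetric]) auto

lemma sum_PiE_insert:
  fixes f :: "('b \<Rightarrow> 'a) \<Rightarrow> real"
  assumes "m \<notin> J"
  shows "(\<Sum>c\<in>PiE (insert m J) (\<lambda>_. L). f c) = (\<Sum>x\<in>L. \<Sum>c\<in>PiE J (\<lambda>_. L). f (c(m := x)))"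
proof -
  have "(\<Sum>c\<in>PiE (insert m J) (\<lambda>_. L). f c) = (\<Sum>(x,c)\<in>L \<times> PiE J (\<lambda>_. L). f (c(m := x)))"
    unfolding PiE_insert_eq by (subst sum.reindex) (auto intro!: inj_combinator assms sum.cong)
  thus ?thesis by (simp add: sum.cartesian_product)
qed

text \<open>Draw the codewords independently with law \<open>w\<close>. Codeword m is independent of
  the interference of the others, so for fixed codeword m operator concavity replaces the
  interference by its mean (M - 1) G. Averaging over codeword m then gives tr(G G^s), and some
  codebook is no worse than the average.\<close>

lemma random_codebook:
  fixes w :: "'a \<Rightarrow> real"
  assumes L: "finite L" and w: "\<And>x. x \<in> L \<Longrightarrow> 0 \<le> w x" and w1: "sum w L = 1"
    and T: "\<And>x. x \<in> L \<Longrightarrow> psd d (T x)" and G: "psd d G"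
    and G_eq: "\<And>P. P \<in> carrier_mat d d \<Longrightarrow> rtr P G = (\<Sum>x\<in>L. w x * rtr P (T x))"
    and M: "0 < M" and s: "0 < s" "s \<le> 1"
  obtains c where "\<And>m. m < M \<Longrightarrow> c m \<in> L"
    "(\<Sum>m<M. rtr (T (c m)) (mat_powr (msum d d (\<lambda>m'. T (c m')) ({..<M} - {m})) s))
      \<le> real M * (real (M - 1) powr s * rtr G (mat_powr G s))"
proof -
  define W where "W c = (\<Prod>m<M. w (c m))" for c
  define \<Phi> where "\<Phi> m c = rtr (T (c m)) (mat_powr (msum d d (\<lambda>m'. T (c m')) ({..<M} - {m})) s)" for m c
  let ?C = "PiE {..<M} (\<lambda>_. L)"
  let ?b = "real (M - 1) powr s * rtr G (mat_powr G s)"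
  have finC: "finite ?C" using L by (intro finite_PiE) auto
  have mean: "(\<Sum>c\<in>?C. W c * \<Phi> m c) \<le> ?b" if m: "m < M" for m
  proof -
    define J where "J = {..<M} - {m}"
    have J: "finite J" "m \<notin> J" "card J = M - 1" "{..<M} = insert m J" using m by (auto simp: J_def)
    let ?D = "PiE J (\<lambda>_. L)"
    define V where "V c = (\<Prod>j\<in>J. w (c j))" for c
    define S where "S c = msum d d (\<lambda>j. T (c j)) J" for c
    \<comment> \<open>The mean interference: M - 1 independent codewords, each of mean
      \<open>G\<close>.\<close>
    define Sb where "Sb = complex_of_real (real (M - 1)) \<cdot>\<^sub>m G"
    have W_eq: "W (c(m := x)) = w x * V c" for c x
    proof -
      have "W (c(m := x)) = w x * (\<Prod>j\<in>J. w ((c(m := x)) j))" unfolding W_def J(4) using J by simp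
      also have "(\<Prod>j\<in>J. w ((c(m := x)) j)) = V c"
        unfolding V_def using J(2) by (intro prod.cong) auto
      finally show ?thesis .
    qed
    have Phi_eq: "\<Phi> m (c(m := x)) = rtr (T x) (mat_powr (S c) s)" for c x
    proof -
      have "msum d d (\<lambda>m'. T ((c(m := x)) m')) J = S c"
        unfolding S_def using J(2) by (intro msum_cong) auto
      thus ?thesis by (simp add: \<Phi>_def flip: J_def)
    qed
    have S: "psd d (S c)" if "c \<in> ?D" for c
      unfolding S_def using that T by (intro psd_msum) (auto simp: PiE_def)
    moreover have "0 \<le> V c" if "c \<in> ?D" for c
      unfolding V_def using that w by (intro prod_nonneg) (auto simp: PiE_def)
    moreover have "sum V ?D = 1" unfolding V_def using J L w1 by (intro sum_PiE_prob)
    moreover have Sb: "psd d Sb" unfolding Sb_def using G by (intro psd_smult) auto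
    moreover have "rtr P Sb = (\<Sum>c\<in>?D. V c * rtr P (S c))" if P: "P \<in> carrier_mat d d" for P
    proof -
      have "(\<Sum>c\<in>?D. V c * rtr P (S c)) = (\<Sum>c\<in>?D. \<Sum>j\<in>J. V c * rtr P (T (c j)))"
      proof (rule sum.cong[OF refl])
        fix c assume c: "c \<in> ?D"
        have "rtr P (S c) = (\<Sum>j\<in>J. rtr P (T (c j)))"
          unfolding S_def using c T by (intro rtr_msum_right[OF P] psd_carrier T) (auto simp: PiE_def)
        thus "V c * rtr P (S c) = (\<Sum>j\<in>J. V c * rtr P (T (c j)))" by (simp add: sum_distrib_left)
      qed
      also have "\<dots> = (\<Sum>j\<in>J. \<Sum>c\<in>?D. V c * rtr P (T (c j)))" by (rule sum.swap)
      also have "\<dots> = (\<Sum>j\<in>J. rtr P G)"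
        unfolding V_def G_eq[OF P] using J L w1 by (intro sum.cong refl sum_PiE_marginal) auto
      finally show ?thesis unfolding Sb_def using P G J(3) by (simp add: rtr_smult_right[of _ d] del: of_real_of_nat_eq)
    qed
    ultimately have conc: "(\<Sum>c\<in>?D. V c * rtr P (mat_powr (S c) s)) \<le> rtr P (mat_powr Sb s)" if "psd d P" for P
      using mat_powr_concave[of ?D d S V Sb P s] that s by blast
    have Gs: "mat_powr G s \<in> carrier_mat d d" using mat_powr_psd[OF G, of s] by simp
    have "(\<Sum>c\<in>?C. W c * \<Phi> m c) = (\<Sum>x\<in>L. w x * (\<Sum>c\<in>?D. V c * rtr (T x) (mat_powr (S c) s)))"
      unfolding J(4) sum_PiE_insert[OF J(2)] W_eq Phi_eq by (simp add: sum_distrib_left mult.assoc)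
    also have "\<dots> \<le> (\<Sum>x\<in>L. w x * rtr (T x) (mat_powr Sb s))"
      using w T by (intro sum_mono mult_left_mono conc) auto
    also have "\<dots> = (\<Sum>x\<in>L. real (M - 1) powr s * (w x * rtr (mat_powr G s) (T x)))"
      unfolding Sb_def mat_powr_smult[OF G of_nat_0_le_iff] using T Gs
      by (intro sum.cong refl) (auto simp: rtr_smult_right[of _ d] rtr_comm[of "T _" d d])
    also have "\<dots> = ?b" using G_eq[OF Gs] Gs G by (simp add: rtr_comm[of G d d] flip: sum_distrib_left)
    finally show ?thesis .
  qed
  have W1: "sum W ?C = 1" unfolding W_def using L w1 by (intro sum_PiE_prob) auto
  have W0: "0 \<le> W c" if "c \<in> ?C" for c unfolding W_def using that w by (intro prod_nonneg) (auto simp: PiE_def)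
  \<comment> \<open>If every codebook exceeded the average, the weighted excesses would be
    nonnegative with sum at most zero. Then all weights vanish, although they sum to one.\<close>
  have "\<exists>c\<in>?C. (\<Sum>m<M. \<Phi> m c) \<le> real M * ?b"
  proof (rule ccontr)
    assume "\<not> ?thesis"
    hence gt: "real M * ?b < (\<Sum>m<M. \<Phi> m c)" if "c \<in> ?C" for c using that by force
    have "(\<Sum>c\<in>?C. W c * ((\<Sum>m<M. \<Phi> m c) - real M * ?b)) = (\<Sum>m<M. \<Sum>c\<in>?C. W c * \<Phi> m c) - real M * ?b"
      using W1 by (subst sum.swap) (simp add: right_diff_distrib sum_subtractf sum_distrib_left flip: sum_distrib_right)
    also have "\<dots> \<le> (\<Sum>m<M. ?b) - real M * ?b" using mean by (intro diff_right_mono sum_mono) auto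
    also have "(\<Sum>m<M. ?b) = real M * ?b" by (simp only: sum_constant card_lessThan)
    finally have le: "(\<Sum>c\<in>?C. W c * ((\<Sum>m<M. \<Phi> m c) - real M * ?b)) \<le> 0" by (simp only: diff_self)
    have nn: "0 \<le> W c * ((\<Sum>m<M. \<Phi> m c) - real M * ?b)" if "c \<in> ?C" for c
      using W0[OF that] gt[OF that] by simp
    have "(\<Sum>c\<in>?C. W c * ((\<Sum>m<M. \<Phi> m c) - real M * ?b)) = 0"
      by (rule antisym[OF le sum_nonneg[OF nn]])
    hence "W c = 0" if "c \<in> ?C" for c
      using sum_nonneg_eq_0_iff[OF finC nn] that gt[OF that] by auto
    thus False using W1 by simp
  qed
  then obtain c where c: "c \<in> ?C" "(\<Sum>m<M. \<Phi> m c) \<le> real M * ?b" by blast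
  thus ?thesis using that[of c] by (auto simp: \<Phi>_def PiE_def)
qed

lemma mtrace_hermitian: "hermitian d A \<Longrightarrow> mtrace A = complex_of_real (Re (mtrace A))"
proof -
  assume "hermitian d A"
  hence A: "A \<in> carrier_mat d d" "adj A = A" by (auto simp: hermitian_def)
  have "cnj (A $$ (i,i)) = A $$ (i,i)" if "i < d" for i
    using adj_index[of i A i] A that by simp
  hence "cnj (mtrace A) = mtrace A" using A by (simp add: mtrace_def)
  thus ?thesis by (simp add: complex_eq_iff)
qed

lemma code_error_bounds:
  assumes states: "\<forall>x<k. is_state d (\<rho> x)" and code: "is_code k d n M cw \<Lambda>" and M: "0 < M"
  shows "0 \<le> code_error \<rho> M cw \<Lambda>" and "code_error \<rho> M cw \<Lambda> \<le> 1"
    and "code_error \<rho> M cw \<Lambda> = (\<Sum>m<M. rtr (tensor_states \<rho> (cw m)) (1\<^sub>m (d ^ n)) - rtr (tensor_states \<rho> (cw m)) (\<Lambda> m)) / real M"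
proof -
  have r: "psd d (\<rho> x)" "mtrace (\<rho> x) = 1" if "x < k" for x using states that by (auto simp: is_state_def)
  have cw: "cw m \<in> words k n" if "m < M" for m using code that by (auto simp: is_code_def words_def)
  have T: "psd (d ^ n) (tensor_states \<rho> (cw m))" if "m < M" for m
    using tensor_states_words_psd[OF r(1) cw[OF that]] by simp
  have L: "is_povm (d ^ n) M \<Lambda>" using code by (simp add: is_code_def is_povm_def)
  have Lc: "\<Lambda> m \<in> carrier_mat (d ^ n) (d ^ n)" if "m < M" for m using L that by (auto simp: is_povm_def)
  have tr: "rtr (tensor_states \<rho> (cw m)) (1\<^sub>m (d ^ n)) = 1" if "m < M" for m
  proof -
    have "mtrace (tensor_states \<rho> (cw m)) = prod_list (map (\<lambda>x. mtrace (\<rho> x)) (cw m))"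
      using cw[OF that] r(1) by (intro tensor_states_psd(3)[of _ d]) (auto simp: words_def)
    also have "map (\<lambda>x. mtrace (\<rho> x)) (cw m) = map (\<lambda>_. 1) (cw m)"
      using cw[OF that] r(2) by (intro map_cong) (auto simp: words_def)
    also have "prod_list (map (\<lambda>_. 1 :: complex) xs) = 1" for xs :: "nat list" by (induction xs) auto
    finally show ?thesis using T[OF that] by (simp add: rtr_one_right)
  qed
  have "Re (mtrace (\<Lambda> m * tensor_states \<rho> (cw m))) = rtr (tensor_states \<rho> (cw m)) (\<Lambda> m)" if "m < M" for m
    using T[OF that] Lc[OF that] by (simp add: rtr_def mtrace_comm[of "\<Lambda> m" "d ^ n" "d ^ n"])
  thus eq: "code_error \<rho> M cw \<Lambda> = (\<Sum>m<M. rtr (tensor_states \<rho> (cw m)) (1\<^sub>m (d ^ n)) - rtr (tensor_states \<rho> (cw m)) (\<Lambda> m)) / real M"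
    using M tr by (simp add: code_error_def sum_subtractf field_simps)
  show "0 \<le> code_error \<rho> M cw \<Lambda>"
    unfolding eq using is_povm_rtr_le[OF L T] by (intro divide_nonneg_nonneg sum_nonneg) auto
  have "(\<Sum>m<M. rtr (tensor_states \<rho> (cw m)) (1\<^sub>m (d ^ n)) - rtr (tensor_states \<rho> (cw m)) (\<Lambda> m)) \<le> (\<Sum>m<M. 1)"
    using rtr_psd_nonneg[OF T] L tr by (intro sum_mono) (auto simp: is_povm_def)
  thus "code_error \<rho> M cw \<Lambda> \<le> 1" unfolding eq using M by simp
qed

text \<open>\<open>Z\<close> is the one-letter Gallager trace. The bounds 0 and 1 come with it
  because they need the same facts about the infimum, namely that codes exist and that their errors
  lie in [0,1].\<close>

theorem random_coding_bound:
  assumes states: "\<forall>x<k. is_state d (\<rho> x)" and p: "\<forall>x<k. 0 \<le> p x" "(\<Sum>x<k. p x) = 1"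
    and s: "0 < s" "s \<le> 1"
  defines "Z \<equiv> Re (mtrace (mat_powr (mean_mat k d p (\<lambda>x. mat_powr (\<rho> x) (1 / (1 + s)))) (1 + s)))"
  shows "0 \<le> Pe_opt k d \<rho> n r" and "Pe_opt k d \<rho> n r \<le> 1"
    and "Pe_opt k d \<rho> n r \<le> (1 + s) * (2 powr (real n * r)) powr s * Z ^ n"
proof -
  define M where "M = nat \<lceil>2 powr (real n * r)\<rceil>"
  have M: "0 < M" unfolding M_def by simp
  have "real M = real_of_int \<lceil>2 powr (real n * r)\<rceil>" unfolding M_def by simp
  \<comment> \<open>The number of messages is rounded up, but only the M - 1 competitors enter the
    bound, so rounding costs nothing.\<close>
  hence M1: "real (M - 1) \<le> 2 powr (real n * r)" using M by (simp add: of_nat_diff)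
  define N where "N = d ^ n"
  define F where "F x = mat_powr (\<rho> x) (1 / (1 + s))" for x
  have r: "psd d (\<rho> x)" if "x < k" for x using states that by (auto simp: is_state_def)
  have F: "psd d (F x)" if "x < k" for x using r[OF that] by (simp add: F_def)
  define G where "G = mean_tensor k d p F n"
  have G: "psd N G" unfolding G_def N_def by (rule mean_tensor_psd[OF F p(1)])
  have T: "psd N (tensor_states F xs)" if "xs \<in> words k n" for xs
    unfolding N_def using tensor_states_words_psd[OF F that] by simp
  have Tp: "mat_powr (tensor_states F xs) (1 + s) = tensor_states \<rho> xs" if "xs \<in> words k n" for xs
  proof -
    have sub: "x < k" if "x \<in> set xs" for x using that \<open>xs \<in> words k n\<close> by (auto simp: words_def)
    have "tensor_states F xs = mat_powr (tensor_states \<rho> xs) (1 / (1 + s))"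
      unfolding F_def using r sub by (intro tensor_states_psd(2)[symmetric]) auto
    moreover have "psd N (tensor_states \<rho> xs)"
      unfolding N_def using tensor_states_words_psd[OF r that] by simp
    ultimately show ?thesis using s by (simp add: mat_powr_powr[of N] mat_powr_one[of N])
  qed
  have G_eq: "rtr P G = (\<Sum>xs\<in>words k n. word_prob p xs * rtr P (tensor_states F xs))"
    if P: "P \<in> carrier_mat N N" for P
    unfolding G_def mean_tensor_def N_def[symmetric] using T P
    by (subst rtr_msum_right) (auto simp: rtr_smult_right[of _ N] intro!: sum.cong)
  have GZ: "rtr G (mat_powr G s) = Z ^ n"
  proof -
    have "rtr G (mat_powr G s) = Re (mtrace (mat_powr G (1 + s)))"
      using G mat_powr_psd[OF G, of "1 + s"] by (simp add: rtr_mat_powr_one[of N] rtr_one_right[of _ N])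
    also have "mtrace (mat_powr G (1 + s)) = mtrace (mat_powr (mean_mat k d p F) (1 + s)) ^ n"
      unfolding G_def by (rule mtrace_mat_powr_mean_tensor[OF F p(1)])
    also have "mtrace (mat_powr (mean_mat k d p F) (1 + s)) = complex_of_real Z"
      unfolding Z_def F_def[symmetric] using mat_powr_psd[OF mean_mat_psd[OF F p(1)]]
      by (intro mtrace_hermitian[of d]) auto
    finally show ?thesis by (simp flip: of_real_power)
  qed
  have Z0: "0 \<le> Z ^ n" using rtr_psd_nonneg[OF G mat_powr_psd[OF G, of s]] GZ by simp
  define E where "E = {code_error \<rho> M cw \<Lambda> | cw \<Lambda>. is_code k d n M cw \<Lambda>}"
  have Pe: "Pe_opt k d \<rho> n r = Inf E" unfolding Pe_opt_def Let_def E_def M_def ..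
  have E0: "0 \<le> e" if "e \<in> E" for e using that code_error_bounds(1)[OF states _ M] by (auto simp: E_def)
  have bdd: "bdd_below E" using E0 by (rule bdd_belowI)
  have w0: "0 \<le> word_prob p xs" if "xs \<in> words k n" for xs using word_prob_nonneg[OF p(1) that] .
  obtain c where c: "\<And>m. m < M \<Longrightarrow> c m \<in> words k n" and cb:
    "(\<Sum>m<M. rtr (tensor_states F (c m)) (mat_powr (msum N N (\<lambda>m'. tensor_states F (c m')) ({..<M} - {m})) s))
      \<le> real M * (real (M - 1) powr s * rtr G (mat_powr G s))"
    using random_codebook[OF finite_words w0 sum_word_prob[OF p(2)] T G G_eq M s] by blast
  \<comment> \<open>The duality gap \<open>\<eta>\<close> stays in the error of each single code and
    disappears only in the infimum over codes.\<close>
  have exE: "\<exists>e\<in>E. e \<le> (1 + s) * (2 powr (real n * r)) powr s * Z ^ n + \<eta>" if eta: "0 < \<eta>" for \<eta>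
  proof -
    obtain \<Lambda> where L: "is_povm N M \<Lambda>" and Lb:
      "(\<Sum>m<M. rtr (mat_powr (tensor_states F (c m)) (1 + s)) (1\<^sub>m N) - rtr (mat_powr (tensor_states F (c m)) (1 + s)) (\<Lambda> m))
      \<le> (1 + s) * (\<Sum>m<M. rtr (tensor_states F (c m)) (mat_powr (msum N N (\<lambda>m. tensor_states F (c m)) ({..<M} - {m})) s)) + \<eta>"
      using packing_povm[of M N "\<lambda>m. tensor_states F (c m)", OF T[OF c] M s eta] by blast
    have code: "is_code k d n M c \<Lambda>"
      using L c by (auto simp: is_code_def is_povm_def N_def words_def)
    have "code_error \<rho> M c \<Lambda> = (\<Sum>m<M. rtr (mat_powr (tensor_states F (c m)) (1 + s)) (1\<^sub>m N) - rtr (mat_powr (tensor_states F (c m)) (1 + s)) (\<Lambda> m)) / real M"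
      unfolding code_error_bounds(3)[OF states code M] N_def[symmetric] using Tp[OF c] by simp
    also have "\<dots> \<le> ((1 + s) * (real M * (real (M - 1) powr s * Z ^ n)) + \<eta>) / real M"
    proof (rule divide_right_mono)
      show "(\<Sum>m<M. rtr (mat_powr (tensor_states F (c m)) (1 + s)) (1\<^sub>m N) - rtr (mat_powr (tensor_states F (c m)) (1 + s)) (\<Lambda> m))
        \<le> (1 + s) * (real M * (real (M - 1) powr s * Z ^ n)) + \<eta>"
        using Lb mult_left_mono[OF cb[unfolded GZ], of "1 + s"] s(1) by linarith
    qed simp
    also have "\<dots> = (1 + s) * real (M - 1) powr s * Z ^ n + \<eta> / real M" using M by (simp add: field_simps)
    also have "\<dots> \<le> (1 + s) * (2 powr (real n * r)) powr s * Z ^ n + \<eta>"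
    proof (intro add_mono mult_right_mono mult_left_mono powr_mono2)
      show "\<eta> / real M \<le> \<eta>" using M eta by (simp add: divide_le_eq)
    qed (use s M1 Z0 in auto)
    finally show ?thesis using code by (auto simp: E_def)
  qed
  have ne: "E \<noteq> {}" using exE[of 1] by auto
  show "0 \<le> Pe_opt k d \<rho> n r" unfolding Pe using E0 by (intro cInf_greatest[OF ne])
  obtain e where "e \<in> E" using ne by blast
  hence "Inf E \<le> e" "e \<le> 1" using cInf_lower[OF _ bdd] code_error_bounds(2)[OF states _ M] by (auto simp: E_def)
  thus "Pe_opt k d \<rho> n r \<le> 1" unfolding Pe by simp
  show "Pe_opt k d \<rho> n r \<le> (1 + s) * (2 powr (real n * r)) powr s * Z ^ n"
  proof (rule field_le_epsilon)
    fix \<eta> :: real assume "0 < \<eta>"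
    from exE[OF this] obtain e where "e \<in> E" "e \<le> (1 + s) * (2 powr (real n * r)) powr s * Z ^ n + \<eta>" by blast
    thus "Pe_opt k d \<rho> n r \<le> (1 + s) * (2 powr (real n * r)) powr s * Z ^ n + \<eta>"
      unfolding Pe using cInf_lower[OF _ bdd, of e] by simp
  qed
qed

section \<open>Block-diagonal matrices and the Renyi information\<close>

text \<open>Index i stands for the pair (i div d, i mod d), the same convention as in
  \<open>kron\<close>, so classical-quantum matrices with the classical label in the first factor
  are of this form.\<close>

definition block_diag :: "nat \<Rightarrow> nat \<Rightarrow> (nat \<Rightarrow> complex mat) \<Rightarrow> complex mat" where
  "block_diag k d X = mat (k * d) (k * d)
     (\<lambda>(i,j). if i div d = j div d then X (i div d) $$ (i mod d, j mod d) else 0)"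

lemma block_diag_carrier[simp]: "block_diag k d X \<in> carrier_mat (k * d) (k * d)"
  by (simp add: block_diag_def)

lemma block_diag_dim[simp]: "dim_row (block_diag k d X) = k * d" "dim_col (block_diag k d X) = k * d"
  by (simp_all add: block_diag_def)

lemma block_diag_index:
  "i < k * d \<Longrightarrow> j < k * d \<Longrightarrow>
    block_diag k d X $$ (i,j) = (if i div d = j div d then X (i div d) $$ (i mod d, j mod d) else 0)"
  by (simp add: block_diag_def)

lemma block_diag_cong: "(\<And>x. x < k \<Longrightarrow> X x = Y x) \<Longrightarrow> block_diag k d X = block_diag k d Y"
  by (rule eq_matI) (auto simp: block_diag_index div_mod_less)

lemma block_diag_mult:
  assumes X: "\<And>x. x < k \<Longrightarrow> X x \<in> carrier_mat d d" and Y: "\<And>x. x < k \<Longrightarrow> Y x \<in> carrier_mat d d"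
  shows "block_diag k d X * block_diag k d Y = block_diag k d (\<lambda>x. X x * Y x)"
proof (rule eq_matI)
  fix i j assume "i < dim_row (block_diag k d (\<lambda>x. X x * Y x))" "j < dim_col (block_diag k d (\<lambda>x. X x * Y x))"
  hence ij: "i < k * d" "j < k * d" by auto
  note im = div_mod_less[OF ij(1)] and jm = div_mod_less[OF ij(2)]
  have "(block_diag k d X * block_diag k d Y) $$ (i,j)
    = (\<Sum>l<k*d. (if i div d = l div d then X (i div d) $$ (i mod d, l mod d) else 0) *
        (if l div d = j div d then Y (l div d) $$ (l mod d, j mod d) else 0))"
    using ij by (simp add: index_mult_sum block_diag_index del: index_mult_mat(1))
  also have "\<dots> = (\<Sum>a<k. \<Sum>b<d. (if i div d = a then X (i div d) $$ (i mod d, b) else 0) *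
        (if a = j div d then Y a $$ (b, j mod d) else 0))"
    by (rule sum_div_mod)
  also have "\<dots> = (\<Sum>a<k. if i div d = a then \<Sum>b<d. X a $$ (i mod d, b) *
        (if a = j div d then Y a $$ (b, j mod d) else 0) else 0)"
    by (intro sum.cong refl) auto
  also have "\<dots> = (\<Sum>b<d. X (i div d) $$ (i mod d, b) *
        (if i div d = j div d then Y (i div d) $$ (b, j mod d) else 0))"
    using im by simp
  also have "\<dots> = block_diag k d (\<lambda>x. X x * Y x) $$ (i,j)"
  proof (cases "i div d = j div d")
    case True
    thus ?thesis using carrier_matD[OF X[OF jm(1)]] carrier_matD[OF Y[OF jm(1)]] ij im jm
      by (simp add: index_mult_sum block_diag_index del: index_mult_mat(1))
  qed (use ij in \<open>simp add: block_diag_index\<close>)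
  finally show "(block_diag k d X * block_diag k d Y) $$ (i,j) = block_diag k d (\<lambda>x. X x * Y x) $$ (i,j)" .
qed auto

lemma adj_block_diag:
  assumes X: "\<And>x. x < k \<Longrightarrow> X x \<in> carrier_mat d d"
  shows "adj (block_diag k d X) = block_diag k d (\<lambda>x. adj (X x))"
proof (rule eq_matI)
  fix i j assume "i < dim_row (block_diag k d (\<lambda>x. adj (X x)))" "j < dim_col (block_diag k d (\<lambda>x. adj (X x)))"
  hence ij: "i < k * d" "j < k * d" by auto
  thus "adj (block_diag k d X) $$ (i,j) = block_diag k d (\<lambda>x. adj (X x)) $$ (i,j)"
    using div_mod_less[OF ij(1)] div_mod_less[OF ij(2)] carrier_matD[OF X[of "i div d"]]
    by (auto simp: block_diag_index)
qed auto

lemma block_diag_real: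
  "block_diag k d (\<lambda>x. diag_real d (l x)) = diag_real (k * d) (\<lambda>i. l (i div d) (i mod d))"
proof (rule eq_matI)
  fix i j assume "i < dim_row (diag_real (k * d) (\<lambda>i. l (i div d) (i mod d)))"
    "j < dim_col (diag_real (k * d) (\<lambda>i. l (i div d) (i mod d)))"
  hence ij: "i < k * d" "j < k * d" by auto
  thus "block_diag k d (\<lambda>x. diag_real d (l x)) $$ (i,j) = diag_real (k * d) (\<lambda>i. l (i div d) (i mod d)) $$ (i,j)"
    using div_mod_less[OF ij(1)] div_mod_less[OF ij(2)] div_mod_eq_iff[of i d j]
    by (auto simp: block_diag_index diag_real_def)
qed auto

lemma mtrace_block_diag:
  assumes X: "\<And>x. x < k \<Longrightarrow> X x \<in> carrier_mat d d"
  shows "mtrace (block_diag k d X) = (\<Sum>x<k. mtrace (X x))"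
proof -
  have "mtrace (block_diag k d X) = (\<Sum>i<k*d. X (i div d) $$ (i mod d, i mod d))"
    by (simp add: mtrace_def block_diag_index)
  also have "\<dots> = (\<Sum>x<k. \<Sum>a<d. X x $$ (a,a))" by (rule sum_div_mod)
  finally show ?thesis using carrier_matD[OF X] by (simp add: mtrace_def)
qed

lemma block_diag_psd_powr:
  assumes X: "\<And>x. x < k \<Longrightarrow> psd d (X x)"
  shows block_diag_psd: "psd (k * d) (block_diag k d X)"
    and mat_powr_block_diag: "mat_powr (block_diag k d X) q = block_diag k d (\<lambda>x. mat_powr (X x) q)"
proof -
  have "\<forall>x. \<exists>U l. x < k \<longrightarrow> unitary_mat d U \<and> X x = U * diag_real d l * adj U \<and>
      (\<forall>f. mat_fun f (X x) = U * diag_real d (f \<circ> l) * adj U) \<and> (\<forall>i. 0 \<le> l i)"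
    using psd_spectral[OF X] by metis
  then obtain U l where "\<forall>x. x < k \<longrightarrow> unitary_mat d (U x) \<and> X x = U x * diag_real d (l x) * adj (U x) \<and>
      (\<forall>f. mat_fun f (X x) = U x * diag_real d (f \<circ> l x) * adj (U x)) \<and> (\<forall>i. 0 \<le> l x i)"
    unfolding choice_iff by blast
  hence uU: "\<And>x. x < k \<Longrightarrow> unitary_mat d (U x)"
    and XU: "\<And>x. x < k \<Longrightarrow> X x = U x * diag_real d (l x) * adj (U x)"
    and fX: "\<And>x f. x < k \<Longrightarrow> mat_fun f (X x) = U x * diag_real d (f \<circ> l x) * adj (U x)"
    and l: "\<And>x i. x < k \<Longrightarrow> 0 \<le> l x i" by auto
  note U = unitary_matD[OF uU]
  define V where "V = block_diag k d U"
  have adjV: "adj V = block_diag k d (\<lambda>x. adj (U x))" unfolding V_def by (rule adj_block_diag[OF U(1)])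
  have uV: "unitary_mat (k * d) V"
  proof -
    have "adj V * V = block_diag k d (\<lambda>x. adj (U x) * U x)"
      unfolding adjV unfolding V_def by (rule block_diag_mult[OF U(2,1)])
    also have "\<dots> = block_diag k d (\<lambda>x. diag_real d (\<lambda>_. 1))"
      using U(3) by (intro block_diag_cong) (simp add: one_eq_diag_real)
    finally show ?thesis by (simp add: unitary_mat_def V_def block_diag_real one_eq_diag_real)
  qed
  have VD: "V * diag_real (k * d) (\<lambda>i. f (l (i div d) (i mod d))) * adj V
      = block_diag k d (\<lambda>x. U x * diag_real d (f \<circ> l x) * adj (U x))" for f
  proof -
    have "diag_real (k * d) (\<lambda>i. f (l (i div d) (i mod d))) = block_diag k d (\<lambda>x. diag_real d (f \<circ> l x))"
      unfolding block_diag_real by simp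
    thus ?thesis unfolding adjV unfolding V_def using U(1,2) by (simp add: block_diag_mult)
  qed
  have XV: "block_diag k d X = V * diag_real (k * d) (\<lambda>i. l (i div d) (i mod d)) * adj V"
    unfolding VD[of "\<lambda>x. x"] by (rule block_diag_cong) (simp add: XU comp_def)
  show P: "psd (k * d) (block_diag k d X)"
    unfolding XV using l by (intro psd_conj_diag_real[OF uV]) (auto simp: div_mod_less)
  have "mat_powr (block_diag k d X) q = V * diag_real (k * d) ((\<lambda>x. x powr q) \<circ> (\<lambda>i. l (i div d) (i mod d))) * adj V"
    unfolding mat_powr_eq[OF P] by (rule mat_fun_eq[OF uV XV])
  also have "\<dots> = block_diag k d (\<lambda>x. U x * diag_real d ((\<lambda>x. x powr q) \<circ> l x) * adj (U x))"
    using VD[of "\<lambda>x. x powr q"] by (simp add: comp_def)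
  also have "\<dots> = block_diag k d (\<lambda>x. mat_powr (X x) q)"
    by (rule block_diag_cong) (simp add: mat_powr_eq[OF X] fX)
  finally show "mat_powr (block_diag k d X) q = block_diag k d (\<lambda>x. mat_powr (X x) q)" .
qed

text \<open>The vector built with \<open>vec d\<close> is the segment of \<open>v\<close> carrying
  the label i div d; kernels of block-diagonal matrices can thus be compared block by block.\<close>

lemma block_diag_mult_vec:
  assumes X: "\<And>x. x < k \<Longrightarrow> X x \<in> carrier_mat d d" and v: "v \<in> carrier_vec (k * d)" and i: "i < k * d"
  shows "(block_diag k d X *\<^sub>v v) $ i = (X (i div d) *\<^sub>v vec d (\<lambda>a. v $ (i div d * d + a))) $ (i mod d)"
proof -
  note im = div_mod_less[OF i]
  have "(block_diag k d X *\<^sub>v v) $ i = (\<Sum>j<k*d. block_diag k d X $$ (i,j) * v $ j)"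
    using v i by (auto simp: scalar_prod_def lessThan_atLeast0)
  also have "\<dots> = (\<Sum>j<k*d. (if i div d = j div d then X (i div d) $$ (i mod d, j mod d) else 0) * v $ (j div d * d + j mod d))"
    using i by (simp add: block_diag_index)
  also have "\<dots> = (\<Sum>a<k. \<Sum>b<d. (if i div d = a then X (i div d) $$ (i mod d, b) else 0) * v $ (a * d + b))"
    by (rule sum_div_mod)
  also have "\<dots> = (\<Sum>a<k. if i div d = a then \<Sum>b<d. X a $$ (i mod d, b) * v $ (a * d + b) else 0)"
    by (intro sum.cong refl) auto
  also have "\<dots> = (\<Sum>b<d. X (i div d) $$ (i mod d, b) * v $ (i div d * d + b))" using im by simp
  also have "\<dots> = (X (i div d) *\<^sub>v vec d (\<lambda>a. v $ (i div d * d + a))) $ (i mod d)"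
    using carrier_matD[OF X[OF im(1)]] im by (auto simp: scalar_prod_def lessThan_atLeast0)
  finally show ?thesis .
qed

lemma smult_smult_mat: "a \<cdot>\<^sub>m (b \<cdot>\<^sub>m A) = (a * b :: complex) \<cdot>\<^sub>m A"
  by (rule eq_matI) (auto simp: mult.assoc)

lemma smult_mat_mult_vec:
  fixes c :: complex
  assumes "A \<in> carrier_mat n m" "v \<in> carrier_vec m"
  shows "(c \<cdot>\<^sub>m A) *\<^sub>v v = c \<cdot>\<^sub>v (A *\<^sub>v v)"
  by (rule eq_vecI) (use assms in \<open>auto simp: scalar_prod_def sum_distrib_left mult.assoc intro!: sum.cong\<close>)

lemma rho_XB_eq:
  assumes \<rho>: "\<And>x. x < k \<Longrightarrow> \<rho> x \<in> carrier_mat d d"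
  shows "rho_XB k d \<rho> p = block_diag k d (\<lambda>x. complex_of_real (p x) \<cdot>\<^sub>m \<rho> x)"
proof (rule eq_matI)
  fix i j assume "i < dim_row (block_diag k d (\<lambda>x. complex_of_real (p x) \<cdot>\<^sub>m \<rho> x))"
    "j < dim_col (block_diag k d (\<lambda>x. complex_of_real (p x) \<cdot>\<^sub>m \<rho> x))"
  hence ij: "i < k * d" "j < k * d" by auto
  note im = div_mod_less[OF ij(1)] and jm = div_mod_less[OF ij(2)]
  have e: "(complex_of_real (p x) \<cdot>\<^sub>m kron (ket_proj k x) (\<rho> x)) $$ (i,j) = (if i div d = x then
      (if j div d = i div d then complex_of_real (p x) * \<rho> x $$ (i mod d, j mod d) else 0) else 0)" if "x < k" for x
    using ij im jm carrier_matD[OF \<rho>[OF that]] by (auto simp: kron_def ket_proj_def)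
  have "rho_XB k d \<rho> p $$ (i,j) = (\<Sum>x<k. if i div d = x then
      (if j div d = i div d then complex_of_real (p x) * \<rho> x $$ (i mod d, j mod d) else 0) else 0)"
    unfolding rho_XB_def msum_def using ij by (simp only: index_mat split) (intro sum.cong refl e, simp)
  also have "\<dots> = block_diag k d (\<lambda>x. complex_of_real (p x) \<cdot>\<^sub>m \<rho> x) $$ (i,j)"
    using ij im jm carrier_matD[OF \<rho>[OF im(1)]] carrier_matD[OF \<rho>[OF jm(1)]] by (simp add: block_diag_index)
  finally show "rho_XB k d \<rho> p $$ (i,j) = block_diag k d (\<lambda>x. complex_of_real (p x) \<cdot>\<^sub>m \<rho> x) $$ (i,j)" .
qed (auto simp: rho_XB_def)

lemma kron_rho_X_eq:
  assumes \<sigma>: "\<sigma> \<in> carrier_mat d d"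
  shows "kron (rho_X k p) \<sigma> = block_diag k d (\<lambda>x. complex_of_real (p x) \<cdot>\<^sub>m \<sigma>)"
proof (rule eq_matI)
  fix i j assume "i < dim_row (block_diag k d (\<lambda>x. complex_of_real (p x) \<cdot>\<^sub>m \<sigma>))"
    "j < dim_col (block_diag k d (\<lambda>x. complex_of_real (p x) \<cdot>\<^sub>m \<sigma>))"
  hence ij: "i < k * d" "j < k * d" by auto
  note im = div_mod_less[OF ij(1)] and jm = div_mod_less[OF ij(2)]
  have e: "(complex_of_real (p x) \<cdot>\<^sub>m ket_proj k x) $$ (i div d, j div d) = (if i div d = x then
      (if j div d = i div d then complex_of_real (p x) else 0) else 0)" for x
    using im jm by (auto simp: ket_proj_def)
  have "rho_X k p $$ (i div d, j div d) = (\<Sum>x<k. if i div d = x then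
      (if j div d = i div d then complex_of_real (p x) else 0) else 0)"
    unfolding rho_X_def msum_def using im jm by (simp add: e del: index_smult_mat(1))
  also have "\<dots> = (if j div d = i div d then complex_of_real (p (i div d)) else 0)" using im by simp
  finally show "kron (rho_X k p) \<sigma> $$ (i,j) = block_diag k d (\<lambda>x. complex_of_real (p x) \<cdot>\<^sub>m \<sigma>) $$ (i,j)"
    using ij im jm \<sigma> by (simp add: kron_index[of _ k k _ d d] rho_X_def block_diag_index)
qed (use \<sigma> in \<open>auto simp: rho_X_def\<close>)

text \<open>Needed so that the infimum in \<open>I_alpha\<close> is over a set bounded below. With
  the overlap weights, the scalar bound a^\<alpha> b^(1-\<alpha>) \<le> \<alpha> a + (1-\<alpha>) b
  sums to \<alpha> tr A + (1-\<alpha>) tr B = 1.\<close>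

lemma petz_D_nonneg:
  assumes A: "is_state n A" and B: "is_state n B" and \<alpha>: "0 < \<alpha>" "\<alpha> < 1"
  shows "0 \<le> petz_D \<alpha> A B"
proof -
  have pA: "psd n A" and pB: "psd n B" using A B by (auto simp: is_state_def)
  obtain w a b where w: "\<And>f g. rtr (mat_fun f A) (mat_fun g B) = (\<Sum>i<n. \<Sum>j<n. w i j * (f (a i) * g (b j)))"
    and pos: "\<And>i. 0 \<le> a i" "\<And>j. 0 \<le> b j" "\<And>i j. 0 \<le> w i j"
    using rtr_mat_fun_mat_fun[OF pA pB] by blast
  have tA: "(\<Sum>i<n. \<Sum>j<n. w i j * a i) = 1"
    using w[of "\<lambda>x. x" "\<lambda>_. 1"] A pA pB by (simp add: mat_fun_id[of n] mat_fun_one[of n] rtr_one_right[of _ n] is_state_def)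
  have "rtr (1\<^sub>m n) B = rtr B (1\<^sub>m n)" using pB by (intro rtr_comm[of _ n n]) auto
  hence tB: "(\<Sum>i<n. \<Sum>j<n. w i j * b j) = 1"
    using w[of "\<lambda>_. 1" "\<lambda>x. x"] B pA pB by (simp add: mat_fun_id[of n] mat_fun_one[of n] rtr_one_right[of _ n] is_state_def)
  define t where "t = rtr (mat_powr A \<alpha>) (mat_powr B (1 - \<alpha>))"
  have "t = (\<Sum>i<n. \<Sum>j<n. w i j * (a i powr \<alpha> * b j powr (1 - \<alpha>)))"
    unfolding t_def mat_powr_eq[OF pA] mat_powr_eq[OF pB] by (rule w)
  also have "\<dots> \<le> (\<Sum>i<n. \<Sum>j<n. w i j * (\<alpha> * a i + (1 - \<alpha>) * b j))"
  proof (intro sum_mono mult_left_mono pos)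
    fix i j
    show "a i powr \<alpha> * b j powr (1 - \<alpha>) \<le> \<alpha> * a i + (1 - \<alpha>) * b j"
    proof (cases "a i = 0 \<or> b j = 0")
      case True thus ?thesis using pos \<alpha> by auto
    next
      case False thus ?thesis using pos \<alpha> by (intro Youngs_inequality_0) (auto simp: less_le)
    qed
  qed
  also have "\<dots> = \<alpha> * (\<Sum>i<n. \<Sum>j<n. w i j * a i) + (1 - \<alpha>) * (\<Sum>i<n. \<Sum>j<n. w i j * b j)"
    unfolding sum_distrib_left sum.distrib[symmetric] by (intro sum.cong refl) (simp add: algebra_simps)
  finally have "t \<le> 1" using tA tB by simp
  moreover have "0 \<le> t" unfolding t_def using pA pB by (intro rtr_psd_nonneg[of n]) auto
  \<comment> \<open>For orthogonal states t = 0, where the divergence is infinite on paper; the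
    convention \<open>ln 0 = 0\<close> gives the value 0, which is still nonnegative.\<close>
  ultimately have "log 2 t \<le> 0" by (cases "t = 0") (auto simp: log_def divide_nonpos_pos)
  thus ?thesis using \<alpha> unfolding petz_D_def t_def rtr_def by (auto intro: divide_nonpos_neg)
qed

text \<open>A power has the same support as the matrix: with nonnegative weights both traces vanish
  exactly when every term with a nonzero eigenvalue has weight zero.\<close>

lemma rtr_mat_powr_eq_0_iff:
  assumes A: "psd d A" and P: "psd d P"
  shows "rtr P (mat_powr A q) = 0 \<longleftrightarrow> rtr P A = 0"
proof -
  obtain w l where w: "\<And>f. rtr P (mat_fun f A) = (\<Sum>i<d. w i * f (l i))" and l: "\<And>i. 0 \<le> l i"
    and w0: "\<And>i. i < d \<Longrightarrow> 0 \<le> w i"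
    using rtr_mat_fun[OF A psd_carrier[OF P]] P by metis
  have "rtr P (mat_powr A q) = 0 \<longleftrightarrow> (\<forall>i<d. w i * l i powr q = 0)"
    unfolding mat_powr_eq[OF A] w using w0 l by (subst sum_nonneg_eq_0_iff) auto
  also have "\<dots> \<longleftrightarrow> (\<forall>i<d. w i * l i = 0)" by auto
  also have "\<dots> \<longleftrightarrow> (\<Sum>i<d. w i * l i) = 0" using w0 l by (subst sum_nonneg_eq_0_iff) auto
  also have "(\<Sum>i<d. w i * l i) = rtr P A"
    using w[of "\<lambda>x. x"] mat_fun_id[OF psd_hermitian[OF A]] by simp
  finally show ?thesis .
qed

theorem I_alpha_le:
  assumes states: "\<forall>x<k. is_state d (\<rho> x)" and p: "\<forall>x<k. 0 \<le> p x" "(\<Sum>x<k. p x) = 1"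
    and \<alpha>: "0 < \<alpha>" "\<alpha> < 1"
  defines "Z \<equiv> Re (mtrace (mat_powr (mean_mat k d p (\<lambda>x. mat_powr (\<rho> x) \<alpha>)) (1 / \<alpha>)))"
  shows "0 < Z" and "I_alpha k d \<rho> \<alpha> p \<le> \<alpha> / (\<alpha> - 1) * log 2 Z"
proof -
  define F where "F x = mat_powr (\<rho> x) \<alpha>" for x
  define G where "G = mean_mat k d p F"
  have r: "psd d (\<rho> x)" and r1: "mtrace (\<rho> x) = 1" if "x < k" for x using states that by (auto simp: is_state_def)
  have F: "psd d (F x)" if "x < k" for x using r[OF that] by (simp add: F_def)
  have Fc: "F x \<in> carrier_mat d d" if "x < k" for x using F[OF that] by simp
  have rc: "\<rho> x \<in> carrier_mat d d" if "x < k" for x using r[OF that] by simp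
  have G: "psd d G" unfolding G_def by (rule mean_mat_psd[OF F p(1)])
  define H where "H = mat_powr G (1 / \<alpha>)"
  have H: "psd d H" unfolding H_def using G by simp
  have Gr: "rtr P G = (\<Sum>x<k. p x * rtr P (F x))" if "P \<in> carrier_mat d d" for P
    unfolding G_def mean_mat_def using that Fc by (subst rtr_msum_right) (auto simp: rtr_smult_right[of _ d])
  \<comment> \<open>A positive test matrix that annihilates G^(1/\<alpha>) annihilates
    \<open>G\<close>, hence every F_x of positive probability, hence \<rho>_x. With the identity as
    test this excludes Z = 0; with rank-one tests it gives the support condition.\<close>
  have GF: "p x * rtr P (\<rho> x) = 0" if "rtr P H = 0" "psd d P" "x < k" for P x
  proof -
    have "rtr P G = 0" using that G by (simp add: H_def rtr_mat_powr_eq_0_iff[of d])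
    hence "(\<Sum>x<k. p x * rtr P (F x)) = 0" using Gr that(2) by simp
    hence "p x * rtr P (F x) = 0"
      using p(1) F rtr_psd_nonneg[OF that(2)] that(3) by (subst (asm) sum_nonneg_eq_0_iff) auto
    thus ?thesis using rtr_mat_powr_eq_0_iff[OF r[OF that(3)] that(2), of \<alpha>] by (auto simp: F_def)
  qed
  have "Z = Re (mtrace H)" unfolding Z_def H_def G_def F_def[symmetric] ..
  hence ZH: "Z = rtr (1\<^sub>m d) H" using left_mult_one_mat[OF psd_carrier[OF H]] by (simp add: rtr_def)
  have "0 \<le> Z" unfolding ZH by (rule rtr_psd_nonneg[OF psd_one H])
  moreover have "Z \<noteq> 0"
  proof
    assume "Z = 0"
    hence "p x * rtr (1\<^sub>m d) (\<rho> x) = 0" if "x < k" for x using GF[OF _ psd_one that] by (simp add: ZH)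
    hence "p x = 0" if "x < k" for x using that r1 rc by (force simp: rtr_def)
    thus False using p(2) by simp
  qed
  ultimately show Z: "0 < Z" by simp
  define \<sigma> where "\<sigma> = complex_of_real (1 / Z) \<cdot>\<^sub>m H"
  have s: "psd d \<sigma>" unfolding \<sigma>_def using Z by (intro psd_smult[OF H]) simp
  have sc: "\<sigma> \<in> carrier_mat d d" using s by simp
  have "mtrace H = complex_of_real Z"
    using mtrace_hermitian[OF psd_hermitian[OF H]] left_mult_one_mat[OF psd_carrier[OF H]] by (simp add: ZH rtr_def)
  hence st: "is_state d \<sigma>" using s Z H by (simp add: is_state_def \<sigma>_def mtrace_smult[of _ d])
  define R where "R = rho_XB k d \<rho> p"
  have R: "R = block_diag k d (\<lambda>x. complex_of_real (p x) \<cdot>\<^sub>m \<rho> x)" unfolding R_def by (rule rho_XB_eq[OF rc])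
  have K: "kron (rho_X k p) \<tau> = block_diag k d (\<lambda>x. complex_of_real (p x) \<cdot>\<^sub>m \<tau>)"
    if "is_state d \<tau>" for \<tau> using that by (intro kron_rho_X_eq) (simp add: is_state_def)
  have state: "is_state (k * d) (block_diag k d (\<lambda>x. complex_of_real (p x) \<cdot>\<^sub>m \<tau> x))"
    if "\<And>x. x < k \<Longrightarrow> is_state d (\<tau> x)" for \<tau>
  proof -
    have t: "psd d (\<tau> x)" "mtrace (\<tau> x) = 1" if "x < k" for x using \<open>\<And>x. x < k \<Longrightarrow> is_state d (\<tau> x)\<close>[OF that] by (auto simp: is_state_def)
    have "psd (k * d) (block_diag k d (\<lambda>x. complex_of_real (p x) \<cdot>\<^sub>m \<tau> x))"
      using t p(1) by (intro block_diag_psd psd_smult) auto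
    moreover have "mtrace (block_diag k d (\<lambda>x. complex_of_real (p x) \<cdot>\<^sub>m \<tau> x)) = (\<Sum>x<k. mtrace (complex_of_real (p x) \<cdot>\<^sub>m \<tau> x))"
      using t by (intro mtrace_block_diag) auto
    moreover have "\<dots> = (\<Sum>x<k. complex_of_real (p x))"
      using t psd_carrier[OF t(1)] by (intro sum.cong refl) (auto simp: mtrace_smult[of _ d])
    moreover have "\<dots> = 1" using p(2) by (simp flip: of_real_sum)
    ultimately show ?thesis by (simp add: is_state_def)
  qed
  have supp: "supp_le (k * d) R (kron (rho_X k p) \<sigma>)"
    unfolding supp_le_def
  proof (intro ballI impI)
    fix v :: "complex vec" assume v: "v \<in> carrier_vec (k * d)" and z: "kron (rho_X k p) \<sigma> *\<^sub>v v = 0\<^sub>v (k * d)"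
    define u where "u x = vec d (\<lambda>a. v $ (x * d + a))" for x
    have u: "u x \<in> carrier_vec d" for x by (simp add: u_def)
    have ker: "complex_of_real (p x) \<cdot>\<^sub>m \<rho> x *\<^sub>v u x = 0\<^sub>v d" if x: "x < k" for x
    proof (cases "p x = 0")
      case True
      thus ?thesis using rc[OF x] u[of x] by (intro eq_vecI) (auto simp: scalar_prod_def)
    next
      case False
      have "complex_of_real (p x) \<cdot>\<^sub>m \<sigma> *\<^sub>v u x = 0\<^sub>v d"
      proof (rule eq_vecI)
        fix a assume "a < dim_vec (0\<^sub>v d :: complex vec)"
        hence a: "a < d" by simp
        have i: "x * d + a < k * d"
        proof -
          have "x * d + a < (x + 1) * d" using a by simp
          also have "\<dots> \<le> k * d" using x by (intro mult_right_mono) auto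
          finally show ?thesis .
        qed
        have "(kron (rho_X k p) \<sigma> *\<^sub>v v) $ (x * d + a) = (complex_of_real (p x) \<cdot>\<^sub>m \<sigma> *\<^sub>v u x) $ a"
          unfolding K[OF st] using block_diag_mult_vec[OF _ v i, of "\<lambda>x. complex_of_real (p x) \<cdot>\<^sub>m \<sigma>"] sc a
          by (simp add: u_def)
        thus "(complex_of_real (p x) \<cdot>\<^sub>m \<sigma> *\<^sub>v u x) $ a = 0\<^sub>v d $ a" using z i a by simp
      qed (use sc in auto)
      \<comment> \<open>The kernel condition for \<sigma> is moved to the unnormalised
        \<open>H\<close>, so that the quadratic form at \<open>u x\<close> becomes a test to which
        \<open>GF\<close> applies.\<close>
      hence "complex_of_real (p x / Z) \<cdot>\<^sub>m H *\<^sub>v u x = 0\<^sub>v d"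
        by (simp add: \<sigma>_def smult_smult_mat)
      obtain P where P: "psd d P" and Pq: "\<And>A. A \<in> carrier_mat d d \<Longrightarrow> Re (conjugate (u x) \<bullet> (A *\<^sub>v u x)) = rtr P A"
        using quadratic_form_rtr[OF u[of x]] by blast
      have "rtr P (complex_of_real (p x / Z) \<cdot>\<^sub>m H) = 0"
        using Pq[of "complex_of_real (p x / Z) \<cdot>\<^sub>m H"] H \<open>complex_of_real (p x / Z) \<cdot>\<^sub>m H *\<^sub>v u x = 0\<^sub>v d\<close> u[of x] by simp
      hence "rtr P H = 0" using rtr_smult_right[OF psd_carrier[OF P] psd_carrier[OF H], of "p x / Z"] False Z by auto
      hence "rtr P (\<rho> x) = 0" using GF[OF _ P x] False by simp
      hence "\<rho> x *\<^sub>v u x = 0\<^sub>v d" using Pq[OF rc[OF x]] by (intro psd_mult_vec_eq_0[OF r[OF x] u]) simp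
      thus ?thesis using smult_mat_mult_vec[OF rc[OF x] u[of x], of "complex_of_real (p x)"]
        by (auto intro!: eq_vecI)
    qed
    show "R *\<^sub>v v = 0\<^sub>v (k * d)"
    proof (rule eq_vecI)
      fix i assume "i < dim_vec (0\<^sub>v (k * d) :: complex vec)"
      hence i: "i < k * d" by simp
      show "(R *\<^sub>v v) $ i = 0\<^sub>v (k * d) $ i"
        unfolding R using block_diag_mult_vec[OF _ v i, of "\<lambda>x. complex_of_real (p x) \<cdot>\<^sub>m \<rho> x"] rc
          ker[OF div_mod_less(1)[OF i]] div_mod_less[OF i] i by (simp add: u_def)
    qed (simp add: R)
  qed
  \<comment> \<open>Blockwise the powers of p_x recombine to p_x, so the sum over x becomes
    \<open>G\<close>. The trace is then Z^(\<alpha>-1) tr(G G^((1-\<alpha>)/\<alpha>)) =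
    Z^(\<alpha>-1) Z = Z^\<alpha>.\<close>
  have D: "petz_D \<alpha> R (kron (rho_X k p) \<sigma>) = \<alpha> / (\<alpha> - 1) * log 2 Z"
  proof -
    have 1: "mat_powr R \<alpha> = block_diag k d (\<lambda>x. complex_of_real (p x powr \<alpha>) \<cdot>\<^sub>m F x)"
      unfolding R using r p(1) by (subst mat_powr_block_diag)
        (auto intro!: psd_smult block_diag_cong simp: mat_powr_smult[of d] F_def)
    have 2: "mat_powr (kron (rho_X k p) \<sigma>) (1 - \<alpha>) = block_diag k d (\<lambda>x. complex_of_real (p x powr (1 - \<alpha>)) \<cdot>\<^sub>m mat_powr \<sigma> (1 - \<alpha>))"
      unfolding K[OF st] using s p(1) by (subst mat_powr_block_diag)
        (auto intro!: psd_smult block_diag_cong simp: mat_powr_smult[of d])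
    have ss: "mat_powr \<sigma> (1 - \<alpha>) = complex_of_real ((1 / Z) powr (1 - \<alpha>)) \<cdot>\<^sub>m mat_powr G ((1 - \<alpha>) / \<alpha>)"
      unfolding \<sigma>_def using mat_powr_smult[OF H, of "1 / Z" "1 - \<alpha>"] Z G by (simp add: H_def mat_powr_powr[of d])
    have sc': "mat_powr \<sigma> (1 - \<alpha>) \<in> carrier_mat d d" using mat_powr_psd[OF s] by simp
    have "rtr (mat_powr R \<alpha>) (mat_powr (kron (rho_X k p) \<sigma>) (1 - \<alpha>))
      = Re (\<Sum>x<k. mtrace (complex_of_real (p x powr \<alpha>) \<cdot>\<^sub>m F x * (complex_of_real (p x powr (1 - \<alpha>)) \<cdot>\<^sub>m mat_powr \<sigma> (1 - \<alpha>))))"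
      unfolding rtr_def 1 2 using Fc sc' by (subst block_diag_mult) (auto simp: mtrace_block_diag)
    also have "\<dots> = (\<Sum>x<k. p x * rtr (mat_powr \<sigma> (1 - \<alpha>)) (F x))"
      unfolding Re_sum
    proof (rule sum.cong[OF refl])
      fix x assume "x \<in> {..<k}"
      hence x: "x < k" by simp
      have "complex_of_real (p x powr \<alpha>) \<cdot>\<^sub>m F x * (complex_of_real (p x powr (1 - \<alpha>)) \<cdot>\<^sub>m mat_powr \<sigma> (1 - \<alpha>))
        = complex_of_real (p x powr \<alpha> * p x powr (1 - \<alpha>)) \<cdot>\<^sub>m (F x * mat_powr \<sigma> (1 - \<alpha>))"
        using Fc[OF x] sc' by (simp add: mult_smult_assoc_mat[of _ d d _ d] mult_smult_distrib[of _ d d _ d] smult_smult_mat mult.commute)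
      \<comment> \<open>True also for p_x = 0, by the convention for \<open>powr\<close> at
        zero.\<close>
      also have "p x powr \<alpha> * p x powr (1 - \<alpha>) = p x" using p(1) x by (cases "p x = 0") (auto simp flip: powr_add)
      finally show "Re (mtrace (complex_of_real (p x powr \<alpha>) \<cdot>\<^sub>m F x * (complex_of_real (p x powr (1 - \<alpha>)) \<cdot>\<^sub>m mat_powr \<sigma> (1 - \<alpha>))))
        = p x * rtr (mat_powr \<sigma> (1 - \<alpha>)) (F x)"
        using Fc[OF x] sc' by (simp add: mtrace_smult[of _ d] rtr_def mtrace_comm[of "F x" d d])
    qed
    also have "\<dots> = rtr (mat_powr \<sigma> (1 - \<alpha>)) G" using Gr[OF sc'] by simp
    also have "\<dots> = rtr G (mat_powr \<sigma> (1 - \<alpha>))" using G sc' by (intro rtr_comm[of _ d d]) auto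
    also have "\<dots> = (1 / Z) powr (1 - \<alpha>) * rtr G (mat_powr G ((1 - \<alpha>) / \<alpha>))"
      unfolding ss using G mat_powr_psd[OF G] by (subst rtr_smult_right[of _ d]) auto
    also have "rtr G (mat_powr G ((1 - \<alpha>) / \<alpha>)) = Z"
    proof -
      have "1 + (1 - \<alpha>) / \<alpha> = 1 / \<alpha>" using \<alpha> by (simp add: field_simps)
      thus ?thesis using rtr_mat_powr_one[OF G, of "(1 - \<alpha>) / \<alpha>"] H
        by (simp add: ZH rtr_comm[of "1\<^sub>m d" d d] flip: H_def)
    qed
    also have "(1 / Z) powr (1 - \<alpha>) * Z = Z powr \<alpha>"
      using Z by (simp add: powr_divide powr_diff)
    finally show ?thesis using \<alpha> Z unfolding petz_D_def rtr_def[symmetric] by (simp add: log_powr)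
  qed
  let ?S = "{petz_D \<alpha> R (kron (rho_X k p) \<tau>) | \<tau>. is_state d \<tau> \<and> supp_le (k*d) R (kron (rho_X k p) \<tau>)}"
  have "bdd_below ?S"
  proof (rule bdd_belowI[of _ 0])
    fix y assume "y \<in> ?S"
    then obtain \<tau> where t: "is_state d \<tau>" and y: "y = petz_D \<alpha> R (kron (rho_X k p) \<tau>)" by blast
    have "is_state (k * d) R" unfolding R using states by (intro state) auto
    moreover have "is_state (k * d) (kron (rho_X k p) \<tau>)" unfolding K[OF t] using t by (intro state)
    ultimately show "0 \<le> y" unfolding y using \<alpha> by (rule petz_D_nonneg)
  qed
  moreover have "\<alpha> / (\<alpha> - 1) * log 2 Z \<in> ?S" using D st supp by force
  ultimately show "I_alpha k d \<rho> \<alpha> p \<le> \<alpha> / (\<alpha> - 1) * log 2 Z"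
    unfolding I_alpha_def R_def[symmetric] by (intro cInf_lower)
qed

text \<open>The limit inferior bounds the exponent from below without asserting that the limit
  exists. Zero error is given the value infinity explicitly, because \<open>log 2 0 = 0\<close> by
  convention would otherwise give exponent zero.\<close>

theorem theorem1:
  fixes k d :: nat and \<rho> :: "nat \<Rightarrow> complex mat" and p :: "nat \<Rightarrow> real" and \<alpha> r :: real
  assumes states: "\<forall>x<k. is_state d (\<rho> x)"
    and p_nonneg: "\<forall>x<k. 0 \<le> p x"
    and p_sum: "(\<Sum>x<k. p x) = 1"
    and alpha_lo: "1/2 \<le> \<alpha>" and alpha_hi: "\<alpha> \<le> 1"
    and r_nonneg: "0 \<le> r"
  shows "liminf (\<lambda>n. if Pe_opt k d \<rho> n r = 0 then PInfty
                      else ereal (- log 2 (Pe_opt k d \<rho> n r) / real n))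
           \<ge> ereal ((1 - \<alpha>) / \<alpha> * (I_alpha k d \<rho> \<alpha> p - r))"
proof (cases "\<alpha> = 1")
  case True
  \<comment> \<open>At \<alpha> = 1 the right-hand side is zero, so it suffices that the error
    probability lies in [0,1]; the value 1 for \<open>s\<close> is an admissible instance.\<close>
  note b = random_coding_bound(1,2)[OF states p_nonneg p_sum, of 1]
  have "0 \<le> liminf (\<lambda>n. if Pe_opt k d \<rho> n r = 0 then PInfty else ereal (- log 2 (Pe_opt k d \<rho> n r) / real n))"
  proof (rule Liminf_bounded, rule always_eventually, rule allI)
    fix n
    show "0 \<le> (if Pe_opt k d \<rho> n r = 0 then PInfty else ereal (- log 2 (Pe_opt k d \<rho> n r) / real n))"
      using b[of n r] by (auto simp: less_le divide_nonpos_nonneg)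
  qed
  thus ?thesis using True by (simp add: zero_ereal_def)
next
  case False
  with alpha_hi have a1: "\<alpha> < 1" by simp
  have a0: "0 < \<alpha>" using alpha_lo by simp
  define s where "s = (1 - \<alpha>) / \<alpha>"
  have s: "0 < s" "s \<le> 1" using a0 a1 alpha_lo by (auto simp: s_def field_simps)
  have s1: "1 + s = 1 / \<alpha>" "1 / (1 + s) = \<alpha>" using a0 by (auto simp: s_def field_simps)
  define Z where "Z = Re (mtrace (mat_powr (mean_mat k d p (\<lambda>x. mat_powr (\<rho> x) \<alpha>)) (1 / \<alpha>)))"
  have Z: "0 < Z" and I: "I_alpha k d \<rho> \<alpha> p \<le> \<alpha> / (\<alpha> - 1) * log 2 Z"
    unfolding Z_def by (rule I_alpha_le[OF states p_nonneg p_sum a0 a1])+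
  have "s * I_alpha k d \<rho> \<alpha> p \<le> s * (\<alpha> / (\<alpha> - 1) * log 2 Z)" using I s by (intro mult_left_mono) auto
  \<comment> \<open>The choice of \<open>s\<close> makes s \<alpha> / (\<alpha> - 1) equal to
    -1.\<close>
  also have "\<dots> = - log 2 Z" using a0 a1 by (simp add: s_def field_simps)
  finally have sI: "s * I_alpha k d \<rho> \<alpha> p \<le> - log 2 Z" .
  let ?f = "\<lambda>n. ereal (s * (I_alpha k d \<rho> \<alpha> p - r) - log 2 (1 + s) / real n)"
  \<comment> \<open>The prefactor 1 + s of the coding bound costs log(1 + s) / n, which vanishes in
    the limit. Positivity of n is needed to cancel it against the division by n.\<close>
  have ev: "\<forall>\<^sub>F n in sequentially. ?f n \<le> (if Pe_opt k d \<rho> n r = 0 then PInfty else ereal (- log 2 (Pe_opt k d \<rho> n r) / real n))"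
    using eventually_gt_at_top[of 0]
  proof eventually_elim
    case (elim n)
    have Pe: "0 \<le> Pe_opt k d \<rho> n r" "Pe_opt k d \<rho> n r \<le> (1 + s) * (2 powr (real n * r)) powr s * Z ^ n"
      using random_coding_bound(1,3)[OF states p_nonneg p_sum s, of n r] unfolding s1 Z_def by auto
    show ?case
    proof (cases "Pe_opt k d \<rho> n r = 0")
      case False
      with Pe have pos: "0 < Pe_opt k d \<rho> n r" by simp
      have "log 2 (Pe_opt k d \<rho> n r) \<le> log 2 ((1 + s) * (2 powr (real n * r)) powr s * Z ^ n)"
        using pos Pe(2) by (intro log_mono) auto
      also have "\<dots> = log 2 (1 + s) + real n * (s * r) + real n * log 2 Z"
        using s Z by (simp add: log_mult log_powr log_nat_power)
      finally have "- log 2 (Pe_opt k d \<rho> n r) \<ge> real n * (s * (I_alpha k d \<rho> \<alpha> p - r)) - log 2 (1 + s)"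
        using mult_left_mono[OF sI, of "real n"] by (simp add: algebra_simps)
      hence "(real n * (s * (I_alpha k d \<rho> \<alpha> p - r)) - log 2 (1 + s)) / real n \<le> - log 2 (Pe_opt k d \<rho> n r) / real n"
        by (intro divide_right_mono) auto
      thus ?thesis using False elim by (simp add: diff_divide_distrib)
    qed simp
  qed
  have "(\<lambda>n. s * (I_alpha k d \<rho> \<alpha> p - r) - log 2 (1 + s) / real n) \<longlonglongrightarrow> s * (I_alpha k d \<rho> \<alpha> p - r) - 0"
    by (intro tendsto_diff tendsto_const lim_const_over_n)
  hence "?f \<longlonglongrightarrow> ereal (s * (I_alpha k d \<rho> \<alpha> p - r))" by simp
  hence "ereal (s * (I_alpha k d \<rho> \<alpha> p - r)) = liminf ?f"
    by (intro lim_imp_Liminf[symmetric]) auto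
  also have "\<dots> \<le> liminf (\<lambda>n. if Pe_opt k d \<rho> n r = 0 then PInfty else ereal (- log 2 (Pe_opt k d \<rho> n r) / real n))"
    by (rule Liminf_mono[OF ev])
  finally show ?thesis unfolding s_def .
qed

end
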